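(* Let $m=m(n)\ge1$ be integers with $m=o(n)$ as $n\to\infty$, and let $h:\mathbb{R}^m\to\mathbb{R}$ be a measurable function (which may depend on $n$). Let $$\sigma_m^2=\sum_{j=-m+1}^{m-1}\operatorname{cov}\big(h(X_0^m),h(X_j^m)\big)-\operatorname{cov}^2\big(h(X_0^m),|X_0^m|\big),$$ $$g(X_0^m)=h(X_0^m)-E h(X_0^m)-(X_0-1)\operatorname{cov}\big(h(X_0^m),|X_0^m|\big),$$ and suppose that for some $r>2$ $$\frac{m^{r-1}}{n^{(r-2)/2}\sigma_m^r}\,E|g(X_0^m)|^r\to0\quad(n\to\infty).$$ Then for $Z_{n,m}=\sum_{k=0}^{n-1}h(nS_k,\dots,nS_{k+m-1})$ we have, as $n\to\infty$, $$\frac{Z_{n,m}-nE h(X_0^m)}{\sigma_m\sqrt n}\xrightarrow{d}\mathcal N(0,1).$$ The same assertion holds for $Z^*_{n,m}=\sum_{k=0}^{n-m-1}h(nS_k,\dots,nS_{k+m-1})$, namely $$\frac{Z^*_{n,m}-nE h(X_0^m)}{\sigma_m\sqrt n}\xrightarrow{d}\mathcal N(0,1);$$ that is, the random variables $Z_{n,m}$ and $Z^*_{n,m}$ have the same asymptotically normal distribution.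
   Context: Spacings: let $0\le U_1\le U_2\le\dots\le U_{n-1}\le 1$ be the ordered version of a sample of size $n-1$ from the uniform distribution on $[0,1]$. Put $U_0=0$, $U_n=1$, and $U_k=1+U_{k-n}$ for $k\ge n$. The simple spacings are $S_k=U_{k+1}-U_k$. Exponentials: $X_0,X_1,\dots,X_{n-1}$ are independent random variables with the standard exponential distribution (mean 1), and $X_{n+j}=X_j$; $X_j^m=(X_j,\dots,X_{j+m-1})$ and $|X_j^m|=X_j+\dots+X_{j+m-1}$. $\xrightarrow{d}$ denotes convergence in distribution; $\mathcal N(0,1)$ denotes a standard normal random variable.
   Formalization: The assertion for Z* is proved under the added hypotheses m·E h/(σ_m√n)→0 and √m·cov(h,|X_0^m|)/(σ_m√n)→0; without them it fails, e.g. m=1, h(x)=x²+n³. The assertion for Z has no such hypothesis. *)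

theory Defs
  imports "HOL-Probability.Probability" "HOL-Library.Landau_Symbols"
begin

text \<open>
  \<open>ustat n V \<omega> k\<close> is \<open>U\<^sub>k\<close>, for the sample \<open>V 0, \<dots>, V (n - 2)\<close> of size \<open>n - 1\<close>. The case
  \<open>n = 0\<close> has no meaning and only makes the function total.
\<close>
function ustat :: "nat \<Rightarrow> (nat \<Rightarrow> 'a \<Rightarrow> real) \<Rightarrow> 'a \<Rightarrow> nat \<Rightarrow> real" where
  "ustat n V \<omega> k =
     (if n = 0 \<or> k = 0 then 0
      else if k < n then sort (map (\<lambda>i. V i \<omega>) [0..<n - 1]) ! (k - 1)
      else 1 + ustat n V \<omega> (k - n))"
  by pat_completeness auto
termination
  by (relation "Wellfounded.measure (\<lambda>(n, V, \<omega>, k). k)") auto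

declare ustat.simps [simp del]

definition spacing :: "nat \<Rightarrow> (nat \<Rightarrow> 'a \<Rightarrow> real) \<Rightarrow> 'a \<Rightarrow> nat \<Rightarrow> real" where
  "spacing n V \<omega> k = ustat n V \<omega> (k + 1) - ustat n V \<omega> k"

text \<open>
  Points of \<open>\<real>\<^sup>m\<close> are the elements of the carrier of \<open>\<Pi>\<^sub>M i\<in>{..<m}. borel\<close>, since \<open>m\<close> depends
  on \<open>n\<close>.
\<close>
definition Z_stat ::
    "nat \<Rightarrow> nat \<Rightarrow> ((nat \<Rightarrow> real) \<Rightarrow> real) \<Rightarrow> (nat \<Rightarrow> 'a \<Rightarrow> real) \<Rightarrow> 'a \<Rightarrow> real" where
  "Z_stat n m h V \<omega> = (\<Sum>k<n. h (\<lambda>i\<in>{..<m}. real n * spacing n V \<omega> (k + i)))"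

definition Z_star_stat ::
    "nat \<Rightarrow> nat \<Rightarrow> ((nat \<Rightarrow> real) \<Rightarrow> real) \<Rightarrow> (nat \<Rightarrow> 'a \<Rightarrow> real) \<Rightarrow> 'a \<Rightarrow> real" where
  "Z_star_stat n m h V \<omega> = (\<Sum>k<n - m. h (\<lambda>i\<in>{..<m}. real n * spacing n V \<omega> (k + i)))"

text \<open>
  \<open>X\<^sub>j\<^sup>m\<close> and its coordinate sum. Reducing the index modulo \<open>n\<close> implements \<open>X\<^bsub>n+j\<^esub> = X\<^sub>j\<close>, also for
  the negative \<open>j\<close> that occur in \<open>\<sigma>\<^sub>m\<^sup>2\<close>.
\<close>
definition block :: "nat \<Rightarrow> nat \<Rightarrow> (nat \<Rightarrow> 'b \<Rightarrow> real) \<Rightarrow> int \<Rightarrow> 'b \<Rightarrow> nat \<Rightarrow> real" where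
  "block n m X j \<omega> = (\<lambda>i\<in>{..<m}. X (nat ((j + int i) mod int n)) \<omega>)"

definition block_sum :: "nat \<Rightarrow> nat \<Rightarrow> (nat \<Rightarrow> 'b \<Rightarrow> real) \<Rightarrow> int \<Rightarrow> 'b \<Rightarrow> real" where
  "block_sum n m X j \<omega> = (\<Sum>i<m. block n m X j \<omega> i)"

definition cov :: "'b measure \<Rightarrow> ('b \<Rightarrow> real) \<Rightarrow> ('b \<Rightarrow> real) \<Rightarrow> real" where
  "cov P f g = (\<integral>\<omega>. (f \<omega> - (\<integral>x. f x \<partial>P)) * (g \<omega> - (\<integral>x. g x \<partial>P)) \<partial>P)"

definition mean_h ::
    "'b measure \<Rightarrow> nat \<Rightarrow> nat \<Rightarrow> (nat \<Rightarrow> 'b \<Rightarrow> real) \<Rightarrow> ((nat \<Rightarrow> real) \<Rightarrow> real) \<Rightarrow> real" where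
  "mean_h P n m X h = (\<integral>\<omega>. h (block n m X 0 \<omega>) \<partial>P)"

definition cov_sum ::
    "'b measure \<Rightarrow> nat \<Rightarrow> nat \<Rightarrow> (nat \<Rightarrow> 'b \<Rightarrow> real) \<Rightarrow> ((nat \<Rightarrow> real) \<Rightarrow> real) \<Rightarrow> real" where
  "cov_sum P n m X h = cov P (\<lambda>\<omega>. h (block n m X 0 \<omega>)) (block_sum n m X 0)"

definition sigma_sq ::
    "'b measure \<Rightarrow> nat \<Rightarrow> nat \<Rightarrow> (nat \<Rightarrow> 'b \<Rightarrow> real) \<Rightarrow> ((nat \<Rightarrow> real) \<Rightarrow> real) \<Rightarrow> real" where
  "sigma_sq P n m X h =
     (\<Sum>j\<in>{- int m + 1..int m - 1}.
        cov P (\<lambda>\<omega>. h (block n m X 0 \<omega>)) (\<lambda>\<omega>. h (block n m X j \<omega>)))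
     - (cov_sum P n m X h)\<^sup>2"

definition sigma_m ::
    "'b measure \<Rightarrow> nat \<Rightarrow> nat \<Rightarrow> (nat \<Rightarrow> 'b \<Rightarrow> real) \<Rightarrow> ((nat \<Rightarrow> real) \<Rightarrow> real) \<Rightarrow> real" where
  "sigma_m P n m X h = sqrt (sigma_sq P n m X h)"

definition g_fun ::
    "'b measure \<Rightarrow> nat \<Rightarrow> nat \<Rightarrow> (nat \<Rightarrow> 'b \<Rightarrow> real) \<Rightarrow> ((nat \<Rightarrow> real) \<Rightarrow> real) \<Rightarrow> 'b \<Rightarrow> real" where
  "g_fun P n m X h \<omega> =
     h (block n m X 0 \<omega>) - mean_h P n m X h - (X 0 \<omega> - 1) * cov_sum P n m X h"

text \<open>
  This condition is used for \<open>Z\<^sup>*\<close> only. The difference of \<open>Z\<close> and \<open>Z\<^sup>*\<close> is a sum over the last \<open>m\<close>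
  blocks; its part that is not controlled by \<open>g\<close> is
  \<open>m E h(X\<^sub>0\<^sup>m) + cov(h(X\<^sub>0\<^sup>m), |X\<^sub>0\<^sup>m|) \<Sum>\<^bsub>k=n-m\<^esub>\<^bsup>n-1\<^esup> (n S\<^sub>k - 1)\<close>, where the last sum has order \<open>\<surd>m\<close>.
  The condition says that this part is negligible at the scale \<open>\<sigma>\<^sub>m \<surd>n\<close>, and it holds automatically
  if \<open>m\<close> and \<open>h\<close> do not depend on \<open>n\<close>.

  For \<open>h\<close> depending on \<open>n\<close> it does not follow from the moment condition on \<open>g\<close>, because \<open>g\<close> and
  \<open>\<sigma>\<^sub>m\<close> do not change if a constant or a multiple of \<open>x\<^sub>0 - 1\<close> is added to \<open>h\<close>, and without it the
  assertion on \<open>Z\<^sup>*\<close> fails: for \<open>m = 1\<close> and \<open>h(x) = x\<^sup>2 + n\<^sup>3\<close> one has \<open>\<sigma>\<^sub>m\<^sup>2 = 4\<close>, the moment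
  condition holds for every \<open>r > 2\<close>, but \<open>Z\<^sup>* - n E h \<le> n\<^sup>2 + (n - 1) n\<^sup>3 - n (n\<^sup>3 + 2) = n\<^sup>2 - n\<^sup>3 - 2 n\<close>
  almost surely, so that \<open>(Z\<^sup>* - n E h) / (\<sigma>\<^sub>m \<surd>n)\<close> tends to minus infinity.
\<close>
definition edge_negligible ::
    "'b measure \<Rightarrow> (nat \<Rightarrow> nat) \<Rightarrow> (nat \<Rightarrow> 'b \<Rightarrow> real) \<Rightarrow> (nat \<Rightarrow> (nat \<Rightarrow> real) \<Rightarrow> real) \<Rightarrow> bool" where
  "edge_negligible P m X h \<longleftrightarrow>
     (\<lambda>n. real (m n) * mean_h P n (m n) X (h n) / (sigma_m P n (m n) X (h n) * sqrt (real n)))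
       \<longlonglongrightarrow> 0 \<and>
     (\<lambda>n. sqrt (real (m n)) * cov_sum P n (m n) X (h n) / (sigma_m P n (m n) X (h n) * sqrt (real n)))
       \<longlonglongrightarrow> 0"

end

theory Submission
  imports Defs "HOL-Combinatorics.Permutations" "HOL-Number_Theory.Cong"
begin

text \<open>
  Given \<open>X\<^sub>0 + \<dots> + X\<^bsub>n-1\<^esub> = n\<close>, the exponentials are distributed as the spacings multiplied by \<open>n\<close>, and the
  centred statistic is then the sum of the terms \<open>g(X\<^sub>k\<^sup>m)\<close>, which is uncorrelated with the sum of the
  \<open>X\<^sub>k\<close>. Terms are grouped into blocks of length \<open>m\<close>, and each block sum is replaced by a martingale
  difference that depends on two neighbouring blocks only and whose variance is exactly \<open>m \<sigma>\<^sub>m\<^sup>2\<close>.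
  The exact variance matters: the variance of the block sums themselves need not be of the order
  \<open>m \<sigma>\<^sub>m\<^sup>2\<close>. Without every \<open>q\<close>-th martingale difference one is left with a sum of independent
  identically distributed variables, and the moment condition with exponent \<open>r\<close> gives the limit of
  the joint characteristic function of this sum and the coordinate sum.

  The conditioning is removed as follows. With respect to the exponentials, the first
  \<open>d \<approx> (1 - 1 / q) n\<close> spacings have a density that is a Gamma density evaluated at
  \<open>n - (X\<^sub>0 + \<dots> + X\<^bsub>d-1\<^esub>)\<close>, and after normalisation it approaches \<open>exp (- q s\<^sup>2 / 2)\<close>, where
  \<open>s \<surd>n\<close> is the centred coordinate sum. As this is itself the characteristic function of a normal
  distribution, the conditional characteristic function becomes an average of the joint
  characteristic functions of the exponentials. The omitted terms are estimated by second moments,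
  where the invariance of the spacings under rotation allows one to move them into the first \<open>d\<close>
  coordinates. Letting \<open>q\<close> tend to infinity, one concludes by the continuity theorem of Levy.
\<close>

section \<open>Functions of independent sequences\<close>

text \<open>The parameter q balances two effects. Passing from the exponentials to the spacings
  costs a factor 1 / E \<open>kern\<close>, because \<open>kern\<close> is at most 1, and this
  factor tends to sqrt q. The omitted martingale differences and the tail behind the first
  \<open>d\<close> coordinates have second moments of order 1 / q. Their second moment under the
  spacings is then asymptotically at most 8 / sqrt q, which is small for large q.

  Write \<rho> = (q - 1) / q. The retained sum and the scaled coordinate sum of the first
  \<open>d\<close> exponentials have independent normal limits of variances \<rho>^2 and \<rho>; the
  independence comes from the zero covariances that the correction term of g produces. Averaging exp
  (- \<rho> u^2 / 2) over u = sqrt q N, with N standard normal, gives 1 / sqrt (1 + \<rho> q) = 1 /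
  sqrt q, whatever the argument s of the characteristic function. The normalisation of
  \<open>kern\<close> contributes the same factor, so that it cancels and exp (- \<rho>^2 s^2 / 2)
  remains.\<close>

definition shf :: "nat \<Rightarrow> (nat \<Rightarrow> 'a) \<Rightarrow> nat \<Rightarrow> 'a" where
  "shf k x = (\<lambda>i. x (k + i))"

text \<open>Stands for measurability with respect to the first \<open>k\<close> coordinates.
  Together with \<open>comb_seq\<close>, which keeps the first \<open>k\<close> coordinates and
  resamples the rest, it allows conditional expectations to be written as plain integrals.\<close>

definition dep :: "nat \<Rightarrow> ((nat \<Rightarrow> 'a) \<Rightarrow> 'b) \<Rightarrow> bool" where
  "dep k f \<longleftrightarrow> (\<forall>x y. (\<forall>i<k. x i = y i) \<longrightarrow> f x = f y)"

lemma depI: "(\<And>x y. (\<And>i. i < k \<Longrightarrow> x i = y i) \<Longrightarrow> f x = f y) \<Longrightarrow> dep k f"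
  unfolding dep_def by blast

lemma depD: "dep k f \<Longrightarrow> (\<And>i. i < k \<Longrightarrow> x i = y i) \<Longrightarrow> f x = f y"
  unfolding dep_def by blast

lemma dep_mono: "dep k f \<Longrightarrow> k \<le> l \<Longrightarrow> dep l f"
  unfolding dep_def by (meson order_less_le_trans)

lemma dep_shf: "dep k f \<Longrightarrow> a + k \<le> l \<Longrightarrow> dep l (\<lambda>x. f (shf a x))"
  by (rule depI, erule depD) (simp add: shf_def)

lemma dep_comp2:
  assumes "dep k f" "dep k g"
  shows "dep k (\<lambda>x. F (f x) (g x))"
proof (rule depI)
  fix x y :: "nat \<Rightarrow> 'a"
  assume xy: "\<And>i. i < k \<Longrightarrow> x i = y i"
  have "f x = f y"
    by (rule depD[OF assms(1)]) (rule xy)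
  moreover have "g x = g y"
    by (rule depD[OF assms(2)]) (rule xy)
  ultimately show "F (f x) (g x) = F (f y) (g y)"
    by simp
qed

lemma dep_comp: "dep k f \<Longrightarrow> dep k (\<lambda>x. F (f x))"
  by (rule dep_comp2[where F = "\<lambda>a _. F a"])

lemma dep_sum: "(\<And>i. i \<in> I \<Longrightarrow> dep k (f i)) \<Longrightarrow> dep k (\<lambda>x. \<Sum>i\<in>I. f i x)"
  by (rule depI, rule sum.cong) (auto intro: depD)

lemma shf_shf [simp]: "shf a (shf b x) = shf (a + b) x"
  by (simp add: shf_def ac_simps)

lemma shf_0 [simp]: "shf 0 x = x"
  by (simp add: shf_def)

lemma shf_comb_seq [simp]: "shf k (comb_seq k x z) = z"
  by (auto simp: shf_def comb_seq_def)

lemma dep_comb_seq: "dep k f \<Longrightarrow> f (comb_seq k x z) = f x"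
  by (erule depD) (simp add: comb_seq_def)

context sequence_space
begin

text \<open>An injective choice of coordinates of an i.i.d. sequence is again an i.i.d. sequence
  with the same law. This serves for shifts, for permutations of the sample, and for the cyclic
  rotation behind the covariances at negative indices.\<close>

lemma distr_reindex:
  assumes "inj t"
  shows "(\<lambda>x i. x (t i)) \<in> S \<rightarrow>\<^sub>M S" "distr S S (\<lambda>x i. x (t i)) = S"
proof -
  have eq: "(\<lambda>x i. x (t i)) = (\<lambda>x. \<lambda>n\<in>UNIV. x (t n))" by (simp add: restrict_def)
  show "(\<lambda>x i. x (t i)) \<in> S \<rightarrow>\<^sub>M S"
    unfolding eq by (intro measurable_restrict measurable_component_singleton) auto
  show "distr S S (\<lambda>x i. x (t i)) = S"
    unfolding eq by (rule distr_PiM_reindex) (use assms in \<open>auto simp: prob_space\<close>)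
qed

lemma integral_reindex:
  fixes f :: "_ \<Rightarrow> 'b::{banach, second_countable_topology}"
  assumes "f \<in> borel_measurable S" and t: "inj t"
  shows "(\<integral>x. f (\<lambda>i. x (t i)) \<partial>S) = (\<integral>x. f x \<partial>S)"
proof -
  have "(\<integral>x. f x \<partial>S) = (\<integral>x. f x \<partial>distr S S (\<lambda>x i. x (t i)))"
    by (simp only: distr_reindex(2)[OF t])
  also have "\<dots> = (\<integral>x. f (\<lambda>i. x (t i)) \<partial>S)"
    by (rule integral_distr[OF distr_reindex(1)[OF t] assms(1)])
  finally show ?thesis by simp
qed

lemma shf_reindex: "shf k = (\<lambda>x i. x (k + i))"
  by (simp add: fun_eq_iff shf_def)

lemma measurable_shf [measurable]: "shf k \<in> S \<rightarrow>\<^sub>M S"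
  unfolding shf_reindex by (rule distr_reindex) (simp add: inj_on_def)

lemma distr_shf: "distr S S (shf k) = S"
  unfolding shf_reindex by (rule distr_reindex) (simp add: inj_on_def)

lemma integral_shf:
  fixes f :: "_ \<Rightarrow> 'b::{banach, second_countable_topology}"
  assumes [measurable]: "f \<in> borel_measurable S"
  shows "(\<integral>x. f (shf k x) \<partial>S) = (\<integral>x. f x \<partial>S)"
  unfolding shf_reindex by (rule integral_reindex[OF assms]) (simp add: inj_on_def)

lemma integrable_shf:
  fixes f :: "_ \<Rightarrow> 'b::{banach, second_countable_topology}"
  assumes "integrable S f"
  shows "integrable S (\<lambda>x. f (shf k x))"
  by (rule integrable_distr[of _ S S]) (simp_all add: distr_shf assms)

lemma pair_sigma_finite_S: "pair_sigma_finite S S"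
  by (simp add: pair_sigma_finite_def P.sigma_finite_measure_axioms)

lemma nn_integral_comb_seq:
  assumes [measurable]: "f \<in> borel_measurable S"
  shows "(\<integral>\<^sup>+x. f x \<partial>S) = (\<integral>\<^sup>+x. \<integral>\<^sup>+z. f (comb_seq k x z) \<partial>S \<partial>S)"
proof -
  interpret PS: pair_sigma_finite S S by (rule pair_sigma_finite_S)
  have "(\<integral>\<^sup>+x. f x \<partial>S) = (\<integral>\<^sup>+x. f x \<partial>distr (S \<Otimes>\<^sub>M S) S (\<lambda>(\<omega>, \<omega>'). comb_seq k \<omega> \<omega>'))"
    by (simp add: PiM_comb_seq)
  also have "\<dots> = (\<integral>\<^sup>+p. f (case p of (\<omega>, \<omega>') \<Rightarrow> comb_seq k \<omega> \<omega>') \<partial>(S \<Otimes>\<^sub>M S))"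
    by (rule nn_integral_distr) auto
  also have "\<dots> = (\<integral>\<^sup>+x. \<integral>\<^sup>+z. f (comb_seq k x z) \<partial>S \<partial>S)"
    by (subst P.nn_integral_fst[symmetric]) auto
  finally show ?thesis .
qed

text \<open>Fubini at coordinate \<open>k\<close>. The inner integral is a version of the
  conditional expectation given the first \<open>k\<close> coordinates, and as a function of
  \<open>x\<close> it is defined everywhere.\<close>

lemma
  fixes f :: "_ \<Rightarrow> 'b::{banach, second_countable_topology}"
  assumes f: "integrable S f"
  shows integrable_comb_seq_pair:
      "integrable (S \<Otimes>\<^sub>M S) (\<lambda>p. f (case p of (\<omega>, \<omega>') \<Rightarrow> comb_seq k \<omega> \<omega>'))"
    and integrable_integral_comb_seq: "integrable S (\<lambda>x. \<integral>z. f (comb_seq k x z) \<partial>S)"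
    and AE_integrable_comb_seq: "AE x in S. integrable S (\<lambda>z. f (comb_seq k x z))"
    and integral_comb_seq: "(\<integral>x. f x \<partial>S) = (\<integral>x. \<integral>z. f (comb_seq k x z) \<partial>S \<partial>S)"
proof -
  interpret PS: pair_sigma_finite S S by (rule pair_sigma_finite_S)
  have [measurable]: "f \<in> borel_measurable S" using f by auto
  show 1: "integrable (S \<Otimes>\<^sub>M S) (\<lambda>p. f (case p of (\<omega>, \<omega>') \<Rightarrow> comb_seq k \<omega> \<omega>'))"
    by (rule integrable_distr[of _ _ S]) (simp_all add: PiM_comb_seq f)
  then have 2: "integrable (S \<Otimes>\<^sub>M S) (\<lambda>(x, z). f (comb_seq k x z))"
    by (simp add: split_beta')
  show "integrable S (\<lambda>x. \<integral>z. f (comb_seq k x z) \<partial>S)"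
    using PS.integrable_fst'[OF 1] by simp
  show "AE x in S. integrable S (\<lambda>z. f (comb_seq k x z))"
    using PS.AE_integrable_fst'[OF 1] by simp
  have "(\<integral>x. f x \<partial>S) = (\<integral>x. f x \<partial>distr (S \<Otimes>\<^sub>M S) S (\<lambda>(\<omega>, \<omega>'). comb_seq k \<omega> \<omega>'))"
    by (simp add: PiM_comb_seq)
  also have "\<dots> = (\<integral>p. f (case p of (\<omega>, \<omega>') \<Rightarrow> comb_seq k \<omega> \<omega>') \<partial>(S \<Otimes>\<^sub>M S))"
    by (rule integral_distr) auto
  also have "\<dots> = (\<integral>x. \<integral>z. f (comb_seq k x z) \<partial>S \<partial>S)"
    using PS.integral_fst'[OF 1] by simp
  finally show "(\<integral>x. f x \<partial>S) = (\<integral>x. \<integral>z. f (comb_seq k x z) \<partial>S \<partial>S)" .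
qed

text \<open>Independence of the first \<open>k\<close> coordinates and the remaining ones, in the
  form of a product formula.\<close>

lemma
  fixes f g :: "_ \<Rightarrow> 'b::{real_normed_field, banach, second_countable_topology}"
  assumes f: "integrable S f" and g: "integrable S g" and dep: "dep k f"
  shows integrable_mult_shf: "integrable S (\<lambda>x. f x * g (shf k x))"
    and integral_mult_shf: "(\<integral>x. f x * g (shf k x) \<partial>S) = (\<integral>x. f x \<partial>S) * (\<integral>x. g x \<partial>S)"
proof -
  interpret PS: pair_sigma_finite S S by (rule pair_sigma_finite_S)
  have [measurable]: "f \<in> borel_measurable S" "g \<in> borel_measurable S" using f g by auto
  show 1: "integrable S (\<lambda>x. f x * g (shf k x))"
  proof (rule integrableI_bounded)
    have "(\<integral>\<^sup>+x. ennreal (norm (f x * g (shf k x))) \<partial>S)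
        = (\<integral>\<^sup>+x. \<integral>\<^sup>+z. ennreal (norm (f x)) * ennreal (norm (g z)) \<partial>S \<partial>S)"
      by (subst nn_integral_comb_seq[of _ k])
        (auto simp: dep_comb_seq[OF dep] norm_mult ennreal_mult)
    also have "\<dots> = (\<integral>\<^sup>+x. ennreal (norm (f x)) \<partial>S) * (\<integral>\<^sup>+z. ennreal (norm (g z)) \<partial>S)"
      by (simp add: nn_integral_cmult nn_integral_multc)
    also have "\<dots> < \<infinity>"
      using f g by (auto simp: integrable_iff_bounded ennreal_mult_less_top)
    finally show "(\<integral>\<^sup>+x. ennreal (norm (f x * g (shf k x))) \<partial>S) < \<infinity>" .
  qed auto
  show "(\<integral>x. f x * g (shf k x) \<partial>S) = (\<integral>x. f x \<partial>S) * (\<integral>x. g x \<partial>S)"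
    by (subst integral_comb_seq[OF 1, of k]) (simp add: dep_comb_seq[OF dep])
qed

definition sqi :: "((nat \<Rightarrow> 'a) \<Rightarrow> real) \<Rightarrow> bool" where
  "sqi f \<longleftrightarrow> f \<in> borel_measurable S \<and> integrable S (\<lambda>x. (f x)\<^sup>2)"

lemma sqi_measurable [measurable_dest]: "sqi f \<Longrightarrow> f \<in> borel_measurable S"
  by (simp add: sqi_def)

lemma sqi_integrable_sq: "sqi f \<Longrightarrow> integrable S (\<lambda>x. (f x)\<^sup>2)"
  by (simp add: sqi_def)

lemma sqi_integrable_mult:
  assumes f: "sqi f" and g: "sqi g"
  shows "integrable S (\<lambda>x. f x * g x)"
proof (rule Bochner_Integration.integrable_bound)
  show "integrable S (\<lambda>x. (f x)\<^sup>2 + (g x)\<^sup>2)"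
    using f g by (simp add: sqi_def)
  have [measurable]: "f \<in> borel_measurable S" "g \<in> borel_measurable S"
    using f g by (simp_all add: sqi_def)
  show "(\<lambda>x. f x * g x) \<in> borel_measurable S"
    by (intro borel_measurable_times) fact+
  have "\<bar>a * b\<bar> \<le> a\<^sup>2 + b\<^sup>2" for a b :: real
  proof -
    have "2 * \<bar>a * b\<bar> \<le> a\<^sup>2 + b\<^sup>2"
      using sum_squares_bound[of "\<bar>a\<bar>" "\<bar>b\<bar>"] by (simp add: abs_mult)
    moreover have "0 \<le> \<bar>a * b\<bar>" by simp
    ultimately show ?thesis by linarith
  qed
  then show "AE x in S. norm (f x * g x) \<le> norm ((f x)\<^sup>2 + (g x)\<^sup>2)"
    by auto
qed

lemma sqi_const [simp]: "sqi (\<lambda>x. c)"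
  by (simp add: sqi_def)

lemma sqi_integrable: "sqi f \<Longrightarrow> integrable S f"
  using sqi_integrable_mult[of f "\<lambda>_. 1"] by simp

lemma sqi_add: "sqi f \<Longrightarrow> sqi g \<Longrightarrow> sqi (\<lambda>x. f x + g x)"
  using sqi_integrable_mult[of f g] unfolding sqi_def power2_sum mult.assoc
  by (intro conjI borel_measurable_add Bochner_Integration.integrable_add integrable_mult_right) auto

lemma sqi_cmult: "sqi f \<Longrightarrow> sqi (\<lambda>x. c * f x)"
  by (auto simp: sqi_def power_mult_distrib)

lemma sqi_minus: "sqi f \<Longrightarrow> sqi g \<Longrightarrow> sqi (\<lambda>x. f x - g x)"
  using sqi_add[of f "\<lambda>x. (-1) * g x"] sqi_cmult[of g "-1"] by simp

lemma sqi_sum: "(\<And>i. i \<in> I \<Longrightarrow> sqi (f i)) \<Longrightarrow> sqi (\<lambda>x. \<Sum>i\<in>I. f i x)"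
  by (induction I rule: infinite_finite_induct) (auto intro: sqi_add)

lemma sqi_shf: "sqi f \<Longrightarrow> sqi (\<lambda>x. f (shf k x))"
  using integrable_shf[of "\<lambda>x. (f x)\<^sup>2"] by (auto simp: sqi_def)

lemmas sqi_intros = sqi_add sqi_cmult sqi_minus sqi_sum sqi_shf sqi_const

lemma integral_mult_far:
  assumes "sqi f" "sqi g" "dep k f" "k \<le> l"
  shows "(\<integral>x. f x * g (shf l x) \<partial>S) = (\<integral>x. f x \<partial>S) * (\<integral>x. g x \<partial>S)"
  using assms by (intro integral_mult_shf) (auto intro: sqi_integrable dep_mono)

lemma integral_mult_shf_shf:
  assumes "sqi f" "sqi g"
  shows "(\<integral>x. f (shf k x) * g (shf (k + l) x) \<partial>S) = (\<integral>x. f x * g (shf l x) \<partial>S)"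
proof -
  have [measurable]: "f \<in> borel_measurable S" "g \<in> borel_measurable S"
    using assms by (auto simp: sqi_def)
  have "(\<integral>x. f (shf k x) * g (shf (k + l) x) \<partial>S) = (\<integral>x. (\<lambda>x. f x * g (shf l x)) (shf k x) \<partial>S)"
    by (simp add: add.commute)
  also have "\<dots> = (\<integral>x. f x * g (shf l x) \<partial>S)"
    by (rule integral_shf) auto
  finally show ?thesis .
qed

end

section \<open>Convexity, orthogonal sums and moments of conditional expectations\<close>

lemma convex_on_abs_powr:
  fixes p :: real
  assumes "p \<ge> 1"
  shows "convex_on UNIV (\<lambda>x::real. \<bar>x\<bar> powr p)"
proof (rule convex_onI)
  fix t x y :: real
  assume t: "0 < t" "t < 1"
  \<comment> \<open>Convexity comes from the open half line. A vanishing \<open>a\<close> or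
    \<open>b\<close> is treated separately, where the claim reduces to w powr p \<le> w on the unit
    interval.\<close>
  have pos: "(u * a + v * b) powr p \<le> u * a powr p + v * b powr p"
    if h: "u \<ge> 0" "v \<ge> 0" "u + v = 1" "a \<ge> 0" "b \<ge> 0" for u v a b :: real
  proof -
    have le1: "w powr p \<le> w" if "0 \<le> w" "w \<le> 1" for w :: real
      using powr_mono'[of 1 p w] that assms by simp
    consider "a = 0" | "b = 0" | "a > 0" "b > 0"
      using h(4,5) by linarith
    then show ?thesis
    proof cases
      case 1
      then show ?thesis
        using h assms le1[of v] by (simp add: powr_mult mult_right_mono)
    next
      case 2
      then show ?thesis
        using h assms le1[of u] by (simp add: powr_mult mult_right_mono)
    next
      case 3
      have u: "u = 1 - v" using h by simp
      from 3 show ?thesis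
        unfolding u using convex_onD[OF powr_convex[OF assms], of v a b] h by simp
    qed
  qed
  have "\<bar>(1 - t) *\<^sub>R x + t *\<^sub>R y\<bar> powr p \<le> ((1 - t) * \<bar>x\<bar> + t * \<bar>y\<bar>) powr p"
    using t assms by (intro powr_mono2 order_trans[OF abs_triangle_ineq]) (auto simp: abs_mult)
  also have "\<dots> \<le> (1 - t) * \<bar>x\<bar> powr p + t * \<bar>y\<bar> powr p"
    by (rule pos) (use t in auto)
  finally show "\<bar>(1 - t) *\<^sub>R x + t *\<^sub>R y\<bar> powr p \<le> (1 - t) * \<bar>x\<bar> powr p + t * \<bar>y\<bar> powr p" .
qed auto

text \<open>Jensen's inequality with equal weights \<open>1 / card I\<close>.\<close>

lemma abs_sum_powr_le:
  fixes f :: "'i \<Rightarrow> real"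
  assumes "p \<ge> 1" "finite I"
  shows "\<bar>\<Sum>i\<in>I. f i\<bar> powr p \<le> real (card I) powr (p - 1) * (\<Sum>i\<in>I. \<bar>f i\<bar> powr p)"
proof (cases "I = {}")
  case False
  define c where "c = real (card I)"
  have c: "c > 0" using False assms by (simp add: c_def card_gt_0_iff)
  have "\<bar>\<Sum>i\<in>I. (1 / c) *\<^sub>R f i\<bar> powr p \<le> (\<Sum>i\<in>I. (1 / c) * \<bar>f i\<bar> powr p)"
    using False assms c
    by (intro convex_on_sum[OF _ _ convex_on_abs_powr]) (auto simp: c_def)
  then have "\<bar>(\<Sum>i\<in>I. f i) / c\<bar> powr p \<le> (\<Sum>i\<in>I. \<bar>f i\<bar> powr p) / c"
    by (simp add: sum_divide_distrib)
  then have "\<bar>\<Sum>i\<in>I. f i\<bar> powr p / c powr p \<le> (\<Sum>i\<in>I. \<bar>f i\<bar> powr p) / c"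
    using c by (simp add: powr_divide abs_divide)
  then have "\<bar>\<Sum>i\<in>I. f i\<bar> powr p \<le> (c powr p / c) * (\<Sum>i\<in>I. \<bar>f i\<bar> powr p)"
    using c by (simp add: field_simps)
  then show ?thesis
    using c by (simp add: c_def[symmetric] powr_diff)
qed simp

context sequence_space
begin

lemma integral_orthogonal_sum_sq:
  assumes "finite I" "\<And>i. i \<in> I \<Longrightarrow> sqi (f i)"
    and "\<And>i j. i \<in> I \<Longrightarrow> j \<in> I \<Longrightarrow> i \<noteq> j \<Longrightarrow> (\<integral>x. f i x * f j x \<partial>S) = 0"
  shows "(\<integral>x. (\<Sum>i\<in>I. f i x)\<^sup>2 \<partial>S) = (\<Sum>i\<in>I. \<integral>x. (f i x)\<^sup>2 \<partial>S)"
proof -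
  have "(\<integral>x. (\<Sum>i\<in>I. f i x)\<^sup>2 \<partial>S) = (\<Sum>i\<in>I. \<Sum>j\<in>I. \<integral>x. f i x * f j x \<partial>S)"
    using assms(2)
    by (simp add: power2_eq_square sum_product sqi_integrable_mult)
  also have "\<dots> = (\<Sum>i\<in>I. \<integral>x. (f i x)\<^sup>2 \<partial>S)"
  proof (rule sum.cong)
    fix i assume i: "i \<in> I"
    have "(\<Sum>j\<in>I. \<integral>x. f i x * f j x \<partial>S) = (\<Sum>j\<in>I. if j = i then \<integral>x. (f i x)\<^sup>2 \<partial>S else 0)"
      using assms(3) i by (intro sum.cong) (auto simp: power2_eq_square)
    then show "(\<Sum>j\<in>I. \<integral>x. f i x * f j x \<partial>S) = (\<integral>x. (f i x)\<^sup>2 \<partial>S)"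
      using i assms(1) by simp
  qed simp
  finally show ?thesis .
qed

text \<open>Jensen's inequality is applied to the inner integral for almost every \<open>x\<close>,
  namely where both \<open>f\<close> and its power are integrable over the tail.\<close>

lemma
  fixes f :: "_ \<Rightarrow> real"
  assumes f: "integrable S f" and p: "p \<ge> 1" and fp: "integrable S (\<lambda>x. \<bar>f x\<bar> powr p)"
  shows integrable_cond_powr: "integrable S (\<lambda>x. \<bar>\<integral>z. f (comb_seq k x z) \<partial>S\<bar> powr p)"
    and integral_cond_powr_le:
      "(\<integral>x. \<bar>\<integral>z. f (comb_seq k x z) \<partial>S\<bar> powr p \<partial>S) \<le> (\<integral>x. \<bar>f x\<bar> powr p \<partial>S)"
proof -
  define c where "c x = (\<integral>z. f (comb_seq k x z) \<partial>S)" for x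
  define d where "d x = (\<integral>z. \<bar>f (comb_seq k x z)\<bar> powr p \<partial>S)" for x
  have c: "integrable S c"
    unfolding c_def by (rule integrable_integral_comb_seq[OF f])
  have d: "integrable S d"
    unfolding d_def by (rule integrable_integral_comb_seq[OF fp])
  have le: "AE x in S. \<bar>c x\<bar> powr p \<le> d x"
    using AE_integrable_comb_seq[OF f, of k] AE_integrable_comb_seq[OF fp, of k]
  proof eventually_elim
    case (elim x)
    show ?case
      unfolding c_def d_def using elim p
      by (intro P.jensens_inequality[where q = "\<lambda>x::real. \<bar>x\<bar> powr p" and I = UNIV] convex_on_abs_powr) auto
  qed
  have [measurable]: "c \<in> borel_measurable S" using c by auto
  show 1: "integrable S (\<lambda>x. \<bar>\<integral>z. f (comb_seq k x z) \<partial>S\<bar> powr p)"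
    unfolding c_def[symmetric]
    by (rule Bochner_Integration.integrable_bound[OF d]) (use le in auto)
  have "(\<integral>x. \<bar>c x\<bar> powr p \<partial>S) \<le> (\<integral>x. d x \<partial>S)"
    by (rule integral_mono_AE) (use 1 d le in \<open>auto simp: c_def\<close>)
  also have "\<dots> = (\<integral>x. \<bar>f x\<bar> powr p \<partial>S)"
    unfolding d_def by (rule integral_comb_seq[OF fp, symmetric])
  finally show "(\<integral>x. \<bar>\<integral>z. f (comb_seq k x z) \<partial>S\<bar> powr p \<partial>S) \<le> (\<integral>x. \<bar>f x\<bar> powr p \<partial>S)"
    by (simp add: c_def)
qed

lemma
  assumes f: "sqi f"
  shows sqi_cond: "sqi (\<lambda>x. \<integral>z. f (comb_seq k x z) \<partial>S)"
    and integral_cond_sq_le: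
      "(\<integral>x. (\<integral>z. f (comb_seq k x z) \<partial>S)\<^sup>2 \<partial>S) \<le> (\<integral>x. (f x)\<^sup>2 \<partial>S)"
proof -
  have sq: "(\<lambda>x. \<bar>h x\<bar> powr 2) = (\<lambda>x. (h x)\<^sup>2)" for h :: "_ \<Rightarrow> real"
    by (auto simp: powr_numeral)
  have 1: "integrable S f" and 2: "integrable S (\<lambda>x. \<bar>f x\<bar> powr 2)"
    using f by (auto simp: sq sqi_def intro: sqi_integrable)
  show "sqi (\<lambda>x. \<integral>z. f (comb_seq k x z) \<partial>S)"
    unfolding sqi_def
    using integrable_cond_powr[OF 1 _ 2, of k] integrable_integral_comb_seq[OF 1, of k] by (auto simp: sq)
  show "(\<integral>x. (\<integral>z. f (comb_seq k x z) \<partial>S)\<^sup>2 \<partial>S) \<le> (\<integral>x. (f x)\<^sup>2 \<partial>S)"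
    using integral_cond_powr_le[OF 1 _ 2, of k] by (simp add: sq)
qed

end

section \<open>Martingale differences of dependent sequences\<close>

text \<open>The shifts of \<open>g\<close> form a centred stationary sequence whose terms at
  distance at least \<open>m\<close> are independent; \<tau> is its long run variance, and
  \<open>e\<close> is the single-coordinate term whose sums the conditioning controls. As
  coordinates from \<open>m\<close> on are independent of \<open>g\<close>,
  \<open>g_e_uncorrelated\<close> extends to every longer sum of shifts of \<open>e\<close>.\<close>

locale dependent_sequence = sequence_space M for M :: "'a measure" +
  fixes m :: nat and g :: "(nat \<Rightarrow> 'a) \<Rightarrow> real" and e :: "(nat \<Rightarrow> 'a) \<Rightarrow> real" and \<tau> :: real
  assumes m_pos: "m \<ge> 1"
    and g_sqi: "sqi g" and g_dep: "dep m g" and g_mean: "(\<integral>x. g x \<partial>S) = 0"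
    and e_sqi: "sqi e" and e_dep: "dep 1 e" and e_mean: "(\<integral>x. e x \<partial>S) = 0"
    and long_run_variance:
      "(\<integral>x. (g x)\<^sup>2 \<partial>S) + 2 * (\<Sum>j=1..m-1. \<integral>x. g x * g (shf j x) \<partial>S) = \<tau>"
    and g_e_uncorrelated: "(\<integral>x. g x * (\<Sum>j<m. e (shf j x)) \<partial>S) = 0"
    and \<tau>_nonneg: "\<tau> \<ge> 0"
begin

definition gsum :: "nat \<Rightarrow> (nat \<Rightarrow> 'a) \<Rightarrow> real" where
  "gsum a x = (\<Sum>k<a. g (shf k x))"

text \<open>
  \<open>cond\<close> is the conditional expectation of a block sum given the first of the two blocks on which it
  depends. Subtracting it from the block sum and adding the same for the second block gives a
  martingale difference, and changes sums of block sums by a telescoping sum only.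
\<close>
definition cond :: "(nat \<Rightarrow> 'a) \<Rightarrow> real" where
  "cond x = (\<integral>z. gsum m (comb_seq m x z) \<partial>S)"

definition mdiff :: "(nat \<Rightarrow> 'a) \<Rightarrow> real" where
  "mdiff x = gsum m x - cond x + cond (shf m x)"

definition lin :: "(nat \<Rightarrow> 'a) \<Rightarrow> real" where
  "lin x = (\<Sum>j<m. e (shf j x))"

definition gvar :: real where "gvar = (\<integral>x. (g x)\<^sup>2 \<partial>S)"
definition evar :: real where "evar = (\<integral>x. (e x)\<^sup>2 \<partial>S)"

lemma gsum_sqi: "sqi (gsum a)"
  unfolding gsum_def[abs_def] by (intro sqi_intros g_sqi)

lemma gsum_dep: "a + m \<le> Suc l \<Longrightarrow> dep l (gsum a)"
  unfolding gsum_def[abs_def] by (intro dep_sum dep_shf[OF g_dep]) auto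

lemma gsum_mean: "(\<integral>x. gsum a x \<partial>S) = 0"
  using g_sqi integral_shf[of g]
  by (simp add: gsum_def[abs_def] sqi_integrable sqi_shf g_mean sqi_measurable)

lemma lin_sqi: "sqi lin"
  unfolding lin_def[abs_def] by (intro sqi_intros e_sqi)

lemma lin_dep: "dep m lin"
  unfolding lin_def[abs_def] by (intro dep_sum dep_shf[OF e_dep]) auto

lemma lin_mean: "(\<integral>x. lin x \<partial>S) = 0"
  using e_sqi integral_shf[of e]
  by (simp add: lin_def[abs_def] sqi_integrable sqi_shf e_mean sqi_measurable)

lemma cond_sqi: "sqi cond"
  unfolding cond_def[abs_def] by (rule sqi_cond[OF gsum_sqi])

lemma cond_dep: "dep m cond"
proof (rule depI)
  fix x y :: "nat \<Rightarrow> 'a" assume "\<And>i. i < m \<Longrightarrow> x i = y i"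
  then have "comb_seq m x z = comb_seq m y z" for z
    by (auto simp: comb_seq_def)
  then show "cond x = cond y"
    by (simp add: cond_def)
qed

lemma cond_mean: "(\<integral>x. cond x \<partial>S) = 0"
  unfolding cond_def by (simp add: integral_comb_seq[symmetric] sqi_integrable gsum_sqi gsum_mean)

lemma mdiff_sqi: "sqi mdiff"
  unfolding mdiff_def[abs_def] by (intro sqi_intros gsum_sqi cond_sqi)

lemma mdiff_dep: "dep (2 * m) mdiff"
  unfolding mdiff_def[abs_def] using m_pos
  by (intro dep_comp2[where F = "(+)"] dep_comp2[where F = "(-)"] dep_shf[OF cond_dep]
      gsum_dep dep_mono[OF cond_dep]) auto

lemma integral_shf0:
  assumes "sqi f" shows "(\<integral>x. f (shf k x) \<partial>S) = (\<integral>x. f x \<partial>S)"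
  using assms by (intro integral_shf) (auto simp: sqi_def)

lemma mdiff_mean: "(\<integral>x. mdiff x \<partial>S) = 0"
  unfolding mdiff_def[abs_def]
  by (simp add: sqi_integrable sqi_intros gsum_sqi cond_sqi gsum_mean cond_mean integral_shf0)

text \<open>The defining property of a conditional expectation, moved to coordinate
  \<open>k\<close>: \<open>cond (shf k x)\<close> is the projection of
  \<open>gsum m (shf k x)\<close> on the functions of the first \<open>k + m\<close>
  coordinates.\<close>

lemma integral_mult_gsum_cond:
  assumes "sqi f" "dep (k + m) f"
  shows "(\<integral>x. f x * gsum m (shf k x) \<partial>S) = (\<integral>x. f x * cond (shf k x) \<partial>S)"
proof -
  have *: "shf k (comb_seq (k + m) x z) = comb_seq m (shf k x) z" for x z :: "nat \<Rightarrow> 'a"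
    by (auto simp: shf_def comb_seq_def fun_eq_iff)
  have "(\<integral>x. f x * gsum m (shf k x) \<partial>S)
      = (\<integral>x. \<integral>z. f (comb_seq (k + m) x z) * gsum m (shf k (comb_seq (k + m) x z)) \<partial>S \<partial>S)"
    by (rule integral_comb_seq) (intro sqi_integrable_mult assms sqi_shf gsum_sqi)
  also have "\<dots> = (\<integral>x. f x * cond (shf k x) \<partial>S)"
    by (simp add: dep_comb_seq[OF assms(2)] * cond_def)
  finally show ?thesis .
qed

text \<open>The martingale difference property. The block sum minus its projection is orthogonal to
  the past, and the term added from the following block is centred and independent of it.\<close>

lemma mdiff_orthogonal:
  assumes "sqi f" "dep (k + m) f"
  shows "(\<integral>x. f x * mdiff (shf k x) \<partial>S) = 0"
proof -
  have "(\<integral>x. f x * mdiff (shf k x) \<partial>S) = (\<integral>x. f x * gsum m (shf k x) \<partial>S)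
     - (\<integral>x. f x * cond (shf k x) \<partial>S) + (\<integral>x. f x * cond (shf (k + m) x) \<partial>S)"
    using assms(1)
    by (simp add: mdiff_def distrib_left right_diff_distrib sqi_integrable_mult sqi_shf gsum_sqi cond_sqi add.commute)
  also have "\<dots> = 0"
    using integral_mult_gsum_cond[OF assms] integral_mult_far[OF assms(1) cond_sqi assms(2) order_refl]
    by (simp add: cond_mean)
  finally show ?thesis .
qed

lemma gcov_far: "j \<ge> m \<Longrightarrow> (\<integral>x. g x * g (shf j x) \<partial>S) = 0"
  using integral_mult_far[OF g_sqi g_sqi g_dep] by (simp add: g_mean)

lemma gcov_le: "\<bar>\<integral>x. g x * g (shf j x) \<partial>S\<bar> \<le> gvar"
proof -
  have "\<bar>\<integral>x. g x * g (shf j x) \<partial>S\<bar> \<le> (\<integral>x. \<bar>g x * g (shf j x)\<bar> \<partial>S)"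
    by (rule integral_abs_bound)
  also have "\<dots> \<le> (\<integral>x. ((g x)\<^sup>2 + (g (shf j x))\<^sup>2) / 2 \<partial>S)"
  proof (rule integral_mono)
    show "integrable S (\<lambda>x. \<bar>g x * g (shf j x)\<bar>)"
      by (intro integrable_abs sqi_integrable_mult sqi_shf g_sqi)
    show "integrable S (\<lambda>x. ((g x)\<^sup>2 + (g (shf j x))\<^sup>2) / 2)"
      using sqi_integrable_sq[OF g_sqi] sqi_integrable_sq[OF sqi_shf[OF g_sqi]] by simp
    fix x
    show "\<bar>g x * g (shf j x)\<bar> \<le> ((g x)\<^sup>2 + (g (shf j x))\<^sup>2) / 2"
      using sum_squares_bound[of "\<bar>g x\<bar>" "\<bar>g (shf j x)\<bar>"] by (simp add: abs_mult)
  qed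
  also have "\<dots> = gvar"
    using sqi_integrable_sq[OF g_sqi] sqi_integrable_sq[OF sqi_shf[OF g_sqi, of j]]
      integral_shf[of "\<lambda>x. (g x)\<^sup>2" j] g_sqi
    by (simp add: gvar_def sqi_measurable)
  finally show ?thesis .
qed

lemma gvar_nonneg: "gvar \<ge> 0"
  by (simp add: gvar_def)

text \<open>Splitting off the first term and using stationarity shows that the variance of the
  partial sums increases by truncated long run variances. From \<open>m - 1\<close> on the missing
  covariances vanish by independence, so that the growth is exactly \<tau> per term.\<close>

lemma integral_gsum_sq_Suc:
  "(\<integral>x. (gsum (Suc a) x)\<^sup>2 \<partial>S) = (\<integral>x. (gsum a x)\<^sup>2 \<partial>S)
     + (gvar + 2 * (\<Sum>j=1..a. \<integral>x. g x * g (shf j x) \<partial>S))"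
proof -
  have eq: "gsum (Suc a) x = g x + gsum a (shf 1 x)" for x
    unfolding gsum_def by (subst sum.lessThan_Suc_shift) simp
  have "(\<integral>x. (gsum (Suc a) x)\<^sup>2 \<partial>S)
      = (\<integral>x. (g x)\<^sup>2 + 2 * (g x * gsum a (shf 1 x)) + (gsum a (shf 1 x))\<^sup>2 \<partial>S)"
    by (simp add: eq power2_sum algebra_simps)
  also have "\<dots> = gvar + 2 * (\<integral>x. g x * gsum a (shf 1 x) \<partial>S) + (\<integral>x. (gsum a (shf 1 x))\<^sup>2 \<partial>S)"
    using sqi_integrable_sq[OF g_sqi] sqi_integrable_sq[OF sqi_shf[OF gsum_sqi[of a], of 1]]
      sqi_integrable_mult[OF g_sqi sqi_shf[OF gsum_sqi[of a], of 1]]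
    by (simp add: gvar_def)
  also have "(\<integral>x. (gsum a (shf 1 x))\<^sup>2 \<partial>S) = (\<integral>x. (gsum a x)\<^sup>2 \<partial>S)"
    using integral_shf[of "\<lambda>x. (gsum a x)\<^sup>2" 1] gsum_sqi[of a] by (simp add: sqi_measurable)
  also have "(\<integral>x. g x * gsum a (shf 1 x) \<partial>S) = (\<Sum>k<a. \<integral>x. g x * g (shf (Suc k) x) \<partial>S)"
    by (simp add: gsum_def sum_distrib_left sqi_integrable_mult g_sqi sqi_shf)
  also have "\<dots> = (\<Sum>j=1..a. \<integral>x. g x * g (shf j x) \<partial>S)"
    by (rule sum.reindex_bij_witness[of _ "\<lambda>j. j - 1" Suc]) auto
  finally show ?thesis by simp
qed

lemma long_run_variance_ge:
  assumes "a \<ge> m - 1"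
  shows "gvar + 2 * (\<Sum>j=1..a. \<integral>x. g x * g (shf j x) \<partial>S) = \<tau>"
proof -
  have "(\<Sum>j=1..a. \<integral>x. g x * g (shf j x) \<partial>S) = (\<Sum>j=1..m-1. \<integral>x. g x * g (shf j x) \<partial>S)"
    by (rule sum.mono_neutral_right) (use assms gcov_far in auto)
  then show ?thesis
    using long_run_variance by (simp add: gvar_def)
qed

lemma integral_gsum_sq_diff:
  "(\<integral>x. (gsum (m + b) x)\<^sup>2 \<partial>S) = (\<integral>x. (gsum m x)\<^sup>2 \<partial>S) + b * \<tau>"
proof (induction b)
  case (Suc b)
  then show ?case
    using long_run_variance_ge[of "m + b"] by (simp add: integral_gsum_sq_Suc algebra_simps)
qed simp

text \<open>The two terms have different origins. The first \<open>m\<close> increments are bounded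
  crudely by \<open>2 * m * gvar\<close>, since they have no relation to \<tau>; the later ones
  equal \<tau>. For the array of the theorem the first term tends to 0.\<close>

lemma integral_gsum_sq_le: "(\<integral>x. (gsum a x)\<^sup>2 \<partial>S) \<le> 2 * (real m)\<^sup>2 * gvar + a * \<tau>"
proof -
  have 1: "(\<integral>x. (gsum a x)\<^sup>2 \<partial>S) \<le> a * (2 * m * gvar)" if "a \<le> m" for a
    using that
  proof (induction a)
    case (Suc a)
    have "(\<Sum>j=1..a. \<integral>x. g x * g (shf j x) \<partial>S) \<le> (\<Sum>j=1..a. gvar)"
      using gcov_le by (intro sum_mono) (simp add: abs_le_iff)
    moreover have "gvar + 2 * (a * gvar) \<le> 2 * m * gvar"
    proof -
      have "gvar + 2 * (a * gvar) = (1 + 2 * real a) * gvar"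
        by (simp add: algebra_simps)
      also have "\<dots> \<le> (2 * real m) * gvar"
        using Suc by (intro mult_right_mono gvar_nonneg) auto
      finally show ?thesis by simp
    qed
    ultimately have "gvar + 2 * (\<Sum>j=1..a. \<integral>x. g x * g (shf j x) \<partial>S) \<le> 2 * m * gvar"
      by simp
    with Suc show ?case
      by (simp add: integral_gsum_sq_Suc algebra_simps)
  qed (simp add: gsum_def)
  show ?thesis
  proof (cases "a \<le> m")
    case True
    have "a * (2 * m * gvar) \<le> m * (2 * m * gvar)"
      using True gvar_nonneg by (intro mult_right_mono) auto
    with 1[OF True] have "(\<integral>x. (gsum a x)\<^sup>2 \<partial>S) \<le> 2 * (real m)\<^sup>2 * gvar"
      by (simp add: power2_eq_square)
    moreover have "0 \<le> a * \<tau>" using \<tau>_nonneg by simp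
    ultimately show ?thesis by linarith
  next
    case False
    then obtain b where a: "a = m + b" by (metis le_add_diff_inverse nle_le)
    have "b * \<tau> \<le> a * \<tau>" using \<tau>_nonneg by (intro mult_right_mono) (auto simp: a)
    with integral_gsum_sq_diff[of b] 1[of m] show ?thesis
      by (simp add: a power2_eq_square)
  qed
qed

lemma cond_sq_le: "(\<integral>x. (cond x)\<^sup>2 \<partial>S) \<le> 2 * (real m)\<^sup>2 * gvar + m * \<tau>"
  using integral_cond_sq_le[OF gsum_sqi[of m], of m] integral_gsum_sq_le[of m]
  by (simp add: cond_def)

text \<open>The \<open>cond\<close> terms cancel except for the covariance of neighbouring block
  sums. With Y the block sum and Y' the next one, the result is Var Y + 2 Cov (Y, Y') = Var (Y + Y')
  - Var Y, which is the growth of the variance from \<open>m\<close> to \<open>2 * m\<close>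
  terms.\<close>

lemma mdiff_var: "(\<integral>x. (mdiff x)\<^sup>2 \<partial>S) = m * \<tau>"
proof -
  note [simp] = sqi_integrable_mult sqi_integrable_sq sqi_intros gsum_sqi cond_sqi
  define Y where "Y = gsum m"
  define W where "W = cond"
  have Y: "sqi Y" "dep (2 * m) Y" and W: "sqi W" "dep m W"
    using m_pos by (auto simp: Y_def W_def intro: gsum_dep cond_dep)
  have i: "integrable S (\<lambda>x. Y x * W x)" "integrable S (\<lambda>x. W x * W (shf m x))"
    "integrable S (\<lambda>x. Y x * W (shf m x))" "integrable S (\<lambda>x. (Y x)\<^sup>2)"
    "integrable S (\<lambda>x. (W x)\<^sup>2)" "integrable S (\<lambda>x. (W (shf m x))\<^sup>2)"
    using Y W sqi_integrable_sq[OF sqi_shf[OF W(1), of m]] by auto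
  have "(mdiff x)\<^sup>2 = (Y x)\<^sup>2 - 2 * (Y x * W x) + (W x)\<^sup>2
      + 2 * (Y x * W (shf m x)) - 2 * (W x * W (shf m x)) + (W (shf m x))\<^sup>2" for x
    by (simp add: mdiff_def Y_def W_def power2_eq_square algebra_simps)
  then have "(\<integral>x. (mdiff x)\<^sup>2 \<partial>S) = (\<integral>x. (Y x)\<^sup>2 \<partial>S) - 2 * (\<integral>x. Y x * W x \<partial>S) + (\<integral>x. (W x)\<^sup>2 \<partial>S)
      + 2 * (\<integral>x. Y x * W (shf m x) \<partial>S) - 2 * (\<integral>x. W x * W (shf m x) \<partial>S) + (\<integral>x. (W (shf m x))\<^sup>2 \<partial>S)"
    using i by simp
  also have "(\<integral>x. Y x * W x \<partial>S) = (\<integral>x. (W x)\<^sup>2 \<partial>S)"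
    using integral_mult_gsum_cond[of cond 0] cond_dep
    by (simp add: Y_def W_def power2_eq_square mult.commute)
  also have "(\<integral>x. W x * W (shf m x) \<partial>S) = 0"
    using integral_mult_far[OF W(1) W(1) W(2) order_refl] by (simp add: W_def cond_mean)
  also have "(\<integral>x. (W (shf m x))\<^sup>2 \<partial>S) = (\<integral>x. (W x)\<^sup>2 \<partial>S)"
    using integral_shf[of "\<lambda>x. (W x)\<^sup>2" m] W(1) by (simp add: sqi_measurable)
  also have "(\<integral>x. Y x * W (shf m x) \<partial>S) = (\<integral>x. Y x * Y (shf m x) \<partial>S)"
    using integral_mult_gsum_cond[of Y m] Y by (simp add: Y_def W_def mult_2)
  finally have 1: "(\<integral>x. (mdiff x)\<^sup>2 \<partial>S) = (\<integral>x. (Y x)\<^sup>2 \<partial>S) + 2 * (\<integral>x. Y x * Y (shf m x) \<partial>S)"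
    by simp
  have eq: "gsum (m + m) x = Y x + Y (shf m x)" for x
    unfolding gsum_def Y_def sum.lessThan_Suc_shift
    using sum.atLeastLessThan_concat[of 0 m "m + m" "\<lambda>k. g (shf k x)"]
      sum.shift_bounds_nat_ivl[of "\<lambda>k. g (shf k x)" 0 m m]
    by (simp add: lessThan_atLeast0 add.commute)
  have i2: "integrable S (\<lambda>x. Y x * Y (shf m x))" "integrable S (\<lambda>x. (Y (shf m x))\<^sup>2)"
    using Y sqi_integrable_sq[OF sqi_shf[OF Y(1), of m]] by auto
  have "(\<integral>x. (gsum (m + m) x)\<^sup>2 \<partial>S)
     = (\<integral>x. (Y x)\<^sup>2 + 2 * (Y x * Y (shf m x)) + (Y (shf m x))\<^sup>2 \<partial>S)"
    by (simp add: eq power2_sum algebra_simps)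
  also have "\<dots> = (\<integral>x. (Y x)\<^sup>2 \<partial>S) + 2 * (\<integral>x. Y x * Y (shf m x) \<partial>S) + (\<integral>x. (Y (shf m x))\<^sup>2 \<partial>S)"
    using i i2 by simp
  also have "(\<integral>x. (Y (shf m x))\<^sup>2 \<partial>S) = (\<integral>x. (Y x)\<^sup>2 \<partial>S)"
    using integral_shf[of "\<lambda>x. (Y x)\<^sup>2" m] Y(1) by (simp add: sqi_measurable)
  finally have "(\<integral>x. (gsum (m + m) x)\<^sup>2 \<partial>S)
     = 2 * (\<integral>x. (Y x)\<^sup>2 \<partial>S) + 2 * (\<integral>x. Y x * Y (shf m x) \<partial>S)" by simp
  with 1 integral_gsum_sq_diff[of m] show ?thesis
    by (simp add: Y_def)
qed

lemma lin_var: "(\<integral>x. (lin x)\<^sup>2 \<partial>S) = m * evar"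
proof -
  have z: "(\<integral>x. e (shf i x) * e (shf j x) \<partial>S) = 0" if "i < j" for i j
    using integral_mult_shf_shf[OF e_sqi e_sqi, of i "j - i"]
      integral_mult_far[OF e_sqi e_sqi e_dep, of "j - i"] that
    by (simp add: e_mean)
  have "(\<integral>x. (lin x)\<^sup>2 \<partial>S) = (\<Sum>j<m. \<integral>x. (e (shf j x))\<^sup>2 \<partial>S)"
    unfolding lin_def
  proof (rule integral_orthogonal_sum_sq)
    fix i j assume "i \<in> {..<m}" "j \<in> {..<m}" "i \<noteq> j"
    then show "(\<integral>x. e (shf i x) * e (shf j x) \<partial>S) = 0"
      using z[of i j] z[of j i] by (cases "i < j") (auto simp: mult.commute)
  qed (auto intro: sqi_shf e_sqi)
  also have "\<dots> = (\<Sum>j<m. evar)"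
    using integral_shf[of "\<lambda>x. (e x)\<^sup>2"] e_sqi by (simp add: evar_def sqi_measurable)
  finally show ?thesis by simp
qed

text \<open>The two blocks contain the full window of \<open>m\<close> coordinates of every term of
  the block sum. Inside its window each term is uncorrelated with the sum of the shifts of
  \<open>e\<close> by assumption, and outside it is independent of them.\<close>

lemma gsum_lin: "(\<integral>x. gsum m x * (lin x + lin (shf m x)) \<partial>S) = 0"
proof -
  have eq: "lin x + lin (shf m x) = (\<Sum>i<m+m. e (shf i x))" for x
    unfolding lin_def
    using sum.atLeastLessThan_concat[of 0 m "m + m" "\<lambda>k. e (shf k x)"]
      sum.shift_bounds_nat_ivl[of "\<lambda>k. e (shf k x)" 0 m m]
    by (simp add: lessThan_atLeast0 add.commute)
  have 1: "(\<Sum>i<m+m. \<integral>x. g (shf k x) * e (shf i x) \<partial>S) = 0" if k: "k < m" for k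
  proof -
    have lo: "(\<integral>x. g (shf k x) * e (shf i x) \<partial>S) = 0" if "i < k" for i
      using integral_mult_shf_shf[OF e_sqi g_sqi, of i "k - i"] that
        integral_mult_far[OF e_sqi g_sqi e_dep, of "k - i"]
      by (simp add: g_mean mult.commute)
    have hi: "(\<integral>x. g (shf k x) * e (shf i x) \<partial>S) = 0" if "k + m \<le> i" for i
      using integral_mult_shf_shf[OF g_sqi e_sqi, of k "i - k"] that
        integral_mult_far[OF g_sqi e_sqi g_dep, of "i - k"]
      by (simp add: g_mean)
    have "(\<Sum>i<m+m. \<integral>x. g (shf k x) * e (shf i x) \<partial>S) = (\<Sum>i\<in>{k..<k+m}. \<integral>x. g (shf k x) * e (shf i x) \<partial>S)"
      by (rule sum.mono_neutral_right) (use k lo hi in \<open>auto simp: not_le not_less\<close>)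
    also have "\<dots> = (\<Sum>j<m. \<integral>x. g (shf k x) * e (shf (k + j) x) \<partial>S)"
      by (rule sum.reindex_bij_witness[of _ "\<lambda>j. k + j" "\<lambda>i. i - k"]) auto
    also have "\<dots> = (\<Sum>j<m. \<integral>x. g x * e (shf j x) \<partial>S)"
      by (simp add: integral_mult_shf_shf g_sqi e_sqi)
    also have "\<dots> = (\<integral>x. g x * (\<Sum>j<m. e (shf j x)) \<partial>S)"
      by (simp add: sum_distrib_left sqi_integrable_mult g_sqi e_sqi sqi_shf)
    finally show ?thesis by (simp add: g_e_uncorrelated)
  qed
  have "(\<integral>x. gsum m x * (lin x + lin (shf m x)) \<partial>S)
      = (\<Sum>k<m. \<Sum>i<m+m. \<integral>x. g (shf k x) * e (shf i x) \<partial>S)"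
    unfolding eq gsum_def sum_product
    by (simp add: sqi_integrable_mult g_sqi e_sqi sqi_shf)
  also have "\<dots> = 0"
    by (rule sum.neutral) (use 1 in auto)
  finally show ?thesis .
qed

text \<open>The second block is the one covered neither by the martingale property nor by
  independence. Shifting back and applying the projection property turn the \<open>cond\<close>
  terms into the covariance of the block sum with the first block, and \<open>gsum_lin\<close>
  treats both blocks together.\<close>

lemma mdiff_lin_next: "(\<integral>x. mdiff x * lin (shf m x) \<partial>S) = 0"
proof -
  note [simp] = sqi_integrable_mult sqi_intros gsum_sqi cond_sqi lin_sqi
  have "(\<integral>x. mdiff x * lin (shf m x) \<partial>S)
     = (\<integral>x. gsum m x * lin (shf m x) \<partial>S) - (\<integral>x. cond x * lin (shf m x) \<partial>S)
       + (\<integral>x. cond (shf m x) * lin (shf m x) \<partial>S)"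
    by (simp add: mdiff_def distrib_right left_diff_distrib)
  also have "(\<integral>x. cond x * lin (shf m x) \<partial>S) = 0"
    using integral_mult_far[OF cond_sqi lin_sqi cond_dep order_refl] by (simp add: lin_mean)
  also have "(\<integral>x. cond (shf m x) * lin (shf m x) \<partial>S) = (\<integral>x. cond x * lin x \<partial>S)"
    using integral_mult_shf_shf[OF cond_sqi lin_sqi, of m 0] by simp
  also have "\<dots> = (\<integral>x. gsum m x * lin x \<partial>S)"
    using integral_mult_gsum_cond[OF lin_sqi, of 0] lin_dep by (simp add: mult.commute)
  finally show ?thesis
    using gsum_lin by (simp add: distrib_left)
qed

end

section \<open>Characteristic functions of block sums\<close>

lemma iexp_sum: "iexp (\<Sum>i\<in>I. f i) = (\<Prod>i\<in>I. iexp (f i))"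
proof (cases "finite I")
  case True
  then show ?thesis
    by (induction I) (simp_all add: distrib_left exp_add)
qed simp

lemma sq3_le: "(a + b + c)\<^sup>2 \<le> 3 * (a\<^sup>2 + b\<^sup>2 + c\<^sup>2)" for a b c :: real
proof -
  have "0 \<le> (a - b)\<^sup>2 + (b - c)\<^sup>2 + (a - c)\<^sup>2" by simp
  then show ?thesis by (simp add: power2_eq_square algebra_simps)
qed

text \<open>The integrand of the error term in \<open>char_approx3'\<close>.\<close>
definition lin_err :: "real \<Rightarrow> real" where
  "lin_err x = min (6 * x\<^sup>2) (\<bar>x\<bar> ^ 3)"

lemma lin_err_nonneg: "0 \<le> lin_err x"
  by (simp add: lin_err_def)

lemma lin_err_measurable [measurable]: "lin_err \<in> borel_measurable borel"
  unfolding lin_err_def[abs_def] by measurable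

lemma lin_err_cmult: "c \<ge> 1 \<Longrightarrow> \<bar>y\<bar> \<le> c * \<bar>x\<bar> \<Longrightarrow> lin_err y \<le> c ^ 3 * lin_err x"
proof -
  assume c: "c \<ge> 1" and y: "\<bar>y\<bar> \<le> c * \<bar>x\<bar>"
  have "y\<^sup>2 \<le> (c * x)\<^sup>2"
    using y c by (intro abs_le_square_iff[THEN iffD1]) (simp add: abs_mult)
  also have "\<dots> = c ^ 2 * x\<^sup>2" by (simp add: power_mult_distrib)
  also have "\<dots> \<le> c ^ 3 * x\<^sup>2"
    using c by (intro mult_right_mono power_increasing) auto
  finally have 1: "6 * y\<^sup>2 \<le> c ^ 3 * (6 * x\<^sup>2)" by simp
  have "\<bar>y\<bar> ^ 3 \<le> (c * \<bar>x\<bar>) ^ 3"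
    using y by (intro power_mono) auto
  then have 2: "\<bar>y\<bar> ^ 3 \<le> c ^ 3 * \<bar>x\<bar> ^ 3" by (simp add: power_mult_distrib)
  have "c ^ 3 * lin_err x = min (c ^ 3 * (6 * x\<^sup>2)) (c ^ 3 * \<bar>x\<bar> ^ 3)"
    using c unfolding lin_err_def by (intro min_mult_distrib_left[THEN trans]) auto
  then show "lin_err y \<le> c ^ 3 * lin_err x"
    using 1 2 unfolding lin_err_def by linarith
qed

text \<open>\<open>lin_err\<close> is not convex, because the minimum changes from a cubic to a
  flatter square. Instead of Jensen's inequality, the sum is compared with \<open>card I\<close>
  times its largest summand.\<close>

lemma lin_err_sum:
  assumes "finite I"
  shows "lin_err (\<Sum>i\<in>I. f i) \<le> real (card I) ^ 3 * (\<Sum>i\<in>I. lin_err (f i))"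
proof (cases "I = {}")
  case True
  then show ?thesis by (simp add: lin_err_def)
next
  case False
  have "Max ((\<lambda>i. \<bar>f i\<bar>) ` I) \<in> (\<lambda>i. \<bar>f i\<bar>) ` I"
    using assms False by (intro Max_in) auto
  then obtain j where j: "j \<in> I" "\<bar>f j\<bar> = Max ((\<lambda>i. \<bar>f i\<bar>) ` I)" by force
  have le: "\<bar>f i\<bar> \<le> \<bar>f j\<bar>" if "i \<in> I" for i
    unfolding j(2) using assms that by auto
  have "\<bar>\<Sum>i\<in>I. f i\<bar> \<le> (\<Sum>i\<in>I. \<bar>f i\<bar>)" by (rule sum_abs)
  also have "\<dots> \<le> real (card I) * \<bar>f j\<bar>"
    using sum_bounded_above[of I "\<lambda>i. \<bar>f i\<bar>" "\<bar>f j\<bar>"] le by simp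
  finally have "lin_err (\<Sum>i\<in>I. f i) \<le> real (card I) ^ 3 * lin_err (f j)"
    using False assms by (intro lin_err_cmult) (auto simp: Suc_le_eq card_gt_0_iff)
  also have "\<dots> \<le> real (card I) ^ 3 * (\<Sum>i\<in>I. lin_err (f i))"
    using j(1) assms by (intro mult_left_mono member_le_sum lin_err_nonneg) auto
  finally show ?thesis .
qed

text \<open>The passage from a Lyapunov condition to a Lindeberg type error, by splitting at |x| =
  \<delta>. As r may be smaller than 3, the cubic branch is used only for small x, and for large x
  the square is bounded by the r-th power.\<close>

lemma lin_err_le_powr:
  assumes "\<delta> > 0" "r \<ge> 2"
  shows "lin_err x \<le> \<delta> * x\<^sup>2 + 6 * \<delta> powr (2 - r) * \<bar>x\<bar> powr r"
proof (cases "\<bar>x\<bar> \<le> \<delta>")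
  case True
  have "lin_err x \<le> \<bar>x\<bar> ^ 3" by (simp add: lin_err_def)
  also have "\<dots> = \<bar>x\<bar> * x\<^sup>2" by (simp add: power3_eq_cube power2_eq_square)
  also have "\<dots> \<le> \<delta> * x\<^sup>2" using True by (intro mult_right_mono) auto
  finally show ?thesis by (simp add: add_increasing2)
next
  case False
  then have x: "\<bar>x\<bar> > 0" using assms by linarith
  have "\<bar>x\<bar> powr (2 - r) \<le> \<delta> powr (2 - r)"
    using False assms by (intro powr_mono2') auto
  have "lin_err x \<le> 6 * x\<^sup>2" by (simp add: lin_err_def)
  also have "x\<^sup>2 = \<bar>x\<bar> powr (2 - r) * \<bar>x\<bar> powr r"
    using x by (simp add: powr_add[symmetric] powr_numeral)
  also have "\<dots> \<le> \<delta> powr (2 - r) * \<bar>x\<bar> powr r"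
    using \<open>\<bar>x\<bar> powr (2 - r) \<le> \<delta> powr (2 - r)\<close> by (intro mult_right_mono) auto
  finally show ?thesis using assms by (simp add: add_increasing mult.assoc)
qed

lemma exp_minus_approx:
  assumes "(a::real) \<ge> 0"
  shows "\<bar>(1 - a) - exp (- a)\<bar> \<le> a\<^sup>2"
proof -
  have "exp (- a) \<le> 1 / (1 + a)"
    using exp_ge_add_one_self[of a] assms
    by (simp add: exp_minus inverse_eq_divide frac_le)
  also have "1 / (1 + a) \<le> 1 - a + a\<^sup>2"
  proof -
    have "(1 - a + a\<^sup>2) * (1 + a) = 1 + a ^ 3"
      by (simp add: algebra_simps power2_eq_square power3_eq_cube)
    then show ?thesis
      using assms by (simp add: divide_le_eq)
  qed
  finally have "exp (- a) \<le> 1 - a + a\<^sup>2" .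
  moreover have "1 - a \<le> exp (- a)"
    using exp_ge_add_one_self[of "- a"] by simp
  ultimately show ?thesis by (simp add: abs_le_iff)
qed

context sequence_space
begin

lemma
  fixes f :: "(nat \<Rightarrow> 'a) \<Rightarrow> complex"
  assumes f: "integrable S f" and dep: "dep L f"
  shows integrable_prod_shf: "integrable S (\<lambda>x. \<Prod>l<K. f (shf (l * L) x))"
    and integral_prod_shf: "(\<integral>x. (\<Prod>l<K. f (shf (l * L) x)) \<partial>S) = (\<integral>x. f x \<partial>S) ^ K"
proof (induction K)
  case (Suc K)
  define p where "p x = (\<Prod>l<K. f (shf (l * L) x))" for x
  have eq: "(\<Prod>l<Suc K. f (shf (l * L) x)) = f x * p (shf L x)" for x
    unfolding p_def prod.lessThan_Suc_shift by (simp add: add.commute)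
  have p: "integrable S p" using Suc by (simp add: p_def[abs_def])
  {
    case 1 show ?case unfolding eq by (rule integrable_mult_shf[OF f p dep])
  next
    case 2 show ?case unfolding eq
      by (subst integral_mult_shf[OF f p dep]) (use Suc in \<open>simp add: p_def[abs_def]\<close>)
  }
qed (simp_all add: P.prob_space)

end

context dependent_sequence
begin

text \<open>
  Leaving out every \<open>q\<close>-th martingale difference makes the remaining blocks independent; what is
  left out, together with the boundary terms of the telescoping sum, is collected in \<open>gaps\<close>.
\<close>
definition bigB :: "nat \<Rightarrow> (nat \<Rightarrow> 'a) \<Rightarrow> real" where
  "bigB q x = (\<Sum>j<q - 1. mdiff (shf (j * m) x))"

definition bigL :: "nat \<Rightarrow> (nat \<Rightarrow> 'a) \<Rightarrow> real" where
  "bigL q x = (\<Sum>j<q. lin (shf (j * m) x))"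

definition blocks :: "nat \<Rightarrow> nat \<Rightarrow> (nat \<Rightarrow> 'a) \<Rightarrow> real" where
  "blocks q K x = (\<Sum>l<K. bigB q (shf (l * (q * m)) x))"

definition gaps :: "nat \<Rightarrow> nat \<Rightarrow> (nat \<Rightarrow> 'a) \<Rightarrow> real" where
  "gaps q K x = (\<Sum>l=1..<K. mdiff (shf ((l * q - 1) * m) x))
     + cond x - cond (shf ((K * q - 1) * m) x)"

lemma bigB_sqi: "sqi (bigB q)"
  unfolding bigB_def[abs_def] by (intro sqi_intros mdiff_sqi)

lemma bigL_sqi: "sqi (bigL q)"
  unfolding bigL_def[abs_def] by (intro sqi_intros lin_sqi)

lemma blocks_sqi: "sqi (blocks q K)"
  unfolding blocks_def[abs_def] by (intro sqi_intros bigB_sqi)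

lemma gaps_sqi: "sqi (gaps q K)"
  unfolding gaps_def[abs_def] by (intro sqi_intros mdiff_sqi cond_sqi)

lemma mult_m_le: "a + b \<le> c \<Longrightarrow> a * m + b * m \<le> c * m"
  by (metis add_mult_distrib mult_le_mono1)

text \<open>The last of the \<open>q - 1\<close> differences reaches into one further block, so a
  group occupies \<open>q\<close> blocks. Omitting one difference per group is exactly what makes
  consecutive groups independent.\<close>

lemma bigB_dep: "dep (q * m) (bigB q)"
  unfolding bigB_def[abs_def]
  by (intro dep_sum dep_shf[OF mdiff_dep] mult_m_le) auto

lemma bigL_dep: "dep (q * m) (bigL q)"
  unfolding bigL_def[abs_def]
proof (intro dep_sum dep_shf[OF lin_dep])
  fix j assume "j \<in> {..<q}"
  then show "j * m + m \<le> q * m" using mult_m_le[of j 1 q] by simp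
qed

lemma blocks_dep: "dep (K * q * m) (blocks q K)"
  unfolding blocks_def[abs_def]
proof (intro dep_sum dep_shf[OF bigB_dep])
  fix l assume "l \<in> {..<K}"
  then have "Suc l * (q * m) \<le> K * (q * m)" by (intro mult_le_mono1) auto
  then show "l * (q * m) + q * m \<le> K * q * m" by (simp add: algebra_simps)
qed

lemma gaps_dep:
  assumes "q \<ge> 1" "K \<ge> 1"
  shows "dep (K * q * m) (gaps q K)"
proof -
  have 1: "dep (K * q * m) (\<lambda>x. mdiff (shf ((l * q - 1) * m) x))" if "l \<in> {1..<K}" for l
  proof (rule dep_shf[OF mdiff_dep], rule mult_m_le)
    have "Suc l * q \<le> K * q" using that by (intro mult_le_mono1) auto
    then show "l * q - 1 + 2 \<le> K * q" using that assms by auto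
  qed
  have 2: "dep (K * q * m) cond"
    using assms by (intro dep_mono[OF cond_dep]) auto
  have 3: "dep (K * q * m) (\<lambda>x. cond (shf ((K * q - 1) * m) x))"
  proof (rule dep_shf[OF cond_dep])
    show "(K * q - 1) * m + m \<le> K * q * m"
      using mult_m_le[of "K * q - 1" 1 "K * q"] assms by (simp add: Suc_le_eq)
  qed
  show ?thesis
    unfolding gaps_def[abs_def] using 1 2 3
    by (intro dep_comp2[where F = "(+)"] dep_comp2[where F = "(-)"] dep_sum) auto
qed

lemma mdiff_shf_orthogonal: "i < j \<Longrightarrow> (\<integral>x. mdiff (shf (i * m) x) * mdiff (shf (j * m) x) \<partial>S) = 0"
proof (rule mdiff_orthogonal)
  assume "i < j"
  show "sqi (\<lambda>x. mdiff (shf (i * m) x))" by (intro sqi_intros mdiff_sqi)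
  show "dep (j * m + m) (\<lambda>x. mdiff (shf (i * m) x))"
  proof (rule dep_shf[OF mdiff_dep])
    show "i * m + 2 * m \<le> j * m + m" using mult_m_le[of i 2 "j + 1"] \<open>i < j\<close> by simp
  qed
qed

lemma lin_shf_orthogonal: "i < j \<Longrightarrow> (\<integral>x. lin (shf (i * m) x) * lin (shf (j * m) x) \<partial>S) = 0"
proof -
  assume "i < j"
  then obtain k where j: "j = i + Suc k" using less_imp_Suc_add by auto
  have "(\<integral>x. lin (shf (i * m) x) * lin (shf (i * m + Suc k * m) x) \<partial>S) = 0"
    by (subst integral_mult_shf_shf[OF lin_sqi lin_sqi], subst integral_mult_far[OF lin_sqi lin_sqi lin_dep])
      (auto simp: lin_mean)
  moreover have "j * m = i * m + Suc k * m" by (simp add: j add_mult_distrib)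
  ultimately show ?thesis by (simp only:)
qed

text \<open>There are three regimes: blocks up to the first one of the difference belong to its
  past, the next block is \<open>mdiff_lin_next\<close>, and all later blocks are independent of
  it.\<close>

lemma mdiff_lin_orthogonal: "(\<integral>x. mdiff (shf (i * m) x) * lin (shf (j * m) x) \<partial>S) = 0"
proof -
  consider "j \<le> i" | "j = Suc i" | k where "j = i + 2 + k"
    by (metis less_eqE not_less_eq_eq add_2_eq_Suc' Suc_leI le_neq_implies_less not_le)
  then show ?thesis
  proof cases
    case 1
    have "(\<integral>x. lin (shf (j * m) x) * mdiff (shf (i * m) x) \<partial>S) = 0"
    proof (rule mdiff_orthogonal)
      show "sqi (\<lambda>x. lin (shf (j * m) x))" by (intro sqi_intros lin_sqi)
      show "dep (i * m + m) (\<lambda>x. lin (shf (j * m) x))"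
        using 1 by (intro dep_shf[OF lin_dep]) simp
    qed
    then show ?thesis by (simp add: mult.commute)
  next
    case 2
    have "(\<integral>x. mdiff (shf (i * m) x) * lin (shf (i * m + m) x) \<partial>S) = 0"
      by (subst integral_mult_shf_shf[OF mdiff_sqi lin_sqi]) (rule mdiff_lin_next)
    then show ?thesis by (simp add: 2 add.commute)
  next
    case 3
    have "(\<integral>x. mdiff (shf (i * m) x) * lin (shf (i * m + (2 + k) * m) x) \<partial>S) = 0"
      by (subst integral_mult_shf_shf[OF mdiff_sqi lin_sqi],
          subst integral_mult_far[OF mdiff_sqi lin_sqi mdiff_dep])
        (auto simp: lin_mean add_mult_distrib)
    moreover have "j * m = i * m + (2 + k) * m" by (simp add: 3 add_mult_distrib)
    ultimately show ?thesis by (simp only:)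
  qed
qed

lemma mdiff_shf_var: "(\<integral>x. (mdiff (shf k x))\<^sup>2 \<partial>S) = m * \<tau>"
  using integral_shf[of "\<lambda>x. (mdiff x)\<^sup>2" k] mdiff_sqi by (simp add: sqi_measurable mdiff_var)

lemma lin_shf_var: "(\<integral>x. (lin (shf k x))\<^sup>2 \<partial>S) = m * evar"
  using integral_shf[of "\<lambda>x. (lin x)\<^sup>2" k] lin_sqi by (simp add: sqi_measurable lin_var)

lemma bigB_var: "(\<integral>x. (bigB q x)\<^sup>2 \<partial>S) = real (q - 1) * (m * \<tau>)"
proof -
  have "(\<integral>x. (bigB q x)\<^sup>2 \<partial>S) = (\<Sum>j<q-1. \<integral>x. (mdiff (shf (j * m) x))\<^sup>2 \<partial>S)"
    unfolding bigB_def
  proof (rule integral_orthogonal_sum_sq)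
    fix i j :: nat assume "i \<noteq> j"
    then show "(\<integral>x. mdiff (shf (i * m) x) * mdiff (shf (j * m) x) \<partial>S) = 0"
      using mdiff_shf_orthogonal[of i j] mdiff_shf_orthogonal[of j i]
      by (cases "i < j") (auto simp: mult.commute)
  qed (auto intro: sqi_shf mdiff_sqi)
  then show ?thesis by (simp add: mdiff_shf_var)
qed

lemma bigL_var: "(\<integral>x. (bigL q x)\<^sup>2 \<partial>S) = real q * (m * evar)"
proof -
  have "(\<integral>x. (bigL q x)\<^sup>2 \<partial>S) = (\<Sum>j<q. \<integral>x. (lin (shf (j * m) x))\<^sup>2 \<partial>S)"
    unfolding bigL_def
  proof (rule integral_orthogonal_sum_sq)
    fix i j :: nat assume "i \<noteq> j"
    then show "(\<integral>x. lin (shf (i * m) x) * lin (shf (j * m) x) \<partial>S) = 0"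
      using lin_shf_orthogonal[of i j] lin_shf_orthogonal[of j i]
      by (cases "i < j") (auto simp: mult.commute)
  qed (auto intro: sqi_shf lin_sqi)
  then show ?thesis by (simp add: lin_shf_var)
qed

lemma bigB_bigL: "(\<integral>x. bigB q x * bigL q x \<partial>S) = 0"
  by (simp add: bigB_def bigL_def sum_product sqi_integrable_mult sqi_shf mdiff_sqi lin_sqi
      mdiff_lin_orthogonal)

lemma bigB_mean: "(\<integral>x. bigB q x \<partial>S) = 0"
  by (simp add: bigB_def sqi_integrable sqi_shf mdiff_sqi integral_shf0 mdiff_mean)

lemma bigL_mean: "(\<integral>x. bigL q x \<partial>S) = 0"
  by (simp add: bigL_def sqi_integrable sqi_shf lin_sqi integral_shf0 lin_mean)

lemma block_var: "(\<integral>x. (s * bigB q x + u * bigL q x)\<^sup>2 \<partial>S)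
    = s\<^sup>2 * (real (q - 1) * (m * \<tau>)) + u\<^sup>2 * (real q * (m * evar))"
proof -
  note B = bigB_sqi[of q] and L = bigL_sqi[of q]
  have "(\<integral>x. (s * bigB q x + u * bigL q x)\<^sup>2 \<partial>S)
      = (\<integral>x. s\<^sup>2 * (bigB q x)\<^sup>2 + 2 * s * u * (bigB q x * bigL q x) + u\<^sup>2 * (bigL q x)\<^sup>2 \<partial>S)"
    by (rule Bochner_Integration.integral_cong) (auto simp: power2_eq_square algebra_simps)
  also have "\<dots> = s\<^sup>2 * (\<integral>x. (bigB q x)\<^sup>2 \<partial>S) + 2 * s * u * (\<integral>x. bigB q x * bigL q x \<partial>S)
      + u\<^sup>2 * (\<integral>x. (bigL q x)\<^sup>2 \<partial>S)"
    using sqi_integrable_sq[OF B] sqi_integrable_sq[OF L] sqi_integrable_mult[OF B L] by simp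
  finally show ?thesis by (simp add: bigB_bigL bigB_var bigL_var)
qed

lemma sum_shf_blocks: "(\<Sum>l<K. \<Sum>j<c. F (l * c + j)) = (\<Sum>i<K * c. F i)" for F :: "nat \<Rightarrow> real"
proof (induction K)
  case (Suc K)
  have "(\<Sum>i<Suc K * c. F i) = (\<Sum>i<K * c. F i) + (\<Sum>i=K*c..<Suc K * c. F i)"
    using sum.atLeastLessThan_concat[of 0 "K * c" "Suc K * c" F] by (simp add: lessThan_atLeast0)
  also have "(\<Sum>i=K*c..<Suc K * c. F i) = (\<Sum>j<c. F (K * c + j))"
    by (rule sum.reindex_bij_witness[of _ "\<lambda>j. K * c + j" "\<lambda>i. i - K * c"]) auto
  finally show ?case using Suc by simp
qed simp

lemma bigL_blocks: "(\<Sum>l<K. bigL q (shf (l * (q * m)) x)) = (\<Sum>i<K * q * m. e (shf i x))"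
proof -
  have "(\<Sum>l<K. bigL q (shf (l * (q * m)) x)) = (\<Sum>l<K. \<Sum>j<q. lin (shf ((l * q + j) * m) x))"
    by (simp add: bigL_def algebra_simps)
  also have "\<dots> = (\<Sum>i<K * q. lin (shf (i * m) x))"
    by (rule sum_shf_blocks)
  also have "\<dots> = (\<Sum>i<K * q. \<Sum>j<m. e (shf (i * m + j) x))"
    by (simp add: lin_def add.commute)
  also have "\<dots> = (\<Sum>i<K * q * m. e (shf i x))"
    by (rule sum_shf_blocks)
  finally show ?thesis .
qed

lemma gsum_telescope:
  "gsum (N * m) x = (\<Sum>J<N. mdiff (shf (J * m) x)) + cond x - cond (shf (N * m) x)"
proof -
  have "gsum (N * m) x = (\<Sum>J<N. gsum m (shf (J * m) x))"
    unfolding gsum_def by (simp add: sum_shf_blocks[symmetric] add.commute)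
  also have "\<dots> = (\<Sum>J<N. mdiff (shf (J * m) x)) + cond x - cond (shf (N * m) x)"
    by (induction N) (auto simp: mdiff_def algebra_simps)
  finally show ?thesis .
qed

text \<open>The sum stops one block before the end, at \<open>K * q - 1\<close> blocks. Then the
  last omitted difference does not occur, and both summands on the right depend on the first
  \<open>K * q * m\<close> coordinates only.\<close>

lemma gsum_decomp:
  assumes "q \<ge> 1" "K \<ge> 1"
  shows "gsum ((K * q - 1) * m) x = blocks q K x + gaps q K x"
proof -
  define F where "F J = mdiff (shf (J * m) x)" for J
  have "(\<Sum>J<K*q - 1. F J) = (\<Sum>l<K. \<Sum>j<q-1. F (l * q + j)) + (\<Sum>l=1..<K. F (l * q - 1))"
    using assms(2)
  proof (induction K rule: dec_induct)
    case base
    then show ?case by simp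
  next
    case (step K)
    have a: "K * q - 1 + q = Suc K * q - 1"
      using step assms by (cases K) auto
    have "(\<Sum>J<Suc K * q - 1. F J) = (\<Sum>J<K * q - 1. F J) + (\<Sum>J=K*q-1..<Suc K * q - 1. F J)"
      using sum.atLeastLessThan_concat[of 0 "K * q - 1" "Suc K * q - 1" F] a by (simp add: lessThan_atLeast0)
    also have "(\<Sum>J=K*q-1..<Suc K * q - 1. F J) = (\<Sum>j<q. F (K * q - 1 + j))"
      by (rule sum.reindex_bij_witness[of _ "\<lambda>j. K * q - 1 + j" "\<lambda>i. i - (K * q - 1)"]) (use a in auto)
    also have "\<dots> = F (K * q - 1) + (\<Sum>j<q - 1. F (K * q + j))"
    proof -
      have q: "q = Suc (q - 1)" using assms by simp
      have *: "K * q - 1 + Suc j = K * q + j" for j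
        using step assms by (cases "K * q") auto
      have "(\<Sum>j<q. F (K * q - 1 + j)) = (\<Sum>j<Suc (q - 1). F (K * q - 1 + j))"
        using q by simp
      also have "\<dots> = F (K * q - 1 + 0) + (\<Sum>j<q - 1. F (K * q - 1 + Suc j))"
        by (rule sum.lessThan_Suc_shift)
      finally show ?thesis unfolding * by simp
    qed
    finally show ?case using step by simp
  qed
  moreover have "(\<Sum>l<K. bigB q (shf (l * (q * m)) x)) = (\<Sum>l<K. \<Sum>j<q-1. F (l * q + j))"
    by (simp add: bigB_def F_def algebra_simps)
  ultimately show ?thesis
    unfolding gsum_telescope gaps_def blocks_def by (simp add: F_def)
qed

text \<open>The factor 3 is that of \<open>sq3_le\<close>. The omitted differences are orthogonal,
  each of variance m \<tau>, and there are at most \<open>K\<close> of them; the two boundary terms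
  of the telescoping sum are both bounded by \<open>cond_sq_le\<close>.\<close>

lemma gaps_sq_le:
  assumes "q \<ge> 1"
  shows "(\<integral>x. (gaps q K x)\<^sup>2 \<partial>S) \<le> 3 * (K * (m * \<tau>)) + 6 * (2 * (real m)\<^sup>2 * gvar + m * \<tau>)"
proof -
  define G where "G x = (\<Sum>l=1..<K. mdiff (shf ((l * q - 1) * m) x))" for x
  define c where "c x = - cond (shf ((K * q - 1) * m) x)" for x
  have G: "sqi G" unfolding G_def[abs_def] by (intro sqi_intros mdiff_sqi)
  have c: "sqi c" using sqi_cmult[OF sqi_shf[OF cond_sqi], of "-1"] by (simp add: c_def[abs_def])
  have "(\<integral>x. (G x)\<^sup>2 \<partial>S) = (\<Sum>l=1..<K. \<integral>x. (mdiff (shf ((l * q - 1) * m) x))\<^sup>2 \<partial>S)"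
    unfolding G_def
  proof (rule integral_orthogonal_sum_sq)
    fix i j assume ij: "i \<in> {1..<K}" "j \<in> {1..<K}" "i \<noteq> j"
    have "i * q - 1 < j * q - 1" if "i < j" "1 \<le> i" for i j
    proof -
      have "1 \<le> i * q" "i * q < j * q" using that assms by auto
      then show ?thesis by linarith
    qed
    with ij show "(\<integral>x. mdiff (shf ((i * q - 1) * m) x) * mdiff (shf ((j * q - 1) * m) x) \<partial>S) = 0"
      using mdiff_shf_orthogonal[of "i * q - 1" "j * q - 1"] mdiff_shf_orthogonal[of "j * q - 1" "i * q - 1"]
      by (cases "i < j") (auto simp: mult.commute)
  qed (auto intro: sqi_shf mdiff_sqi)
  also have "\<dots> = real (K - 1) * (m * \<tau>)" by (simp add: mdiff_shf_var)
  also have "\<dots> \<le> K * (m * \<tau>)" using \<tau>_nonneg by (intro mult_right_mono) auto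
  finally have 1: "(\<integral>x. (G x)\<^sup>2 \<partial>S) \<le> K * (m * \<tau>)" .
  have 2: "(\<integral>x. (c x)\<^sup>2 \<partial>S) = (\<integral>x. (cond x)\<^sup>2 \<partial>S)"
    using integral_shf[of "\<lambda>x. (cond x)\<^sup>2"] cond_sqi by (simp add: c_def sqi_measurable)
  have "(\<integral>x. (gaps q K x)\<^sup>2 \<partial>S) \<le> (\<integral>x. 3 * ((G x)\<^sup>2 + (cond x)\<^sup>2 + (c x)\<^sup>2) \<partial>S)"
  proof (rule integral_mono)
    show "integrable S (\<lambda>x. (gaps q K x)\<^sup>2)" by (intro sqi_integrable_sq gaps_sqi)
    show "integrable S (\<lambda>x. 3 * ((G x)\<^sup>2 + (cond x)\<^sup>2 + (c x)\<^sup>2))"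
      using sqi_integrable_sq[OF G] sqi_integrable_sq[OF c] sqi_integrable_sq[OF cond_sqi] by simp
    show "(gaps q K x)\<^sup>2 \<le> 3 * ((G x)\<^sup>2 + (cond x)\<^sup>2 + (c x)\<^sup>2)" for x
      using sq3_le[of "G x" "cond x" "c x"] by (simp add: gaps_def G_def c_def)
  qed
  also have "\<dots> = 3 * ((\<integral>x. (G x)\<^sup>2 \<partial>S) + (\<integral>x. (cond x)\<^sup>2 \<partial>S) + (\<integral>x. (c x)\<^sup>2 \<partial>S))"
    using sqi_integrable_sq[OF G] sqi_integrable_sq[OF c] sqi_integrable_sq[OF cond_sqi] by simp
  also have "\<dots> \<le> 3 * (K * (m * \<tau>)) + 6 * (2 * (real m)\<^sup>2 * gvar + m * \<tau>)"
    using 1 2 cond_sq_le by simp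
  finally show ?thesis .
qed

lemma gsum_powr_le:
  assumes "r \<ge> 1" "integrable S (\<lambda>x. \<bar>g x\<bar> powr r)"
  shows "integrable S (\<lambda>x. \<bar>gsum m x\<bar> powr r)"
    and "(\<integral>x. \<bar>gsum m x\<bar> powr r \<partial>S) \<le> m powr r * (\<integral>x. \<bar>g x\<bar> powr r \<partial>S)"
proof -
  have i: "integrable S (\<lambda>x. \<bar>g (shf k x)\<bar> powr r)" for k
    by (rule integrable_shf[OF assms(2)])
  have le: "\<bar>gsum m x\<bar> powr r \<le> m powr (r - 1) * (\<Sum>k<m. \<bar>g (shf k x)\<bar> powr r)" for x
    using abs_sum_powr_le[OF assms(1), of "{..<m}" "\<lambda>k. g (shf k x)"] by (simp add: gsum_def)
  have [measurable]: "gsum m \<in> borel_measurable S" using gsum_sqi by (rule sqi_measurable)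
  have ii: "integrable S (\<lambda>x. m powr (r - 1) * (\<Sum>k<m. \<bar>g (shf k x)\<bar> powr r))"
    using i by auto
  show 1: "integrable S (\<lambda>x. \<bar>gsum m x\<bar> powr r)"
    by (rule Bochner_Integration.integrable_bound[OF ii])
      (use le in \<open>auto simp: abs_mult sum_nonneg intro!: AE_I2\<close>)
  have "(\<integral>x. \<bar>gsum m x\<bar> powr r \<partial>S) \<le> (\<integral>x. m powr (r - 1) * (\<Sum>k<m. \<bar>g (shf k x)\<bar> powr r) \<partial>S)"
    by (rule integral_mono[OF 1 ii le])
  also have "\<dots> = m powr (r - 1) * (\<Sum>k<m. \<integral>x. \<bar>g x\<bar> powr r \<partial>S)"
    using i integral_shf[of "\<lambda>x. \<bar>g x\<bar> powr r"] assms(2) by simp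
  also have "\<dots> = m powr r * (\<integral>x. \<bar>g x\<bar> powr r \<partial>S)"
    using m_pos by (simp add: powr_diff)
  finally show "(\<integral>x. \<bar>gsum m x\<bar> powr r \<partial>S) \<le> m powr r * (\<integral>x. \<bar>g x\<bar> powr r \<partial>S)" .
qed

text \<open>The three summands of \<open>mdiff\<close> have r-th moments at most that of a block
  sum, the second by the conditional Jensen inequality and the third by stationarity in
  addition.\<close>

lemma mdiff_powr_le:
  assumes r: "r \<ge> 1" and g: "integrable S (\<lambda>x. \<bar>g x\<bar> powr r)"
  shows "integrable S (\<lambda>x. \<bar>mdiff x\<bar> powr r)"
    and "(\<integral>x. \<bar>mdiff x\<bar> powr r \<partial>S) \<le> 3 powr r * (m powr r * (\<integral>x. \<bar>g x\<bar> powr r \<partial>S))"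
proof -
  note Y = gsum_powr_le[OF assms]
  note W = integrable_cond_powr[OF sqi_integrable[OF gsum_sqi] r Y(1), of m, folded cond_def]
    integral_cond_powr_le[OF sqi_integrable[OF gsum_sqi] r Y(1), of m, folded cond_def]
  note W' = integrable_shf[OF W(1), of m] integral_shf[of "\<lambda>x. \<bar>cond x\<bar> powr r" m]
  have le: "\<bar>mdiff x\<bar> powr r \<le> 3 powr (r - 1) * (\<bar>gsum m x\<bar> powr r + \<bar>cond x\<bar> powr r + \<bar>cond (shf m x)\<bar> powr r)" for x
  proof -
    have "mdiff x = (\<Sum>i<3. [gsum m x, - cond x, cond (shf m x)] ! i)"
      by (simp add: mdiff_def numeral_3_eq_3)
    also have "\<bar>\<dots>\<bar> powr r \<le> 3 powr (r - 1) * (\<Sum>i<3. \<bar>[gsum m x, - cond x, cond (shf m x)] ! i\<bar> powr r)"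
      using abs_sum_powr_le[OF r, of "{..<3::nat}" "\<lambda>i. [gsum m x, - cond x, cond (shf m x)] ! i"] by simp
    finally show ?thesis by (simp add: numeral_3_eq_3)
  qed
  have [measurable]: "mdiff \<in> borel_measurable S" using mdiff_sqi by (rule sqi_measurable)
  have ii: "integrable S (\<lambda>x. 3 powr (r - 1) * (\<bar>gsum m x\<bar> powr r + \<bar>cond x\<bar> powr r + \<bar>cond (shf m x)\<bar> powr r))"
    using Y(1) W(1) W'(1) by auto
  show 1: "integrable S (\<lambda>x. \<bar>mdiff x\<bar> powr r)"
    by (rule Bochner_Integration.integrable_bound[OF ii])
      (use le in \<open>auto simp: abs_mult intro!: AE_I2\<close>)
  have "(\<integral>x. \<bar>mdiff x\<bar> powr r \<partial>S) \<le> (\<integral>x. 3 powr (r - 1) * (\<bar>gsum m x\<bar> powr r + \<bar>cond x\<bar> powr r + \<bar>cond (shf m x)\<bar> powr r) \<partial>S)"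
    by (rule integral_mono[OF 1 ii le])
  also have "\<dots> = 3 powr (r - 1) * ((\<integral>x. \<bar>gsum m x\<bar> powr r \<partial>S) + 2 * (\<integral>x. \<bar>cond x\<bar> powr r \<partial>S))"
    using Y(1) W(1) W' by simp
  also have "\<dots> \<le> 3 powr (r - 1) * (3 * (m powr r * (\<integral>x. \<bar>g x\<bar> powr r \<partial>S)))"
    using Y(2) W(2) by (intro mult_left_mono) auto
  also have "\<dots> = 3 powr r * (m powr r * (\<integral>x. \<bar>g x\<bar> powr r \<partial>S))"
    by (simp add: powr_diff)
  finally show "(\<integral>x. \<bar>mdiff x\<bar> powr r \<partial>S) \<le> 3 powr r * (m powr r * (\<integral>x. \<bar>g x\<bar> powr r \<partial>S))" .
qed

lemma integrable_lin_err: "sqi f \<Longrightarrow> integrable S (\<lambda>x. lin_err (f x))"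
proof (rule Bochner_Integration.integrable_bound[of _ "\<lambda>x. 6 * (f x)\<^sup>2"])
  assume f: "sqi f"
  then have [measurable]: "f \<in> borel_measurable S" by (rule sqi_measurable)
  show "integrable S (\<lambda>x. 6 * (f x)\<^sup>2)" using sqi_integrable_sq[OF f] by simp
  show "(\<lambda>x. lin_err (f x)) \<in> borel_measurable S" by measurable
  show "AE x in S. norm (lin_err (f x)) \<le> norm (6 * (f x)\<^sup>2)"
    using lin_err_nonneg by (intro AE_I2) (simp add: lin_err_def)
qed

lemma integral_lin_err_le:
  assumes f: "sqi f" and "integrable S (\<lambda>x. \<bar>f x\<bar> powr r)" and "\<delta> > 0" "r \<ge> 2"
  shows "(\<integral>x. lin_err (f x) \<partial>S) \<le> \<delta> * (\<integral>x. (f x)\<^sup>2 \<partial>S) + 6 * \<delta> powr (2 - r) * (\<integral>x. \<bar>f x\<bar> powr r \<partial>S)"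
proof -
  have "(\<integral>x. lin_err (f x) \<partial>S) \<le> (\<integral>x. \<delta> * (f x)\<^sup>2 + 6 * \<delta> powr (2 - r) * \<bar>f x\<bar> powr r \<partial>S)"
    using assms sqi_integrable_sq[OF f]
    by (intro integral_mono integrable_lin_err lin_err_le_powr) auto
  also have "\<dots> = \<delta> * (\<integral>x. (f x)\<^sup>2 \<partial>S) + 6 * \<delta> powr (2 - r) * (\<integral>x. \<bar>f x\<bar> powr r \<partial>S)"
    using assms sqi_integrable_sq[OF f] by simp
  finally show ?thesis .
qed

lemma block_lin_err:
  assumes q: "q \<ge> 1"
  shows "(\<integral>x. lin_err (s * bigB q x + u * bigL q x) \<partial>S)
    \<le> (2 * real q) ^ 3 * (real q * ((1 + \<bar>s\<bar>) ^ 3 * (\<integral>x. lin_err (mdiff x) \<partial>S)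
        + (1 + \<bar>u\<bar>) ^ 3 * (\<integral>x. lin_err (lin x) \<partial>S)))"
proof -
  \<comment> \<open>A common index set for the \<open>q - 1\<close> differences and the
    \<open>q\<close> linear terms, so that \<open>lin_err_sum\<close> can be applied to one sum of
    \<open>2 * q - 1\<close> terms, a count that is then rounded up to \<open>2 * q\<close>.\<close>
  define F where "F i x = (if i < q - 1 then s * mdiff (shf (i * m) x) else u * lin (shf ((i - (q - 1)) * m) x))" for i x
  have eq: "s * bigB q x + u * bigL q x = (\<Sum>i<q - 1 + q. F i x)" for x
  proof -
    have "(\<Sum>i<q - 1 + q. F i x) = (\<Sum>i<q-1. F i x) + (\<Sum>i=q-1..<q-1+q. F i x)"
      using sum.atLeastLessThan_concat[of 0 "q - 1" "q - 1 + q" "\<lambda>i. F i x"] by (simp add: lessThan_atLeast0)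
    also have "(\<Sum>i=q-1..<q-1+q. F i x) = (\<Sum>i<q. F (q - 1 + i) x)"
      by (rule sum.reindex_bij_witness[of _ "\<lambda>j. q - 1 + j" "\<lambda>i. i - (q - 1)"]) auto
    also have "\<dots> = (\<Sum>i<q. u * lin (shf (i * m) x))"
      unfolding F_def by (rule sum.cong) (simp_all only: not_add_less1 if_False diff_add_inverse)
    also have "(\<Sum>i<q-1. F i x) = (\<Sum>i<q-1. s * mdiff (shf (i * m) x))"
      by (simp add: F_def)
    finally show ?thesis
      by (simp only: bigB_def bigL_def sum_distrib_left)
  qed
  \<comment> \<open>The factor 1 + |c| replaces |c| because \<open>lin_err_cmult\<close> asks for a
    factor of at least 1.\<close>
  have c: "lin_err (c * y) \<le> (1 + \<bar>c\<bar>) ^ 3 * lin_err y" for c y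
    by (rule lin_err_cmult) (auto simp: abs_mult mult_right_mono)
  have le: "lin_err (s * bigB q x + u * bigL q x) \<le> (2 * real q) ^ 3 *
     ((\<Sum>i<q. (1 + \<bar>s\<bar>) ^ 3 * lin_err (mdiff (shf (i * m) x))) + (\<Sum>i<q. (1 + \<bar>u\<bar>) ^ 3 * lin_err (lin (shf (i * m) x))))" for x
  proof -
    have "lin_err (s * bigB q x + u * bigL q x) \<le> real (q - 1 + q) ^ 3 * (\<Sum>i<q - 1 + q. lin_err (F i x))"
      unfolding eq using lin_err_sum[of "{..<q - 1 + q}" "\<lambda>i. F i x"] by simp
    also have "(\<Sum>i<q - 1 + q. lin_err (F i x)) = (\<Sum>i<q-1. lin_err (F i x)) + (\<Sum>i=q-1..<q-1+q. lin_err (F i x))"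
      using sum.atLeastLessThan_concat[of 0 "q - 1" "q - 1 + q" "\<lambda>i. lin_err (F i x)"] by (simp add: lessThan_atLeast0)
    also have "(\<Sum>i=q-1..<q-1+q. lin_err (F i x)) = (\<Sum>i<q. lin_err (F (q - 1 + i) x))"
      by (rule sum.reindex_bij_witness[of _ "\<lambda>j. q - 1 + j" "\<lambda>i. i - (q - 1)"]) auto
    also have "\<dots> = (\<Sum>i<q. lin_err (u * lin (shf (i * m) x)))"
      unfolding F_def by (rule sum.cong) (simp_all only: not_add_less1 if_False diff_add_inverse)
    also have "(\<Sum>i<q-1. lin_err (F i x)) = (\<Sum>i<q-1. lin_err (s * mdiff (shf (i * m) x)))"
      by (simp add: F_def)
    also have "\<dots> \<le> (\<Sum>i<q. lin_err (s * mdiff (shf (i * m) x)))"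
      by (intro sum_mono2) (auto simp: lin_err_nonneg)
    also have "real (q - 1 + q) ^ 3 * ((\<Sum>i<q. lin_err (s * mdiff (shf (i * m) x))) + (\<Sum>i<q. lin_err (u * lin (shf (i * m) x))))
      \<le> (2 * real q) ^ 3 *
     ((\<Sum>i<q. (1 + \<bar>s\<bar>) ^ 3 * lin_err (mdiff (shf (i * m) x))) + (\<Sum>i<q. (1 + \<bar>u\<bar>) ^ 3 * lin_err (lin (shf (i * m) x))))"
      by (intro mult_mono power_mono add_mono sum_mono c add_nonneg_nonneg sum_nonneg mult_nonneg_nonneg lin_err_nonneg) auto
    finally show ?thesis by (simp add: mult_left_mono)
  qed
  have i: "integrable S (\<lambda>x. lin_err (mdiff (shf k x)))" "integrable S (\<lambda>x. lin_err (lin (shf k x)))" for k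
    by (intro integrable_lin_err sqi_intros mdiff_sqi lin_sqi)+
  have e: "(\<integral>x. lin_err (mdiff (shf k x)) \<partial>S) = (\<integral>x. lin_err (mdiff x) \<partial>S)"
    "(\<integral>x. lin_err (lin (shf k x)) \<partial>S) = (\<integral>x. lin_err (lin x) \<partial>S)" for k
    using integral_shf[of "\<lambda>x. lin_err (mdiff x)" k] integral_shf[of "\<lambda>x. lin_err (lin x)" k]
      integrable_lin_err[OF mdiff_sqi] integrable_lin_err[OF lin_sqi] by auto
  have "(\<integral>x. lin_err (s * bigB q x + u * bigL q x) \<partial>S) \<le> (\<integral>x. (2 * real q) ^ 3 *
     ((\<Sum>i<q. (1 + \<bar>s\<bar>) ^ 3 * lin_err (mdiff (shf (i * m) x))) + (\<Sum>i<q. (1 + \<bar>u\<bar>) ^ 3 * lin_err (lin (shf (i * m) x)))) \<partial>S)"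
    using i by (intro integral_mono le integrable_lin_err sqi_intros bigB_sqi bigL_sqi) auto
  also have "\<dots> = (2 * real q) ^ 3 * (real q * ((1 + \<bar>s\<bar>) ^ 3 * (\<integral>x. lin_err (mdiff x) \<partial>S)
        + (1 + \<bar>u\<bar>) ^ 3 * (\<integral>x. lin_err (lin x) \<partial>S)))"
    using i by (simp add: e distrib_left)
  finally show ?thesis .
qed

text \<open>A second order expansion of the characteristic function of a centred variable of
  variance \<open>v s u q\<close>. The square of \<open>v s u q\<close> is the price of replacing 1
  - v / 2 by exp (- v / 2), which behaves well under powers.\<close>

lemma block_char:
  defines "v s u q \<equiv> s\<^sup>2 * (real (q - 1) * (m * \<tau>)) + u\<^sup>2 * (real q * (m * evar))"
  shows "cmod ((\<integral>x. iexp (s * bigB q x + u * bigL q x) \<partial>S) - complex_of_real (exp (- (v s u q / 2))))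
    \<le> (v s u q)\<^sup>2 + (\<integral>x. lin_err (s * bigB q x + u * bigL q x) \<partial>S)"
proof -
  define f where "f x = s * bigB q x + u * bigL q x" for x
  have f: "sqi f" unfolding f_def[abs_def] by (intro sqi_intros bigB_sqi bigL_sqi)
  then have [measurable]: "f \<in> borel_measurable S" by (rule sqi_measurable)
  have mean: "(\<integral>x. f x \<partial>S) = 0"
    by (simp add: f_def sqi_integrable bigB_sqi bigL_sqi bigB_mean bigL_mean)
  have var: "(\<integral>x. (f x)\<^sup>2 \<partial>S) = v s u q"
    unfolding f_def v_def by (rule block_var)
  have "evar \<ge> 0" by (simp add: evar_def)
  then have v0: "v s u q \<ge> 0" using \<tau>_nonneg by (simp add: v_def)
  have "cmod (char (distr S borel f) 1 - (1 - 1\<^sup>2 * v s u q / 2))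
      \<le> (1\<^sup>2 / 6) * (\<integral>x. min (6 * (f x)\<^sup>2) (\<bar>1\<bar> * \<bar>f x\<bar> ^ 3) \<partial>S)"
    by (rule P.char_approx3') (use f mean var in \<open>auto simp: sqi_integrable sqi_integrable_sq\<close>)
  moreover have "char (distr S borel f) 1 = (\<integral>x. iexp (f x) \<partial>S)"
    by (simp add: char_def integral_distr)
  ultimately have 1: "cmod ((\<integral>x. iexp (f x) \<partial>S) - complex_of_real (1 - v s u q / 2)) \<le> (\<integral>x. lin_err (f x) \<partial>S) / 6"
    by (simp add: lin_err_def)
  have 2: "cmod (complex_of_real (1 - v s u q / 2) - complex_of_real (exp (- (v s u q / 2)))) \<le> (v s u q)\<^sup>2"
  proof -
    have "cmod (complex_of_real ((1 - v s u q / 2) - exp (- (v s u q / 2)))) = \<bar>(1 - v s u q / 2) - exp (- (v s u q / 2))\<bar>"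
      by (rule norm_of_real)
    also have "\<dots> \<le> (v s u q / 2)\<^sup>2" by (rule exp_minus_approx) (use v0 in simp)
    also have "\<dots> \<le> (v s u q)\<^sup>2" using v0 by (intro power_mono) auto
    finally show ?thesis by (simp only: of_real_diff)
  qed
  have 3: "0 \<le> (\<integral>x. lin_err (f x) \<partial>S)"
    by (simp add: lin_err_nonneg)
  have "cmod ((\<integral>x. iexp (f x) \<partial>S) - complex_of_real (exp (- (v s u q / 2)))) \<le>
     cmod ((\<integral>x. iexp (f x) \<partial>S) - complex_of_real (1 - v s u q / 2))
     + cmod (complex_of_real (1 - v s u q / 2) - complex_of_real (exp (- (v s u q / 2))))"
    by (rule order_trans[OF _ norm_triangle_ineq]) simp
  then show ?thesis using 1 2 3 unfolding f_def by simp
qed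

text \<open>The groups are independent, so the characteristic function is a \<open>K\<close>-th
  power, and a difference of \<open>K\<close>-th powers of numbers in the unit disc is at most
  \<open>K\<close> times the difference of the bases. The linear part has fourth moments, hence the
  exponent -2 = 2 - 4 of \<delta> in its error term, while the part with \<open>g\<close> only has
  moments of order r.\<close>

lemma blocks_char:
  defines "v s u q \<equiv> s\<^sup>2 * (real (q - 1) * (m * \<tau>)) + u\<^sup>2 * (real q * (m * evar))"
  assumes q: "q \<ge> 1" and r: "r \<ge> 2" and g: "integrable S (\<lambda>x. \<bar>g x\<bar> powr r)"
    and lin4: "integrable S (\<lambda>x. (lin x) ^ 4)" and \<delta>: "\<delta> > 0"
  shows "cmod ((\<integral>x. iexp (s * blocks q K x + u * (\<Sum>i<K * q * m. e (shf i x))) \<partial>S) - complex_of_real (exp (- (K * v s u q / 2))))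
    \<le> K * ((v s u q)\<^sup>2 + (2 * real q) ^ 3 * (real q *
        ((1 + \<bar>s\<bar>) ^ 3 * (\<delta> * (m * \<tau>) + 6 * \<delta> powr (2 - r) * (3 powr r * (m powr r * (\<integral>x. \<bar>g x\<bar> powr r \<partial>S))))
       + (1 + \<bar>u\<bar>) ^ 3 * (\<delta> * (m * evar) + 6 * \<delta> powr (-2) * (\<integral>x. (lin x) ^ 4 \<partial>S)))))"
proof -
  define f where "f x = s * bigB q x + u * bigL q x" for x
  have f: "sqi f" unfolding f_def[abs_def] by (intro sqi_intros bigB_sqi bigL_sqi)
  then have [measurable]: "f \<in> borel_measurable S" by (rule sqi_measurable)
  have fdep: "dep (q * m) f"
    unfolding f_def[abs_def] using bigB_dep bigL_dep by (rule dep_comp2)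
  define \<phi> where "\<phi> = (\<integral>x. iexp (f x) \<partial>S)"
  have i: "integrable S (\<lambda>x. iexp (f x))"
    by (rule P.integrable_const_bound[where B = 1]) auto
  have "s * blocks q K x + u * (\<Sum>i<K * q * m. e (shf i x)) = (\<Sum>l<K. f (shf (l * (q * m)) x))" for x
    by (simp add: bigL_blocks[symmetric] blocks_def f_def sum_distrib_left sum.distrib)
  then have "(\<integral>x. iexp (s * blocks q K x + u * (\<Sum>i<K * q * m. e (shf i x))) \<partial>S)
     = (\<integral>x. (\<Prod>l<K. iexp (f (shf (l * (q * m)) x))) \<partial>S)"
    by (simp only: iexp_sum)
  also have "\<dots> = \<phi> ^ K"
    unfolding \<phi>_def by (rule integral_prod_shf[OF i]) (rule dep_comp[OF fdep])
  finally have 1: "(\<integral>x. iexp (s * blocks q K x + u * (\<Sum>i<K * q * m. e (shf i x))) \<partial>S) = \<phi> ^ K" .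
  have "evar \<ge> 0" by (simp add: evar_def)
  then have v0: "v s u q \<ge> 0" using \<tau>_nonneg by (simp add: v_def)
  have 2: "complex_of_real (exp (- (K * v s u q / 2))) = complex_of_real (exp (- (v s u q / 2))) ^ K"
    by (simp only: of_real_power[symmetric] exp_of_nat_mult[symmetric]) simp
  have "cmod \<phi> \<le> 1"
    unfolding \<phi>_def using integral_norm_bound[of S "\<lambda>x. iexp (f x)"] by (simp add: P.prob_space)
  moreover have "cmod (complex_of_real (exp (- (v s u q / 2)))) \<le> 1"
    unfolding norm_of_real using v0 by simp
  ultimately have "cmod (\<phi> ^ K - complex_of_real (exp (- (v s u q / 2))) ^ K) \<le> K * cmod (\<phi> - complex_of_real (exp (- (v s u q / 2))))"
    by (rule norm_power_diff)
  also have "\<dots> \<le> K * ((v s u q)\<^sup>2 + (\<integral>x. lin_err (f x) \<partial>S))"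
    using block_char[of s q u] by (intro mult_left_mono) (simp_all add: \<phi>_def f_def v_def exp_of_real[symmetric] del: exp_of_real)
  also have "(\<integral>x. lin_err (f x) \<partial>S) \<le> (2 * real q) ^ 3 * (real q * ((1 + \<bar>s\<bar>) ^ 3 * (\<integral>x. lin_err (mdiff x) \<partial>S)
        + (1 + \<bar>u\<bar>) ^ 3 * (\<integral>x. lin_err (lin x) \<partial>S)))"
    unfolding f_def by (rule block_lin_err[OF q])
  also have "(\<integral>x. lin_err (mdiff x) \<partial>S) \<le> \<delta> * (m * \<tau>) + 6 * \<delta> powr (2 - r) * (3 powr r * (m powr r * (\<integral>x. \<bar>g x\<bar> powr r \<partial>S)))"
  proof -
    have "(\<integral>x. lin_err (mdiff x) \<partial>S) \<le> \<delta> * (m * \<tau>) + 6 * \<delta> powr (2 - r) * (\<integral>x. \<bar>mdiff x\<bar> powr r \<partial>S)"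
      using integral_lin_err_le[OF mdiff_sqi mdiff_powr_le(1)[OF _ g] \<delta> r] r by (simp add: mdiff_var)
    also have "(\<integral>x. \<bar>mdiff x\<bar> powr r \<partial>S) \<le> 3 powr r * (m powr r * (\<integral>x. \<bar>g x\<bar> powr r \<partial>S))"
      using r by (intro mdiff_powr_le g) auto
    finally show ?thesis by (simp add: mult_left_mono)
  qed
  also have "(\<integral>x. lin_err (lin x) \<partial>S) \<le> \<delta> * (m * evar) + 6 * \<delta> powr (-2) * (\<integral>x. (lin x) ^ 4 \<partial>S)"
  proof -
    have 4: "\<bar>lin x\<bar> powr 4 = (lin x) ^ 4" for x by (simp add: powr_numeral power_even_abs)
    show ?thesis
      using integral_lin_err_le[OF lin_sqi, of 4 \<delta>] \<delta> lin4 by (simp add: 4 lin_var)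
  qed
  finally have "cmod (\<phi> ^ K - complex_of_real (exp (- (v s u q / 2))) ^ K)
     \<le> K * ((v s u q)\<^sup>2 + (2 * real q) ^ 3 * (real q *
        ((1 + \<bar>s\<bar>) ^ 3 * (\<delta> * (m * \<tau>) + 6 * \<delta> powr (2 - r) * (3 powr r * (m powr r * (\<integral>x. \<bar>g x\<bar> powr r \<partial>S))))
       + (1 + \<bar>u\<bar>) ^ 3 * (\<delta> * (m * evar) + 6 * \<delta> powr (-2) * (\<integral>x. (lin x) ^ 4 \<partial>S)))))"
    by (simp add: mult_left_mono)
  then show ?thesis unfolding 1 2 .
qed

end

section \<open>The joint law of uniform spacings\<close>

abbreviation "seq_borel \<equiv> (\<Pi>\<^sub>M i\<in>UNIV::nat set. borel :: real measure)"

definition expm :: "real measure" where "expm = density lborel (exponential_density 1)"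
definition unim :: "real measure" where "unim = uniform_measure lborel {0..1}"

lemma sets_expm [measurable_cong, simp]: "sets expm = sets borel"
  by (simp add: expm_def)

lemma sets_unim [measurable_cong, simp]: "sets unim = sets borel"
  by (simp add: unim_def)

lemma space_expm [simp]: "space expm = UNIV"
  by (simp add: expm_def)

lemma space_unim [simp]: "space unim = UNIV"
  by (simp add: unim_def)

lemma prob_space_expm: "prob_space expm"
  unfolding expm_def by (rule prob_space_exponential_density) simp

lemma prob_space_unim: "prob_space unim"
  unfolding unim_def by (rule prob_space_uniform_measure) auto

lemma sequence_space_expm: "sequence_space expm"
  by (simp add: sequence_space_def product_prob_spaceI prob_space_expm)

lemma sequence_space_unim: "sequence_space unim"
  by (simp add: sequence_space_def product_prob_spaceI prob_space_unim)

interpretation EX: sequence_space expm by (rule sequence_space_expm)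
interpretation UX: sequence_space unim by (rule sequence_space_unim)

lemma sets_seq_expm [measurable_cong, simp]: "sets (\<Pi>\<^sub>M i\<in>UNIV::nat set. expm) = sets seq_borel"
  by (rule sets_PiM_cong) auto

lemma sets_seq_unim [measurable_cong, simp]: "sets (\<Pi>\<^sub>M i\<in>UNIV::nat set. unim) = sets seq_borel"
  by (rule sets_PiM_cong) auto

lemma space_seq_borel [simp]: "space seq_borel = UNIV"
  by (simp add: space_PiM PiE_UNIV_domain)

lemma space_seq_expm [simp]: "space (\<Pi>\<^sub>M i\<in>UNIV::nat set. expm) = UNIV"
  by (simp add: space_PiM PiE_UNIV_domain)

lemma space_seq_unim [simp]: "space (\<Pi>\<^sub>M i\<in>UNIV::nat set. unim) = UNIV"
  by (simp add: space_PiM PiE_UNIV_domain)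

lemma nn_integral_expm:
  assumes [measurable]: "f \<in> borel_measurable borel"
  shows "(\<integral>\<^sup>+x. f x \<partial>expm) = (\<integral>\<^sup>+x. f x * ennreal (exp (- x)) * indicator {0..} x \<partial>lborel)"
  unfolding expm_def
  by (subst nn_integral_density)
    (auto intro!: nn_integral_cong simp: exponential_density_def indicator_def mult.commute)

lemma nn_integral_expm_exp:
  assumes [measurable]: "f \<in> borel_measurable borel"
  shows "(\<integral>\<^sup>+x. f x * ennreal (exp x) \<partial>expm) = (\<integral>\<^sup>+x. f x * indicator {0..} x \<partial>lborel)"
  by (subst nn_integral_expm)
    (auto intro!: nn_integral_cong simp: mult.assoc simp flip: ennreal_mult exp_add)

lemma nn_integral_unim:
  assumes [measurable]: "f \<in> borel_measurable borel"
  shows "(\<integral>\<^sup>+x. f x \<partial>unim) = (\<integral>\<^sup>+x. f x * indicator {0..1} x \<partial>lborel)"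
  unfolding unim_def by (subst nn_integral_uniform_measure) (auto simp: divide_ennreal_def)

lemma AE_expm_nonneg: "AE x in expm. 0 \<le> x"
  unfolding expm_def by (subst AE_density) (auto simp: exponential_density_def)

lemma AE_unim_nonneg: "AE x in unim. 0 \<le> x"
  unfolding unim_def by (rule AE_uniform_measureI) auto

context sequence_space
begin

lemma nn_integral_component:
  assumes [measurable]: "f \<in> borel_measurable M"
  shows "(\<integral>\<^sup>+z. f (z i) \<partial>S) = (\<integral>\<^sup>+t. f t \<partial>M)"
proof -
  have "(\<integral>\<^sup>+t. f t \<partial>M) = (\<integral>\<^sup>+t. f t \<partial>distr S M (\<lambda>\<omega>. \<omega> i))"
    by (simp add: PiM_component)
  then show ?thesis by (simp add: nn_integral_distr)
qed

lemma nn_integral_reindex: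
  assumes [measurable]: "f \<in> borel_measurable S" and "inj t"
  shows "(\<integral>\<^sup>+x. f (\<lambda>i. x (t i)) \<partial>S) = (\<integral>\<^sup>+x. f x \<partial>S)"
proof -
  have "(\<integral>\<^sup>+x. f x \<partial>S) = (\<integral>\<^sup>+x. f x \<partial>distr S S (\<lambda>x i. x (t i)))"
    by (simp only: distr_reindex(2)[OF assms(2)])
  then show ?thesis
    by (simp add: nn_integral_distr[OF distr_reindex(1)[OF assms(2)]])
qed

lemma AE_seq_component: "(AE x in M. P x) \<Longrightarrow> AE x in S. P (x i)"
  using AE_PiM_component[of UNIV "\<lambda>_. M" i P] prob_space by simp

lemma nn_integral_case_nat:
  assumes [measurable]: "f \<in> borel_measurable S"
  shows "(\<integral>\<^sup>+x. f x \<partial>S) = (\<integral>\<^sup>+t. \<integral>\<^sup>+r. f (case_nat t r) \<partial>S \<partial>M)"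
proof -
  have "(\<integral>\<^sup>+x. f x \<partial>S) = (\<integral>\<^sup>+x. f x \<partial>distr (M \<Otimes>\<^sub>M S) S (\<lambda>(s, \<omega>). case_nat s \<omega>))"
    by (simp add: PiM_iter)
  also have "\<dots> = (\<integral>\<^sup>+p. f (case p of (s, \<omega>) \<Rightarrow> case_nat s \<omega>) \<partial>(M \<Otimes>\<^sub>M S))"
    by (rule nn_integral_distr) auto
  also have "\<dots> = (\<integral>\<^sup>+t. \<integral>\<^sup>+r. f (case_nat t r) \<partial>S \<partial>M)"
    by (subst P.nn_integral_fst[symmetric]) auto
  finally show ?thesis .
qed

lemma nn_integral_case_nat_swap:
  assumes [measurable]: "f \<in> borel_measurable S"
  shows "(\<integral>\<^sup>+x. f x \<partial>S) = (\<integral>\<^sup>+r. \<integral>\<^sup>+t. f (case_nat t r) \<partial>M \<partial>S)"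
proof -
  interpret PS: pair_sigma_finite M S
    by (simp add: pair_sigma_finite_def P.sigma_finite_measure_axioms sigma_finite_measures)
  have "(\<integral>\<^sup>+t. \<integral>\<^sup>+r. f (case_nat t r) \<partial>S \<partial>M) = (\<integral>\<^sup>+r. \<integral>\<^sup>+t. f (case_nat t r) \<partial>M \<partial>S)"
    by (rule PS.Fubini'[symmetric]) auto
  then show ?thesis by (simp only: nn_integral_case_nat[OF assms])
qed

end

lemma AE_seq_expm_nonneg: "AE x in (\<Pi>\<^sub>M i\<in>UNIV::nat set. expm). \<forall>i. 0 \<le> x i"
  by (subst AE_all_countable) (auto intro!: EX.AE_seq_component AE_expm_nonneg)

lemma AE_seq_unim_nonneg: "AE x in (\<Pi>\<^sub>M i\<in>UNIV::nat set. unim). \<forall>i. 0 \<le> x i"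
  by (subst AE_all_countable) (auto intro!: UX.AE_seq_component AE_unim_nonneg)

text \<open>Given the earlier coordinate, equality of two coordinates requires the later one to hit
  a single point, which is a Lebesgue null set.\<close>

lemma AE_seq_unim_inj: "AE x in (\<Pi>\<^sub>M i\<in>UNIV::nat set. unim). inj x"
proof -
  have less: "AE x in UX.S. x i \<noteq> x j" if "i < j" for i j :: nat
  proof -
    have [measurable]: "{x::nat \<Rightarrow> real. x i = x j} \<in> sets seq_borel"
      using borel_measurable_eq[of "\<lambda>x. x i" seq_borel "\<lambda>x. x j"] by simp
    have "(\<integral>\<^sup>+x. indicator {x. x i = x j} x \<partial>UX.S)
       = (\<integral>\<^sup>+x. \<integral>\<^sup>+z. indicator {x. x i = x j} (comb_seq j x z) \<partial>UX.S \<partial>UX.S)"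
      by (rule UX.nn_integral_comb_seq) measurable
    also have "\<dots> = (\<integral>\<^sup>+x. \<integral>\<^sup>+z. indicator {x i} (z 0) \<partial>UX.S \<partial>UX.S)"
      using that by (intro nn_integral_cong) (auto simp: comb_seq_def indicator_def)
    also have "\<dots> = (\<integral>\<^sup>+x. \<integral>\<^sup>+t. indicator {x i} t \<partial>unim \<partial>UX.S)"
      by (intro nn_integral_cong UX.nn_integral_component) auto
    also have "\<dots> = (\<integral>\<^sup>+(x::nat \<Rightarrow> real). 0 \<partial>UX.S)"
    proof (intro nn_integral_cong)
      fix x :: "nat \<Rightarrow> real"
      have "(\<integral>\<^sup>+t. indicator {x i} t \<partial>unim) = (\<integral>\<^sup>+t. indicator {x i} t * indicator {0..1} t \<partial>lborel)"
        by (rule nn_integral_unim) auto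
      also have "\<dots> \<le> (\<integral>\<^sup>+t. indicator {x i} t \<partial>lborel)"
        by (intro nn_integral_mono) (auto simp: indicator_def)
      finally show "(\<integral>\<^sup>+t. indicator {x i} t \<partial>unim) = 0" by simp
    qed
    finally have "emeasure UX.S {x. x i = x j} = 0"
      by (simp add: nn_integral_indicator)
    moreover have "{x. x i = x j} \<in> sets seq_borel" by measurable
    ultimately show ?thesis
      by (intro AE_I[of _ _ "{x. x i = x j}"]) auto
  qed
  have "AE x in UX.S. i \<noteq> j \<longrightarrow> x i \<noteq> x j" for i j
    using less[of i j] less[of j i] by (cases "i < j"; cases "j < i") auto
  then have "AE x in UX.S. \<forall>i j. i \<noteq> j \<longrightarrow> x i \<noteq> x j"
    by (simp add: AE_all_countable)
  then show ?thesis
    by eventually_elim (auto simp: inj_def)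
qed

lemma measurable_seqI:
  assumes "\<And>i. (\<lambda>x. f x i) \<in> borel_measurable M"
  shows "f \<in> M \<rightarrow>\<^sub>M seq_borel"
proof -
  have "(\<lambda>x. \<lambda>i\<in>UNIV. f x i) \<in> M \<rightarrow>\<^sub>M seq_borel"
    by (rule measurable_restrict) (rule assms)
  then show ?thesis by (simp add: restrict_def)
qed

lemma pred_le_real [measurable (raw)]:
  fixes f g :: "'a \<Rightarrow> real"
  assumes "f \<in> borel_measurable M" "g \<in> borel_measurable M"
  shows "Measurable.pred M (\<lambda>x. f x \<le> g x)"
  unfolding pred_def using assms by (rule borel_measurable_le)

section \<open>The ordered sample and its increments\<close>

definition trunc :: "nat \<Rightarrow> (nat \<Rightarrow> real) \<Rightarrow> nat \<Rightarrow> real" where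
  "trunc N u = (\<lambda>i. if i < N then u i else 0)"

text \<open>The value 0 for \<open>N = 0\<close> is U_0. Through it \<open>inc\<close> includes that
  the first coordinate is nonnegative, so that all increments are.\<close>

definition prv :: "nat \<Rightarrow> (nat \<Rightarrow> real) \<Rightarrow> real" where
  "prv N u = (if N = 0 then 0 else u (N - 1))"

definition inc :: "nat \<Rightarrow> (nat \<Rightarrow> real) \<Rightarrow> bool" where
  "inc N u \<longleftrightarrow> (\<forall>i<N. prv i u \<le> u i)"

definition psum :: "nat \<Rightarrow> (nat \<Rightarrow> real) \<Rightarrow> nat \<Rightarrow> real" where
  "psum n x i = (\<Sum>j\<le>i. x j) / real n"

text \<open>
  The weight \<open>exp (x\<^sub>0 + \<dots> + x\<^bsub>N-1\<^esub>)\<close> cancels the exponential density, so that \<open>wt n N\<close> turns the law of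
  the exponentials into Lebesgue measure on a simplex.
\<close>
definition wt :: "nat \<Rightarrow> nat \<Rightarrow> (nat \<Rightarrow> real) \<Rightarrow> ennreal" where
  "wt n N x = ennreal (exp (\<Sum>i<N. x i)) * indicator {..real n} (\<Sum>i<N. x i)"

lemma measurable_trunc [measurable]: "trunc N \<in> seq_borel \<rightarrow>\<^sub>M seq_borel"
  unfolding trunc_def[abs_def] by (rule measurable_seqI) simp

lemma measurable_psum [measurable]: "psum n \<in> seq_borel \<rightarrow>\<^sub>M seq_borel"
  unfolding psum_def[abs_def] by (rule measurable_seqI) simp

lemma measurable_prv [measurable]: "prv N \<in> borel_measurable seq_borel"
  unfolding prv_def[abs_def] by simp

lemma measurable_inc [measurable]: "Measurable.pred seq_borel (inc N)"
  unfolding inc_def[abs_def]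
  by (intro pred_intros_countable(1) pred_intros_imp' pred_le_real measurable_prv) simp

lemma measurable_wt [measurable]: "wt n N \<in> borel_measurable seq_borel"
  unfolding wt_def[abs_def] by measurable

lemma measurable_fun_upd_seq [measurable]:
  assumes [measurable]: "f \<in> M \<rightarrow>\<^sub>M seq_borel" "t \<in> borel_measurable M"
  shows "(\<lambda>x. (f x)(N := t x)) \<in> M \<rightarrow>\<^sub>M seq_borel"
proof (rule measurable_seqI)
  fix i
  have "(\<lambda>x. f x i) \<in> borel_measurable M" by measurable
  then show "(\<lambda>x. ((f x)(N := t x)) i) \<in> borel_measurable M"
    by (cases "i = N") auto
qed

lemma trunc_comb_seq: "trunc (Suc N) (comb_seq N u t) = (trunc N u)(N := t 0)"
  by (auto simp: trunc_def comb_seq_def fun_eq_iff)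

lemma inc_comb_seq: "inc (Suc N) (comb_seq N u t) \<longleftrightarrow> inc N u \<and> prv N u \<le> t 0"
  by (auto simp: inc_def prv_def comb_seq_def less_Suc_eq)

text \<open>Passing from an increasing vector to \<open>n\<close> times its increments is a linear
  substitution with constant Jacobian. It is carried out one coordinate at a time: given increments
  with sum s, the next value t between s / n and 1 is written as (s + y) / n with y \<ge> 0 and s +
  y \<le> n, which contributes one factor 1 / n.\<close>

lemma ordered_uniform_density:
  assumes n: "n \<ge> 1" and [measurable]: "F \<in> borel_measurable seq_borel"
  shows "(\<integral>\<^sup>+u. F (trunc N u) * indicator {u. inc N u} u \<partial>UX.S)
    = ennreal (1 / n) ^ N * (\<integral>\<^sup>+x. F (trunc N (psum n x)) * wt n N x \<partial>EX.S)"
  using assms(2)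
proof (induction N arbitrary: F)
  case 0
  have 1: "trunc 0 u = (\<lambda>_. 0)" for u by (auto simp: trunc_def)
  have 2: "inc 0 u" for u by (simp add: inc_def)
  show ?case using n by (simp add: 1 2 wt_def UX.P.emeasure_space_1[simplified] EX.P.emeasure_space_1[simplified])
next
  case (Suc N)
  have [measurable]: "F \<in> borel_measurable seq_borel" by fact
  \<comment> \<open>The last coordinate is integrated out first, so that the induction hypothesis
    applies to a function of the first \<open>N\<close> coordinates.\<close>
  define G where "G v = (\<integral>\<^sup>+t. F (v(N := t)) * indicator {t. prv N v \<le> t} t \<partial>unim)" for v
  have [measurable]: "G \<in> borel_measurable seq_borel"
    unfolding G_def[abs_def] by measurable
  have "(\<integral>\<^sup>+u. F (trunc (Suc N) u) * indicator {u. inc (Suc N) u} u \<partial>UX.S)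
     = (\<integral>\<^sup>+u. \<integral>\<^sup>+t. F (trunc (Suc N) (comb_seq N u t)) * indicator {u. inc (Suc N) u} (comb_seq N u t) \<partial>UX.S \<partial>UX.S)"
    by (rule UX.nn_integral_comb_seq) measurable
  also have "\<dots> = (\<integral>\<^sup>+u. G (trunc N u) * indicator {u. inc N u} u \<partial>UX.S)"
  proof (rule nn_integral_cong)
    fix u :: "nat \<Rightarrow> real"
    have p: "prv N (trunc N u) = prv N u" by (simp add: prv_def trunc_def)
    have "(\<integral>\<^sup>+t. F (trunc (Suc N) (comb_seq N u t)) * indicator {u. inc (Suc N) u} (comb_seq N u t) \<partial>UX.S)
      = (\<integral>\<^sup>+t. F ((trunc N u)(N := t 0)) * indicator {t. prv N u \<le> t} (t 0) * indicator {u. inc N u} u \<partial>UX.S)"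
      by (intro nn_integral_cong) (auto simp: trunc_comb_seq inc_comb_seq indicator_def)
    also have "\<dots> = (\<integral>\<^sup>+t. F ((trunc N u)(N := t 0)) * indicator {t. prv N u \<le> t} (t 0) \<partial>UX.S) * indicator {u. inc N u} u"
      by (rule nn_integral_multc) measurable
    also have "(\<integral>\<^sup>+t. F ((trunc N u)(N := t 0)) * indicator {t. prv N u \<le> t} (t 0) \<partial>UX.S)
       = (\<integral>\<^sup>+t. F ((trunc N u)(N := t)) * indicator {t. prv N u \<le> t} t \<partial>unim)"
      by (rule UX.nn_integral_component) measurable
    finally show "(\<integral>\<^sup>+t. F (trunc (Suc N) (comb_seq N u t)) * indicator {u. inc (Suc N) u} (comb_seq N u t) \<partial>UX.S)
      = G (trunc N u) * indicator {u. inc N u} u"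
      by (simp add: G_def p)
  qed
  also have "\<dots> = ennreal (1 / n) ^ N * (\<integral>\<^sup>+x. G (trunc N (psum n x)) * wt n N x \<partial>EX.S)"
    by (rule Suc.IH) measurable
  also have "(\<integral>\<^sup>+x. G (trunc N (psum n x)) * wt n N x \<partial>EX.S)
     = (\<integral>\<^sup>+x. ennreal (1 / n) * (\<integral>\<^sup>+z. F (trunc (Suc N) (psum n (comb_seq N x z))) * wt n (Suc N) (comb_seq N x z) \<partial>EX.S) \<partial>EX.S)"
  proof (rule nn_integral_cong_AE, use AE_seq_expm_nonneg in eventually_elim)
    fix x :: "nat \<Rightarrow> real" assume x: "\<forall>i. 0 \<le> x i"
    define s where "s = (\<Sum>i<N. x i)"
    define v where "v = trunc N (psum n x)"
    have s: "s \<ge> 0" using x by (simp add: s_def sum_nonneg)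
    have p: "prv N v = s / n"
    proof (cases N)
      case (Suc M)
      then have "{..M} = {..<N}" by auto
      then show ?thesis by (simp add: Suc prv_def v_def trunc_def psum_def s_def)
    qed (simp add: prv_def s_def)
    have "trunc (Suc N) (psum n (comb_seq N x z)) = v(N := (s + z 0) / n)" for z
    proof
      fix i
      have a: "(\<Sum>j\<le>i. comb_seq N x z j) = (\<Sum>j\<le>i. x j)" if "i < N"
        using that by (intro sum.cong) (auto simp: comb_seq_def)
      have "(\<Sum>j\<le>N. comb_seq N x z j) = (\<Sum>j<N. comb_seq N x z j) + comb_seq N x z N"
        by (simp add: lessThan_Suc_atMost[symmetric])
      also have "\<dots> = s + z 0"
        by (auto simp: comb_seq_def s_def)
      finally show "trunc (Suc N) (psum n (comb_seq N x z)) i = (v(N := (s + z 0) / n)) i"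
        using a by (auto simp: trunc_def psum_def v_def less_Suc_eq)
    qed
    moreover have "(\<Sum>i<Suc N. comb_seq N x z i) = s + z 0" for z
      by (auto simp: comb_seq_def s_def)
    ultimately have "(\<integral>\<^sup>+z. F (trunc (Suc N) (psum n (comb_seq N x z))) * wt n (Suc N) (comb_seq N x z) \<partial>EX.S)
      = (\<integral>\<^sup>+z. F (v(N := (s + z 0) / n)) * (ennreal (exp (s + z 0)) * indicator {..real n} (s + z 0)) \<partial>EX.S)"
      unfolding wt_def by simp
    also have "\<dots> = (\<integral>\<^sup>+y. F (v(N := (s + y) / n)) * (ennreal (exp (s + y)) * indicator {..real n} (s + y)) \<partial>expm)"
      by (rule EX.nn_integral_component[where f = "\<lambda>y. F (v(N := (s + y) / n)) * (ennreal (exp (s + y)) * indicator {..real n} (s + y))"]) measurable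
    also have "\<dots> = (\<integral>\<^sup>+y. (ennreal (exp s) * (F (v(N := (s + y) / n)) * indicator {..real n} (s + y))) * ennreal (exp y) \<partial>expm)"
      by (intro nn_integral_cong) (simp add: exp_add ennreal_mult ac_simps)
    also have "\<dots> = (\<integral>\<^sup>+y. (ennreal (exp s) * (F (v(N := (s + y) / n)) * indicator {..real n} (s + y))) * indicator {0..} y \<partial>lborel)"
      by (rule nn_integral_expm_exp) measurable
    also have "\<dots> = ennreal (exp s) * (\<integral>\<^sup>+y. F (v(N := (s + y) / n)) * indicator {..real n} (s + y) * indicator {0..} y \<partial>lborel)"
      by (simp add: nn_integral_cmult[symmetric] mult.assoc)
    finally have R: "(\<integral>\<^sup>+z. F (trunc (Suc N) (psum n (comb_seq N x z))) * wt n (Suc N) (comb_seq N x z) \<partial>EX.S)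
      = ennreal (exp s) * (\<integral>\<^sup>+y. F (v(N := (s + y) / n)) * indicator {..real n} (s + y) * indicator {0..} y \<partial>lborel)" .
    have "G v = (\<integral>\<^sup>+t. F (v(N := t)) * indicator {t. s / n \<le> t} t * indicator {0..1} t \<partial>lborel)"
      unfolding G_def p by (rule nn_integral_unim) measurable
    also have "\<dots> = ennreal \<bar>1 / n\<bar> * (\<integral>\<^sup>+y. F (v(N := s / n + 1 / n * y)) * indicator {t. s / n \<le> t} (s / n + 1 / n * y) * indicator {0..1} (s / n + 1 / n * y) \<partial>lborel)"
      using n by (intro nn_integral_real_affine) auto
    also have "(\<integral>\<^sup>+y. F (v(N := s / n + 1 / n * y)) * indicator {t. s / n \<le> t} (s / n + 1 / n * y) * indicator {0..1} (s / n + 1 / n * y) \<partial>lborel)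
      = (\<integral>\<^sup>+y. F (v(N := (s + y) / n)) * indicator {..real n} (s + y) * indicator {0..} y \<partial>lborel)"
    proof (rule nn_integral_cong)
      fix y
      have "s / n + 1 / n * y = (s + y) / n" by (simp add: add_divide_distrib)
      moreover have "s / n \<le> (s + y) / n \<longleftrightarrow> 0 \<le> y" "(s + y) / n \<le> 1 \<longleftrightarrow> s + y \<le> n"
        using n by (auto simp: divide_le_cancel)
      moreover have "0 \<le> y \<Longrightarrow> 0 \<le> (s + y) / n" using s by simp
      ultimately show "F (v(N := s / n + 1 / n * y)) * indicator {t. s / n \<le> t} (s / n + 1 / n * y) * indicator {0..1} (s / n + 1 / n * y)
        = F (v(N := (s + y) / n)) * indicator {..real n} (s + y) * indicator {0..} y"
        by (auto simp: indicator_def)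
    qed
    finally have "G v = ennreal (1 / n) * (\<integral>\<^sup>+y. F (v(N := (s + y) / n)) * indicator {..real n} (s + y) * indicator {0..} y \<partial>lborel)"
      (is "_ = _ * ?I") by simp
    \<comment> \<open>The weight \<open>wt n N\<close> also contains the constraint s \<le> n. It
      may be inserted here, because for s > n there is no y \<ge> 0 with s + y \<le> n.\<close>
    moreover have "?I * indicator {..real n} s = ?I"
    proof (cases "s \<le> n")
      case False
      then have "?I = (\<integral>\<^sup>+(y::real). 0 \<partial>lborel)"
        by (intro nn_integral_cong) (auto simp: indicator_def)
      then show ?thesis by simp
    qed simp
    moreover have "a * b * (c * d) = a * (c * (b * d))" for a b c d :: ennreal
      by (simp add: ac_simps)
    ultimately have "G v * (ennreal (exp s) * indicator {..real n} s) = ennreal (1 / n) * (ennreal (exp s) * ?I)"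
      by (simp only:)
    moreover have wx: "wt n N x = ennreal (exp s) * indicator {..real n} s"
      by (simp add: wt_def s_def)
    ultimately show "G (trunc N (psum n x)) * wt n N x
       = ennreal (1 / n) * (\<integral>\<^sup>+z. F (trunc (Suc N) (psum n (comb_seq N x z))) * wt n (Suc N) (comb_seq N x z) \<partial>EX.S)"
      unfolding R v_def[symmetric] wx by simp
  qed
  also have "\<dots> = ennreal (1 / n) * (\<integral>\<^sup>+x. \<integral>\<^sup>+z. F (trunc (Suc N) (psum n (comb_seq N x z))) * wt n (Suc N) (comb_seq N x z) \<partial>EX.S \<partial>EX.S)"
    by (rule nn_integral_cmult) measurable
  also have "(\<integral>\<^sup>+x. \<integral>\<^sup>+z. F (trunc (Suc N) (psum n (comb_seq N x z))) * wt n (Suc N) (comb_seq N x z) \<partial>EX.S \<partial>EX.S)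
     = (\<integral>\<^sup>+x. F (trunc (Suc N) (psum n x)) * wt n (Suc N) x \<partial>EX.S)"
    by (rule EX.nn_integral_comb_seq[symmetric]) measurable
  finally show ?case by (simp add: ac_simps)
qed

section \<open>The spacings as a function of the sample\<close>

definition seq_spacing :: "nat \<Rightarrow> (nat \<Rightarrow> real) \<Rightarrow> nat \<Rightarrow> real" where
  "seq_spacing n u k = real n * spacing n (\<lambda>i (w::nat \<Rightarrow> real). w i) u k"

lemma ustat_0 [simp]: "ustat n V \<omega> 0 = 0"
  by (subst ustat.simps) simp

lemma ustat_cong:
  assumes "sort (map (\<lambda>i. V i \<omega>) [0..<n - 1]) = sort (map (\<lambda>i. V' i \<omega>') [0..<n - 1])"
  shows "ustat n V \<omega> k = ustat n V' \<omega>' k"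
proof (induction k rule: less_induct)
  case (less k)
  have 1: "ustat n V \<omega> k = (if n = 0 \<or> k = 0 then 0
      else if k < n then sort (map (\<lambda>i. V' i \<omega>') [0..<n - 1]) ! (k - 1) else 1 + ustat n V \<omega> (k - n))"
    by (subst ustat.simps) (simp only: assms)
  have 2: "ustat n V' \<omega>' k = (if n = 0 \<or> k = 0 then 0
      else if k < n then sort (map (\<lambda>i. V' i \<omega>') [0..<n - 1]) ! (k - 1) else 1 + ustat n V' \<omega>' (k - n))"
    by (rule ustat.simps)
  show ?case
    unfolding 1 2 using less[of "k - n"] by simp
qed

lemma seq_spacing_eq: "real n * spacing n V \<omega> k = seq_spacing n (\<lambda>i. V i \<omega>) k"
  unfolding seq_spacing_def spacing_def
  using ustat_cong[of V \<omega> n "\<lambda>i (w::nat \<Rightarrow> real). w i" "\<lambda>i. V i \<omega>"] by simp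

lemma seq_spacing_cong:
  "sort (map u [0..<n - 1]) = sort (map v [0..<n - 1]) \<Longrightarrow> seq_spacing n u = seq_spacing n v"
  unfolding seq_spacing_def[abs_def] spacing_def
  using ustat_cong[of "\<lambda>i (w::nat \<Rightarrow> real). w i" u n "\<lambda>i (w::nat \<Rightarrow> real). w i" v] by simp

lemma seq_spacing_trunc: "seq_spacing n (trunc (n - 1) u) = seq_spacing n u"
  by (rule seq_spacing_cong, rule arg_cong[where f = sort]) (auto simp: trunc_def)

lemma seq_spacing_dep: "dep (n - 1) (seq_spacing n)"
proof (rule depI)
  fix x y :: "nat \<Rightarrow> real" assume "\<And>i. i < n - 1 \<Longrightarrow> x i = y i"
  then have "map x [0..<n - 1] = map y [0..<n - 1]" by auto
  then show "seq_spacing n x = seq_spacing n y"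
    by (intro seq_spacing_cong arg_cong[where f = sort])
qed

lemma inc_sorted: "inc N u \<Longrightarrow> sorted (map u [0..<N])"
proof (induction N)
  case (Suc N)
  then have IH: "sorted (map u [0..<N])" and l: "prv N u \<le> u N" by (auto simp: inc_def)
  show ?case
  proof (cases N)
    case (Suc M)
    have "u j \<le> u N" if "j < N" for j
    proof -
      have "map u [0..<N] ! j \<le> map u [0..<N] ! M"
        using that Suc by (intro sorted_nth_mono[OF IH]) auto
      then show ?thesis using l that Suc by (simp add: prv_def del: upt_Suc)
    qed
    then show ?thesis using IH by (auto simp: sorted_append)
  qed simp
qed simp

lemma sorted_inc: "sorted (map u [0..<N]) \<Longrightarrow> \<forall>i. 0 \<le> u i \<Longrightarrow> inc N u"
  unfolding inc_def prv_def
proof (intro allI impI)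
  fix i assume *: "sorted (map u [0..<N])" "\<forall>i. 0 \<le> u i" "i < N"
  then show "(if i = 0 then 0 else u (i - 1)) \<le> u i"
    using sorted_nth_mono[of "map u [0..<N]" "i - 1" i] by (simp del: upt_Suc)
qed

text \<open>Sorting provides the permutation and distinctness of the values its uniqueness. Hence
  the indicators of the orderings add up to 1 almost surely.\<close>

lemma ex_inc_permutation:
  assumes "\<forall>i. 0 \<le> u i" "inj u"
  shows "\<exists>!p. p permutes {..<N} \<and> inc N (\<lambda>i. u (p i))"
proof -
  have "mset (sort (map u [0..<N])) = mset (map u [0..<N])" by simp
  then obtain p where p: "p permutes {..<length (map u [0..<N])}" "permute_list p (map u [0..<N]) = sort (map u [0..<N])"
    by (rule mset_eq_permutation)
  have perm: "permute_list q (map u [0..<N]) = map (\<lambda>i. u (q i)) [0..<N]" if "q permutes {..<N}" for q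
    using that permutes_in_image[OF that] by (auto simp: permute_list_def)
  have mset: "mset (map (\<lambda>i. u (q i)) [0..<N]) = mset (map u [0..<N])" if "q permutes {..<N}" for q
    using mset_permute_list[of q "map u [0..<N]"] perm[OF that] that by simp
  have pN: "p permutes {..<N}" using p by simp
  show ?thesis
  proof (rule ex1I[of _ p], intro conjI)
    show "p permutes {..<N}" by fact
    have "sorted (map (\<lambda>i. u (p i)) [0..<N])"
      using p(2) perm[OF pN] by (metis sorted_sort)
    then show "inc N (\<lambda>i. u (p i))"
      using assms by (intro sorted_inc) auto
  next
    fix q assume q: "q permutes {..<N} \<and> inc N (\<lambda>i. u (q i))"
    have "sort (map u [0..<N]) = map (\<lambda>i. u (q i)) [0..<N]"
      using q inc_sorted[of N "\<lambda>i. u (q i)"] mset[of q] by (intro properties_for_sort) auto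
    then have "map (\<lambda>i. u (q i)) [0..<N] = map (\<lambda>i. u (p i)) [0..<N]"
      using p(2) perm[OF pN] by simp
    then have eq: "q i = p i" if "i < N" for i
      using that assms(2) by (auto simp: inj_eq map_eq_conv)
    show "q = p"
    proof
      fix i show "q i = p i"
        using eq[of i] q pN by (cases "i < N") (auto simp: permutes_def)
    qed
  qed
qed

lemma seq_spacing_permute:
  assumes "p permutes {..<n - 1}"
  shows "seq_spacing n (\<lambda>i. u (p i)) = seq_spacing n u"
proof (rule seq_spacing_cong)
  have "permute_list p (map u [0..<n - 1]) = map (\<lambda>i. u (p i)) [0..<n - 1]"
    using permutes_in_image[OF assms] by (auto simp: permute_list_def)
  then have "mset (map (\<lambda>i. u (p i)) [0..<n - 1]) = mset (map u [0..<n - 1])"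
    using mset_permute_list[of p "map u [0..<n - 1]"] assms by simp
  then show "sort (map (\<lambda>i. u (p i)) [0..<n - 1]) = sort (map u [0..<n - 1])"
    by (intro properties_for_sort) simp_all
qed

text \<open>The list function \<open>sort\<close> is described by comparisons of coordinates: the
  event is a finite union over the permutations that can put the sample in order.\<close>

lemma measurable_order_statistic:
  assumes "k < N"
  shows "(\<lambda>u. sort (map u [0..<N]) ! k) \<in> borel_measurable seq_borel"
proof (rule borel_measurable_iff_le[THEN iffD2], rule allI)
  fix a :: real
  have "{u \<in> space seq_borel. sort (map u [0..<N]) ! k \<le> a}
     = (\<Union>p\<in>{p. p permutes {..<N}}. {u \<in> space seq_borel. (\<forall>i<N. \<forall>j<N. i \<le> j \<longrightarrow> u (p i) \<le> u (p j)) \<and> u (p k) \<le> a})"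
    (is "?A = ?B")
  proof (intro set_eqI iffI)
    fix u assume u: "u \<in> ?A"
    have "mset (sort (map u [0..<N])) = mset (map u [0..<N])" by simp
    then obtain p where p: "p permutes {..<length (map u [0..<N])}" "permute_list p (map u [0..<N]) = sort (map u [0..<N])"
      by (rule mset_eq_permutation)
    then have pN: "p permutes {..<N}" by simp
    have "permute_list p (map u [0..<N]) = map (\<lambda>i. u (p i)) [0..<N]"
      using permutes_in_image[OF pN] by (auto simp: permute_list_def)
    then have "sort (map u [0..<N]) = map (\<lambda>i. u (p i)) [0..<N]"
      by (simp only: p(2))
    then have eq: "sort (map u [0..<N]) ! i = u (p i)" if "i < N" for i
      using that by simp
    have "u (p i) \<le> u (p j)" if "i \<le> j" "j < N" for i j
      using sorted_nth_mono[of "sort (map u [0..<N])" i j] that by (simp add: eq)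
    with u pN eq[OF assms] show "u \<in> ?B" by auto
  next
    fix u assume "u \<in> ?B"
    then obtain p where p: "p permutes {..<N}" and le: "\<And>i j. i < N \<Longrightarrow> j < N \<Longrightarrow> i \<le> j \<Longrightarrow> u (p i) \<le> u (p j)"
      and a: "u (p k) \<le> a" by auto
    have "permute_list p (map u [0..<N]) = map (\<lambda>i. u (p i)) [0..<N]"
      using permutes_in_image[OF p] by (auto simp: permute_list_def)
    then have "mset (map (\<lambda>i. u (p i)) [0..<N]) = mset (map u [0..<N])"
      using mset_permute_list[of p "map u [0..<N]"] p by simp
    moreover have "sorted (map (\<lambda>i. u (p i)) [0..<N])"
      using le by (auto simp: sorted_iff_nth_mono)
    ultimately have "sort (map u [0..<N]) = map (\<lambda>i. u (p i)) [0..<N]"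
      by (intro properties_for_sort)
    with a assms show "u \<in> ?A" by simp
  qed
  moreover have "?B \<in> sets seq_borel"
  proof (intro sets.finite_UN finite_permutations finite_lessThan)
    fix p :: "nat \<Rightarrow> nat"
    have [measurable]: "Measurable.pred seq_borel (\<lambda>u. u (p i) \<le> u (p j))" for i j
      by (rule pred_le_real) simp_all
    have [measurable]: "Measurable.pred seq_borel (\<lambda>u. u (p k) \<le> a)"
      by (rule pred_le_real) simp_all
    show "{u \<in> space seq_borel. (\<forall>i<N. \<forall>j<N. i \<le> j \<longrightarrow> u (p i) \<le> u (p j)) \<and> u (p k) \<le> a} \<in> sets seq_borel"
      by measurable
  qed
  ultimately show "{u \<in> space seq_borel. sort (map u [0..<N]) ! k \<le> a} \<in> sets seq_borel" by simp
qed

lemma measurable_ustat: "(\<lambda>u. ustat n (\<lambda>i (w::nat \<Rightarrow> real). w i) u k) \<in> borel_measurable seq_borel"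
proof (induction k rule: less_induct)
  case (less k)
  consider "n = 0 \<or> k = 0" | "0 < k" "k < n" | "0 < k" "0 < n" "n \<le> k" by linarith
  then show ?case
  proof cases
    case 1
    then show ?thesis by (subst ustat.simps) simp
  next
    case 2
    then show ?thesis
      using measurable_order_statistic[of "k - 1" "n - 1"] by (subst ustat.simps) simp
  next
    case 3
    then show ?thesis
      using less[of "k - n"] by (subst ustat.simps) simp
  qed
qed

lemma measurable_seq_spacing [measurable]: "seq_spacing n \<in> seq_borel \<rightarrow>\<^sub>M seq_borel"
  unfolding seq_spacing_def[abs_def] spacing_def
  by (intro measurable_seqI borel_measurable_times borel_measurable_diff measurable_ustat) simp

text \<open>The point of the simplex of total mass \<open>n\<close> that is determined by its first
  \<open>n - 1\<close> coordinates, continued periodically. Spacings have this form, because the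
  last one in each period is determined by the others.\<close>

definition per :: "nat \<Rightarrow> (nat \<Rightarrow> real) \<Rightarrow> nat \<Rightarrow> real" where
  "per n x k = (if k mod n < n - 1 then x (k mod n) else real n - (\<Sum>i<n-1. x i))"

lemma measurable_per [measurable]: "per n \<in> seq_borel \<rightarrow>\<^sub>M seq_borel"
  unfolding per_def[abs_def] by (rule measurable_seqI) simp

lemma seq_spacing_periodic:
  assumes "n \<ge> 1"
  shows "seq_spacing n u (k + n) = seq_spacing n u k"
proof -
  have "ustat n V \<omega> (k + n) = 1 + ustat n V \<omega> k" for V :: "nat \<Rightarrow> (nat \<Rightarrow> real) \<Rightarrow> real" and \<omega> k
    using assms by (subst ustat.simps) simp
  from this[of _ _ k] this[of _ _ "Suc k"] show ?thesis
    by (simp add: seq_spacing_def spacing_def)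
qed

lemma seq_spacing_mod:
  assumes "n \<ge> 1"
  shows "seq_spacing n u k = seq_spacing n u (k mod n)"
proof (induction k rule: less_induct)
  case (less k)
  show ?case
  proof (cases "k < n")
    case False
    then have "seq_spacing n u k = seq_spacing n u (k - n)"
      using seq_spacing_periodic[OF assms, of u "k - n"] by simp
    also have "\<dots> = seq_spacing n u (k mod n)"
      using less[of "k - n"] False assms by (simp add: le_mod_geq)
    finally show ?thesis .
  qed simp
qed

lemma seq_spacing_psum:
  assumes n: "n \<ge> 1" and x: "\<forall>i. 0 \<le> x i"
  shows "seq_spacing n (psum n x) = per n x"
proof
  fix k
  define j where "j = k mod n"
  have j: "j < n" using n by (simp add: j_def)
  have "inc (n - 1) (psum n x)"
    unfolding inc_def
  proof (intro allI impI)
    fix i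
    show "prv i (psum n x) \<le> psum n x i"
    proof (cases i)
      case (Suc a)
      then show ?thesis using x n by (simp add: prv_def psum_def divide_right_mono)
    qed (use x in \<open>simp add: prv_def psum_def\<close>)
  qed
  then have sort: "sort (map (psum n x) [0..<n - 1]) = map (psum n x) [0..<n - 1]"
    by (intro sorted_sort_id inc_sorted)
  have u: "ustat n (\<lambda>i (w::nat \<Rightarrow> real). w i) (psum n x) l = (\<Sum>i<l. x i) / n" if "l < n" for l
  proof (cases "l = 0")
    case False
    then have "{..l - 1} = {..<l}" by auto
    with False that show ?thesis
      by (subst ustat.simps) (simp add: sort psum_def del: One_nat_def)
  qed simp
  have un: "ustat n (\<lambda>i (w::nat \<Rightarrow> real). w i) (psum n x) n = 1"
    using n by (subst ustat.simps) simp
  have "seq_spacing n (psum n x) j = per n x k"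
  proof (cases "j < n - 1")
    case True
    then have "seq_spacing n (psum n x) j = real n * ((\<Sum>i<Suc j. x i) / n - (\<Sum>i<j. x i) / n)"
      unfolding seq_spacing_def spacing_def using u[of "Suc j"] u[of j] by simp
    also have "\<dots> = x j" using n by (simp add: add_divide_distrib)
    finally show ?thesis using True by (simp add: per_def j_def)
  next
    case False
    then have jn: "j = n - 1" "Suc j = n" using j by auto
    then have "seq_spacing n (psum n x) j = real n * (1 - (\<Sum>i<n-1. x i) / n)"
      unfolding seq_spacing_def spacing_def using u[of j] un j by simp
    also have "\<dots> = real n - (\<Sum>i<n-1. x i)" using n by (simp add: right_diff_distrib)
    finally show ?thesis using False by (simp add: per_def j_def)
  qed
  then show "seq_spacing n (psum n x) k = per n x k"
    using seq_spacing_mod[OF n, of "psum n x" k] by (simp add: j_def)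
qed

text \<open>The scaled spacings are uniform on the simplex, and the constant is the reciprocal of
  its volume n^(n-1) / (n-1)! in the first n - 1 coordinates. The (n-1)! orderings of the sample
  contribute equally, since the spacings are symmetric in the sample and the sample is
  exchangeable.\<close>

lemma seq_spacing_distribution:
  assumes n: "n \<ge> 1" and [measurable]: "F \<in> borel_measurable seq_borel"
  shows "(\<integral>\<^sup>+u. F (seq_spacing n u) \<partial>UX.S)
    = ennreal (fact (n - 1) * (1 / n) ^ (n - 1)) * (\<integral>\<^sup>+x. F (per n x) * wt n (n - 1) x \<partial>EX.S)"
proof -
  define N where "N = n - 1"
  define Pm where "Pm = {p. p permutes {..<N}}"
  have fin: "finite Pm" unfolding Pm_def by (rule finite_permutations) simp
  have ind: "(\<Sum>p\<in>Pm. indicator {u. inc N u} (\<lambda>i. u (p i)) :: ennreal) = 1"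
    if h: "\<forall>i. 0 \<le> u i" "inj u" for u
  proof -
    from ex_inc_permutation[OF h, of N] obtain p
      where "p permutes {..<N} \<and> inc N (\<lambda>i. u (p i))"
        and "\<forall>q. q permutes {..<N} \<and> inc N (\<lambda>i. u (q i)) \<longrightarrow> q = p"
      by (rule ex1E)
    then have p: "p \<in> Pm" "inc N (\<lambda>i. u (p i))" "\<And>q. q \<in> Pm \<Longrightarrow> inc N (\<lambda>i. u (q i)) \<Longrightarrow> q = p"
      unfolding Pm_def by (blast, blast, blast)
    have "(\<Sum>q\<in>Pm. indicator {u. inc N u} (\<lambda>i. u (q i)) :: ennreal) = (\<Sum>q\<in>Pm. if q = p then 1 else 0)"
    proof (rule sum.cong)
      fix q assume q: "q \<in> Pm"
      show "indicator {u. inc N u} (\<lambda>i. u (q i)) = (if q = p then 1 else 0 :: ennreal)"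
      proof (cases "q = p")
        case False
        then have "\<not> inc N (\<lambda>i. u (q i))" using p(3)[OF q] by blast
        then show ?thesis using False by (simp add: indicator_def)
      qed (simp add: p(2))
    qed simp
    then show ?thesis using p(1) fin by simp
  qed
  define H where "H u = F (seq_spacing n u) * indicator {u. inc N u} u" for u
  have H [measurable]: "H \<in> borel_measurable seq_borel"
    unfolding H_def[abs_def] by measurable
  have pm: "(\<lambda>u. H (\<lambda>i. u (p i))) \<in> borel_measurable seq_borel" for p :: "nat \<Rightarrow> nat"
    by (rule measurable_compose[OF _ H], rule measurable_seqI) simp
  have "(\<integral>\<^sup>+u. F (seq_spacing n u) \<partial>UX.S) = (\<integral>\<^sup>+u. (\<Sum>p\<in>Pm. H (\<lambda>i. u (p i))) \<partial>UX.S)"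
  proof (rule nn_integral_cong_AE, use AE_seq_unim_nonneg AE_seq_unim_inj in eventually_elim)
    fix u :: "nat \<Rightarrow> real" assume u: "\<forall>i. 0 \<le> u i" "inj u"
    have "(\<Sum>p\<in>Pm. H (\<lambda>i. u (p i)))
       = (\<Sum>p\<in>Pm. F (seq_spacing n u) * indicator {u. inc N u} (\<lambda>i. u (p i)))"
    proof (rule sum.cong)
      fix p assume "p \<in> Pm"
      then have "seq_spacing n (\<lambda>i. u (p i)) = seq_spacing n u"
        unfolding Pm_def N_def by (intro seq_spacing_permute) simp
      then show "H (\<lambda>i. u (p i)) = F (seq_spacing n u) * indicator {u. inc N u} (\<lambda>i. u (p i))"
        by (simp only: H_def)
    qed simp
    also have "\<dots> = F (seq_spacing n u) * 1"
      unfolding sum_distrib_left[symmetric] ind[OF u] by simp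
    finally show "F (seq_spacing n u) = (\<Sum>p\<in>Pm. H (\<lambda>i. u (p i)))" by simp
  qed
  also have "\<dots> = (\<Sum>p\<in>Pm. \<integral>\<^sup>+u. H (\<lambda>i. u (p i)) \<partial>UX.S)"
    by (rule nn_integral_sum) (simp add: pm measurable_cong_sets[OF sets_seq_unim refl])
  also have "\<dots> = (\<Sum>p\<in>Pm. \<integral>\<^sup>+u. H u \<partial>UX.S)"
  proof (rule sum.cong)
    fix p assume "p \<in> Pm"
    then have "inj p" using permutes_inj by (auto simp: Pm_def)
    then show "(\<integral>\<^sup>+u. H (\<lambda>i. u (p i)) \<partial>UX.S) = (\<integral>\<^sup>+u. H u \<partial>UX.S)"
      by (intro UX.nn_integral_reindex) simp_all
  qed simp
  also have "\<dots> = ennreal (fact N) * (\<integral>\<^sup>+u. F (seq_spacing n u) * indicator {u. inc N u} u \<partial>UX.S)"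
    using card_permutations[of "{..<N}" N]
    by (simp add: Pm_def H_def ennreal_of_nat_eq_real_of_nat)
  also have "(\<integral>\<^sup>+u. F (seq_spacing n u) * indicator {u. inc N u} u \<partial>UX.S)
     = (\<integral>\<^sup>+u. F (seq_spacing n (trunc N u)) * indicator {u. inc N u} u \<partial>UX.S)"
    unfolding N_def seq_spacing_trunc ..
  also have "\<dots> = ennreal (1 / n) ^ N * (\<integral>\<^sup>+x. F (seq_spacing n (trunc N (psum n x))) * wt n N x \<partial>EX.S)"
    by (rule ordered_uniform_density[OF n]) measurable
  also have "(\<integral>\<^sup>+x. F (seq_spacing n (trunc N (psum n x))) * wt n N x \<partial>EX.S)
     = (\<integral>\<^sup>+x. F (per n x) * wt n N x \<partial>EX.S)"
    by (rule nn_integral_cong_AE, use AE_seq_expm_nonneg in eventually_elim)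
      (simp only: N_def seq_spacing_trunc seq_spacing_psum[OF n] simp_thms)
  finally show ?thesis
    by (simp add: N_def mult.assoc ennreal_mult ennreal_power)
qed

section \<open>Invariance of the spacings under rotation\<close>

lemma measurable_shf_borel [measurable]: "shf k \<in> seq_borel \<rightarrow>\<^sub>M seq_borel"
  unfolding shf_def[abs_def] by (rule measurable_seqI) simp

text \<open>A common form for a point of the cyclic simplex and its rotation, which isolates the two
  entries \<open>b\<close> and \<open>c\<close> that the rotation argument exchanges.\<close>

definition cyc :: "nat \<Rightarrow> (nat \<Rightarrow> real) \<Rightarrow> real \<Rightarrow> real \<Rightarrow> nat \<Rightarrow> real" where
  "cyc d r b c k = (if k mod (d + 2) < d then r (k mod (d + 2)) else if k mod (d + 2) = d then b else c)"

lemma measurable_cyc: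
  assumes "f \<in> borel_measurable M" "g \<in> borel_measurable M"
  shows "(\<lambda>t. cyc d r (f t) (g t)) \<in> M \<rightarrow>\<^sub>M seq_borel"
  unfolding cyc_def using assms by (intro measurable_seqI) simp

lemma shf_per_case_nat:
  "shf 1 (per (d + 2) (case_nat t r)) = cyc d r (real (d + 2) - (\<Sum>i<d. r i) - t) t"
proof
  fix k
  have s: "(\<Sum>i<Suc d. case_nat t r i) = t + (\<Sum>i<d. r i)"
    by (subst sum.lessThan_Suc_shift) simp
  have m: "Suc k mod (d + 2) = (if k mod (d + 2) = Suc d then 0 else Suc (k mod (d + 2)))"
    by (simp add: mod_Suc)
  have lt: "k mod (d + 2) < d + 2" by simp
  consider "k mod (d + 2) < d" | "k mod (d + 2) = d" | "k mod (d + 2) = Suc d" using lt by linarith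
  then show "shf 1 (per (d + 2) (case_nat t r)) k = cyc d r (real (d + 2) - (\<Sum>i<d. r i) - t) t k"
    unfolding shf_def per_def cyc_def using s m by cases auto
qed

lemma per_comb_seq:
  "per (d + 2) (comb_seq d r z) = cyc d r (z 0) (real (d + 2) - (\<Sum>i<d. r i) - z 0)"
proof
  fix k
  have s: "(\<Sum>i<Suc d. comb_seq d r z i) = (\<Sum>i<d. r i) + z 0"
    by (simp add: comb_seq_def)
  have lt: "k mod (d + 2) < d + 2" by simp
  consider "k mod (d + 2) < d" | "k mod (d + 2) = d" | "k mod (d + 2) = Suc d" using lt by linarith
  then show "per (d + 2) (comb_seq d r z) k = cyc d r (z 0) (real (d + 2) - (\<Sum>i<d. r i) - z 0) k"
    unfolding per_def cyc_def using s by cases (auto simp: comb_seq_def)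
qed

text \<open>After the rotation the period ends with the dependent coordinate a - t followed by the
  free coordinate t; without it the period ends with t followed by a - t. Given the other
  coordinates, t is governed by Lebesgue measure on the interval from 0 to a, and the reflection of
  t to a - t identifies the two integrals.\<close>

lemma per_rotate:
  assumes n: "n \<ge> 2" and [measurable]: "F \<in> borel_measurable seq_borel"
  shows "(\<integral>\<^sup>+x. F (shf 1 (per n x)) * wt n (n - 1) x \<partial>EX.S) = (\<integral>\<^sup>+x. F (per n x) * wt n (n - 1) x \<partial>EX.S)"
proof -
  obtain d where d: "n = d + 2" using n le_Suc_ex[of 2 n] by auto
  define a where "a r = real n - (\<Sum>i<d. r i)" for r :: "nat \<Rightarrow> real"
  have cm: "(\<lambda>t. F (cyc d r (a r - t) t)) \<in> borel_measurable borel"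
    "(\<lambda>t. F (cyc d r t (a r - t))) \<in> borel_measurable borel" for r
    by (rule measurable_compose[OF measurable_cyc assms(2)], simp_all)+
  have w1: "wt n (n - 1) (case_nat t r) = ennreal (exp (\<Sum>i<d. r i)) * (ennreal (exp t) * indicator {..a r} t)" for t r
  proof -
    have "(\<Sum>i<n-1. case_nat t r i) = t + (\<Sum>i<d. r i)"
      using sum.lessThan_Suc_shift[of "case_nat t r" d] by (simp add: d)
    then show ?thesis
      by (auto simp: wt_def a_def exp_add ennreal_mult indicator_def mult.commute)
  qed
  have w2: "wt n (n - 1) (comb_seq d r z) = ennreal (exp (\<Sum>i<d. r i)) * (ennreal (exp (z 0)) * indicator {..a r} (z 0))" for z r
  proof -
    have "(\<Sum>i<n-1. comb_seq d r z i) = (\<Sum>i<d. r i) + z 0"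
      by (simp add: d comb_seq_def)
    then show ?thesis
      by (auto simp: wt_def a_def exp_add ennreal_mult indicator_def mult.commute)
  qed
  have "(\<integral>\<^sup>+x. F (shf 1 (per n x)) * wt n (n - 1) x \<partial>EX.S)
     = (\<integral>\<^sup>+r. \<integral>\<^sup>+t. F (shf 1 (per n (case_nat t r))) * wt n (n - 1) (case_nat t r) \<partial>expm \<partial>EX.S)"
    by (rule EX.nn_integral_case_nat_swap) measurable
  also have "\<dots> = (\<integral>\<^sup>+r. \<integral>\<^sup>+z. F (per n (comb_seq d r z)) * wt n (n - 1) (comb_seq d r z) \<partial>EX.S \<partial>EX.S)"
  proof (rule nn_integral_cong)
    fix r :: "nat \<Rightarrow> real"
    define c where "c = ennreal (exp (\<Sum>i<d. r i))"
    have [measurable]: "(\<lambda>t. F (cyc d r (a r - t) t)) \<in> borel_measurable borel"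
      "(\<lambda>t. F (cyc d r t (a r - t))) \<in> borel_measurable borel" by (rule cm)+
    have "(\<integral>\<^sup>+t. F (shf 1 (per n (case_nat t r))) * wt n (n - 1) (case_nat t r) \<partial>expm)
      = (\<integral>\<^sup>+t. (c * (F (cyc d r (a r - t) t) * indicator {..a r} t)) * ennreal (exp t) \<partial>expm)"
    proof (rule nn_integral_cong)
      fix t
      have "shf 1 (per n (case_nat t r)) = cyc d r (a r - t) t"
        unfolding d a_def by (rule shf_per_case_nat)
      then show "F (shf 1 (per n (case_nat t r))) * wt n (n - 1) (case_nat t r)
        = (c * (F (cyc d r (a r - t) t) * indicator {..a r} t)) * ennreal (exp t)"
        by (simp only: w1 c_def ac_simps)
    qed
    also have "\<dots> = (\<integral>\<^sup>+t. (c * (F (cyc d r (a r - t) t) * indicator {..a r} t)) * indicator {0..} t \<partial>lborel)"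
      by (rule nn_integral_expm_exp) measurable
    also have "\<dots> = ennreal \<bar>-1\<bar> * (\<integral>\<^sup>+t. (c * (F (cyc d r (a r - (a r + (-1) * t)) (a r + (-1) * t)) * indicator {..a r} (a r + (-1) * t))) * indicator {0..} (a r + (-1) * t) \<partial>lborel)"
      by (intro nn_integral_real_affine borel_measurable_times_ennreal borel_measurable_indicator borel_measurable_const cm) simp_all
    also have "\<dots> = (\<integral>\<^sup>+t. (c * (F (cyc d r t (a r - t)) * indicator {..a r} t)) * indicator {0..} t \<partial>lborel)"
      by (simp, rule nn_integral_cong) (auto simp: indicator_def)
    also have "\<dots> = (\<integral>\<^sup>+t. (c * (F (cyc d r t (a r - t)) * indicator {..a r} t)) * ennreal (exp t) \<partial>expm)"
      by (rule nn_integral_expm_exp[symmetric]) measurable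
    also have "\<dots> = (\<integral>\<^sup>+z. (c * (F (cyc d r (z 0) (a r - z 0)) * indicator {..a r} (z 0))) * ennreal (exp (z 0)) \<partial>EX.S)"
      by (rule EX.nn_integral_component[symmetric]) measurable
    also have "\<dots> = (\<integral>\<^sup>+z. F (per n (comb_seq d r z)) * wt n (n - 1) (comb_seq d r z) \<partial>EX.S)"
    proof (rule nn_integral_cong)
      fix z :: "nat \<Rightarrow> real"
      have "per n (comb_seq d r z) = cyc d r (z 0) (a r - z 0)"
        unfolding d a_def by (rule per_comb_seq)
      then show "(c * (F (cyc d r (z 0) (a r - z 0)) * indicator {..a r} (z 0))) * ennreal (exp (z 0))
        = F (per n (comb_seq d r z)) * wt n (n - 1) (comb_seq d r z)"
        by (simp only: w2 c_def ac_simps)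
    qed
    finally show "(\<integral>\<^sup>+t. F (shf 1 (per n (case_nat t r))) * wt n (n - 1) (case_nat t r) \<partial>expm)
      = (\<integral>\<^sup>+z. F (per n (comb_seq d r z)) * wt n (n - 1) (comb_seq d r z) \<partial>EX.S)" .
  qed
  also have "\<dots> = (\<integral>\<^sup>+x. F (per n x) * wt n (n - 1) x \<partial>EX.S)"
    by (rule EX.nn_integral_comb_seq[symmetric]) measurable
  finally show ?thesis .
qed

section \<open>Volumes of simplices\<close>

lemma nn_integral_power_div_fact:
  assumes "(w::real) \<ge> 0"
  shows "(\<integral>\<^sup>+s. ennreal (s ^ j / fact j) * indicator {0..w} s \<partial>lborel) = ennreal (w ^ Suc j / fact (Suc j))"
proof -
  have "(\<integral>\<^sup>+s. ennreal (s ^ j / fact j) * indicator {0..w} s \<partial>lborel) = ennreal (w ^ Suc j / fact (Suc j) - 0 ^ Suc j / fact (Suc j))"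
  proof (rule nn_integral_FTC_Icc)
    fix x :: real
    show "DERIV (\<lambda>s. s ^ Suc j / fact (Suc j)) x :> x ^ j / fact j"
      using DERIV_cdivide[OF DERIV_pow[of "Suc j" x UNIV], of "fact (Suc j)"] by (simp del: of_nat_Suc)
  qed (use assms in auto)
  then show ?thesis by simp
qed

text \<open>The weight cancels the exponential density, so this is the volume of the simplex of
  nonnegative vectors with sum at most \<open>w\<close>. The indicator on the right is essential for
  negative \<open>w\<close>, where an even power would be positive.\<close>

lemma nn_integral_exp_sum:
  "(\<integral>\<^sup>+z. ennreal (exp (\<Sum>i<j. z i)) * indicator {..w} (\<Sum>i<j. z i) \<partial>EX.S)
    = ennreal (w ^ j / fact j) * indicator {0..} w"
proof (induction j arbitrary: w)
  case 0
  then show ?case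
    by (simp add: indicator_def EX.P.emeasure_space_1[simplified])
next
  case (Suc j)
  have s: "(\<Sum>i<Suc j. case_nat t r i) = t + (\<Sum>i<j. r i)" for t r
    by (subst sum.lessThan_Suc_shift) simp
  have meas: "(\<lambda>t. (ennreal ((w - t) ^ j / fact j) * indicator {0..} (w - t)) * indicator {0..} t) \<in> borel_measurable borel"
    by measurable
  have "(\<integral>\<^sup>+z. ennreal (exp (\<Sum>i<Suc j. z i)) * indicator {..w} (\<Sum>i<Suc j. z i) \<partial>EX.S)
     = (\<integral>\<^sup>+t. \<integral>\<^sup>+r. ennreal (exp (\<Sum>i<Suc j. case_nat t r i)) * indicator {..w} (\<Sum>i<Suc j. case_nat t r i) \<partial>EX.S \<partial>expm)"
    by (rule EX.nn_integral_case_nat) measurable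
  also have "\<dots> = (\<integral>\<^sup>+t. (ennreal ((w - t) ^ j / fact j) * indicator {0..} (w - t)) * ennreal (exp t) \<partial>expm)"
  proof (rule nn_integral_cong)
    fix t
    have "(\<integral>\<^sup>+r. ennreal (exp (\<Sum>i<Suc j. case_nat t r i)) * indicator {..w} (\<Sum>i<Suc j. case_nat t r i) \<partial>EX.S)
      = (\<integral>\<^sup>+r. (ennreal (exp (\<Sum>i<j. r i)) * indicator {..w - t} (\<Sum>i<j. r i)) * ennreal (exp t) \<partial>EX.S)"
      unfolding s by (intro nn_integral_cong) (auto simp: exp_add ennreal_mult indicator_def mult.commute)
    also have "\<dots> = (\<integral>\<^sup>+r. ennreal (exp (\<Sum>i<j. r i)) * indicator {..w - t} (\<Sum>i<j. r i) \<partial>EX.S) * ennreal (exp t)"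
      by (rule nn_integral_multc) measurable
    finally show "(\<integral>\<^sup>+r. ennreal (exp (\<Sum>i<Suc j. case_nat t r i)) * indicator {..w} (\<Sum>i<Suc j. case_nat t r i) \<partial>EX.S)
       = (ennreal ((w - t) ^ j / fact j) * indicator {0..} (w - t)) * ennreal (exp t)"
      by (simp add: Suc.IH)
  qed
  also have "\<dots> = (\<integral>\<^sup>+t. (ennreal ((w - t) ^ j / fact j) * indicator {0..} (w - t)) * indicator {0..} t \<partial>lborel)"
    by (rule nn_integral_expm_exp) measurable
  also have "\<dots> = ennreal \<bar>-1\<bar> * (\<integral>\<^sup>+s. (ennreal ((w - (w + (-1) * s)) ^ j / fact j) * indicator {0..} (w - (w + (-1) * s))) * indicator {0..} (w + (-1) * s) \<partial>lborel)"
    by (rule nn_integral_real_affine[OF meas]) simp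
  also have "\<dots> = (\<integral>\<^sup>+s. ennreal (s ^ j / fact j) * indicator {0..w} s \<partial>lborel)"
    by (simp, rule nn_integral_cong) (auto simp: indicator_def)
  also have "\<dots> = ennreal (w ^ Suc j / fact (Suc j)) * indicator {0..} w"
  proof (cases "w \<ge> 0")
    case True
    then show ?thesis using nn_integral_power_div_fact[of w j] by simp
  next
    case False
    then show ?thesis by simp
  qed
  finally show ?case .
qed

section \<open>The marginal density of the spacings\<close>

text \<open>
  Up to a factor that depends only on \<open>n\<close> and \<open>d\<close>, this is the density of the sum of \<open>n - d\<close>
  standard exponentials at \<open>n - (x\<^sub>0 + \<dots> + x\<^bsub>d-1\<^esub>)\<close>, normalised to have maximum 1.
\<close>
definition kern :: "nat \<Rightarrow> nat \<Rightarrow> (nat \<Rightarrow> real) \<Rightarrow> real" where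
  "kern n d x = (if real n < (\<Sum>i<d. x i) then 0 else
     ((real n - (\<Sum>i<d. x i)) / real (n - d - 1)) ^ (n - d - 1) * exp (real (n - d - 1) - (real n - (\<Sum>i<d. x i))))"

lemma measurable_kern [measurable]: "kern n d \<in> borel_measurable seq_borel"
  unfolding kern_def[abs_def] by measurable

lemma kern_nonneg: "0 \<le> kern n d x"
  by (simp add: kern_def)

lemma kern_le_1: "d + 2 \<le> n \<Longrightarrow> kern n d x \<le> 1"
proof -
  assume "d + 2 \<le> n"
  define c where "c = real (n - d - 1)"
  define w where "w = real n - (\<Sum>i<d. x i)"
  have c: "c > 0" using \<open>d + 2 \<le> n\<close> by (simp add: c_def)
  have "(w / c) ^ (n - d - 1) * exp (c - w) \<le> 1" if "w \<ge> 0"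
  proof -
    have "w / c \<le> exp (w / c - 1)" using exp_ge_add_one_self[of "w / c - 1"] by simp
    then have "(w / c) ^ (n - d - 1) \<le> exp (w / c - 1) ^ (n - d - 1)"
      using that c by (intro power_mono) auto
    also have "\<dots> = exp (c * (w / c - 1))"
      by (simp add: c_def exp_of_nat_mult[symmetric])
    also have "\<dots> = exp (w - c)" using c by (simp add: right_diff_distrib)
    finally have "(w / c) ^ (n - d - 1) * exp (c - w) \<le> exp (w - c) * exp (c - w)"
      by (intro mult_right_mono) auto
    then show ?thesis by (simp add: exp_add[symmetric])
  qed
  then show ?thesis unfolding kern_def c_def[symmetric] w_def[symmetric] by (auto simp: w_def)
qed

text \<open>Integrating out the remaining \<open>n - d - 1\<close> free coordinates produces the
  volume w^k / k! of a simplex, with k = n - d - 1 and w the mass that the first \<open>d\<close>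
  coordinates leave. The weight of these \<open>d\<close> coordinates supplies the exponential
  factor of \<open>kern\<close>.\<close>

lemma per_marginal:
  assumes d: "d + 2 \<le> n" and [measurable]: "F \<in> borel_measurable seq_borel" and dep: "dep d F"
  shows "(\<integral>\<^sup>+x. F (per n x) * wt n (n - 1) x \<partial>EX.S)
    = ennreal (exp (d + 1) * real (n - d - 1) ^ (n - d - 1) / fact (n - d - 1))
      * (\<integral>\<^sup>+x. F x * ennreal (kern n d x) \<partial>EX.S)"
proof -
  define k where "k = n - d - 1"
  have n: "n - 1 = d + k" "real n = real d + 1 + real k" "k \<ge> 1" using d by (auto simp: k_def)
  have F: "F (per n x) = F x" for x
  proof (rule depD[OF dep])
    fix i assume "i < d"
    then have "i < n" "i < n - 1" using d by linarith+
    then show "per n x i = x i" by (simp add: per_def)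
  qed
  have [measurable]: "(\<lambda>x. F (per n x) * wt n (n - 1) x) \<in> borel_measurable EX.S" by measurable
  have "(\<integral>\<^sup>+x. F (per n x) * wt n (n - 1) x \<partial>EX.S)
    = (\<integral>\<^sup>+x. \<integral>\<^sup>+z. F (per n (comb_seq d x z)) * wt n (n - 1) (comb_seq d x z) \<partial>EX.S \<partial>EX.S)"
    by (rule EX.nn_integral_comb_seq) measurable
  also have "\<dots> = (\<integral>\<^sup>+x. ennreal (exp (d + 1) * real k ^ k / fact k) * (F x * ennreal (kern n d x)) \<partial>EX.S)"
  proof (rule nn_integral_cong)
    fix x :: "nat \<Rightarrow> real"
    define s where "s = (\<Sum>i<d. x i)"
    define w where "w = real n - s"
    have sum: "(\<Sum>i<n-1. comb_seq d x z i) = s + (\<Sum>i<k. z i)" for z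
    proof -
      have "(\<Sum>i<d + k. comb_seq d x z i) = (\<Sum>i<d. comb_seq d x z i) + (\<Sum>i=d..<d+k. comb_seq d x z i)"
        using sum.atLeastLessThan_concat[of 0 d "d + k" "comb_seq d x z"] by (simp add: lessThan_atLeast0)
      also have "(\<Sum>i<d. comb_seq d x z i) = s" by (simp add: s_def comb_seq_def)
      also have "(\<Sum>i=d..<d+k. comb_seq d x z i) = (\<Sum>i<k. z i)"
        by (rule sum.reindex_bij_witness[of _ "\<lambda>i. d + i" "\<lambda>i. i - d"]) (auto simp: comb_seq_def)
      finally show ?thesis by (simp only: n)
    qed
    have Fz: "F (per n (comb_seq d x z)) = F x" for z
      unfolding F by (rule dep_comb_seq[OF dep])
    have "(\<integral>\<^sup>+z. F (per n (comb_seq d x z)) * wt n (n - 1) (comb_seq d x z) \<partial>EX.S)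
      = (\<integral>\<^sup>+z. (F x * ennreal (exp s)) * (ennreal (exp (\<Sum>i<k. z i)) * indicator {..w} (\<Sum>i<k. z i)) \<partial>EX.S)"
      unfolding Fz wt_def sum
      by (intro nn_integral_cong) (auto simp: exp_add ennreal_mult indicator_def w_def mult.assoc)
    also have "\<dots> = (F x * ennreal (exp s)) * (\<integral>\<^sup>+z. ennreal (exp (\<Sum>i<k. z i)) * indicator {..w} (\<Sum>i<k. z i) \<partial>EX.S)"
      by (rule nn_integral_cmult) measurable
    also have "\<dots> = F x * (ennreal (exp s) * (ennreal (w ^ k / fact k) * indicator {0..} w))"
      by (simp only: nn_integral_exp_sum mult.assoc)
    also have "ennreal (exp s) * (ennreal (w ^ k / fact k) * indicator {0..} w)
      = ennreal (exp (d + 1) * real k ^ k / fact k) * ennreal (kern n d x)"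
    proof (cases "w \<ge> 0")
      case True
      \<comment> \<open>Here w = n - s and n = d + 1 + k, so the exponents add up to s; this is
        where the constant exp (d + 1) comes from.\<close>
      have e: "exp (real d + 1) * exp (real k - w) = exp s"
        unfolding exp_add[symmetric] by (simp add: w_def n)
      have kern: "kern n d x = (w / real k) ^ k * exp (real k - w)"
        using True unfolding kern_def s_def[symmetric] w_def[symmetric] k_def[symmetric] by (auto simp: w_def)
      have "exp (real d + 1) * real k ^ k / fact k * kern n d x = (exp (real d + 1) * exp (real k - w)) * (w ^ k / fact k)"
        using n(3) by (simp add: kern power_divide)
      then have "exp (real d + 1) * real k ^ k / fact k * kern n d x = exp s * (w ^ k / fact k)"
        unfolding e .
      then show ?thesis
        using True kern_nonneg[of n d x] by (simp add: ennreal_mult[symmetric] add.commute)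
    next
      case False
      then have "kern n d x = 0" by (simp add: kern_def w_def s_def)
      with False show ?thesis by simp
    qed
    finally show "(\<integral>\<^sup>+z. F (per n (comb_seq d x z)) * wt n (n - 1) (comb_seq d x z) \<partial>EX.S)
      = ennreal (exp (d + 1) * real k ^ k / fact k) * (F x * ennreal (kern n d x))"
      by (simp only: ac_simps)
  qed
  also have "\<dots> = ennreal (exp (d + 1) * real k ^ k / fact k) * (\<integral>\<^sup>+x. F x * ennreal (kern n d x) \<partial>EX.S)"
    by (rule nn_integral_cmult) measurable
  finally show ?thesis by (simp only: k_def of_nat_add of_nat_1)
qed

section \<open>The law of the scaled spacings compared with that of the exponentials\<close>

definition spacing_law :: "nat \<Rightarrow> (nat \<Rightarrow> real) measure" where
  "spacing_law n = distr UX.S seq_borel (seq_spacing n)"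

lemma sets_spacing_law [measurable_cong, simp]: "sets (spacing_law n) = sets seq_borel"
  by (simp add: spacing_law_def)

lemma space_spacing_law [simp]: "space (spacing_law n) = UNIV"
  by (simp add: spacing_law_def)

lemma prob_space_spacing_law: "prob_space (spacing_law n)"
  unfolding spacing_law_def by (rule UX.P.prob_space_distr) measurable

lemma nn_integral_spacing_law:
  assumes n: "n \<ge> 1" and [measurable]: "F \<in> borel_measurable seq_borel"
  shows "(\<integral>\<^sup>+y. F y \<partial>spacing_law n)
    = ennreal (fact (n - 1) * (1 / n) ^ (n - 1)) * (\<integral>\<^sup>+x. F (per n x) * wt n (n - 1) x \<partial>EX.S)"
proof -
  have m: "seq_spacing n \<in> UX.S \<rightarrow>\<^sub>M seq_borel" by measurable
  have F: "F \<in> borel_measurable (distr UX.S seq_borel (seq_spacing n))" using assms(2) by simp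
  show ?thesis
    unfolding spacing_law_def
    by (simp only: nn_integral_distr[OF m F] seq_spacing_distribution[OF assms])
qed

lemma nn_integral_spacing_law_shf:
  assumes n: "n \<ge> 2" and [measurable]: "F \<in> borel_measurable seq_borel"
  shows "(\<integral>\<^sup>+y. F (shf a y) \<partial>spacing_law n) = (\<integral>\<^sup>+y. F y \<partial>spacing_law n)"
proof (induction a)
  case (Suc a)
  define G where "G y = F (shf a y)" for y
  have G [measurable]: "G \<in> borel_measurable seq_borel" unfolding G_def[abs_def] by measurable
  have "(\<integral>\<^sup>+y. F (shf (Suc a) y) \<partial>spacing_law n) = (\<integral>\<^sup>+y. G (shf 1 y) \<partial>spacing_law n)"
    by (simp add: G_def)
  also have "\<dots> = (\<integral>\<^sup>+y. G y \<partial>spacing_law n)"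
    using n by (subst (1 2) nn_integral_spacing_law) (simp_all add: per_rotate[OF n G, simplified])
  finally show ?case using Suc by (simp add: G_def)
qed simp

lemma spacing_law_marginal:
  assumes d: "d + 2 \<le> n"
  shows "\<exists>C>0. \<forall>F. F \<in> borel_measurable seq_borel \<longrightarrow> dep d F \<longrightarrow>
      (\<integral>\<^sup>+y. F y \<partial>spacing_law n) = ennreal C * (\<integral>\<^sup>+x. F x * ennreal (kern n d x) \<partial>EX.S)"
proof -
  define K where "K = (fact (n - 1) * (1 / real n) ^ (n - 1) :: real)"
  define L where "L = (exp (real d + 1) * real (n - d - 1) ^ (n - d - 1) / fact (n - d - 1) :: real)"
  have pos: "K > 0" "L > 0" unfolding K_def L_def using d by (auto intro!: mult_pos_pos divide_pos_pos)
  have "(\<integral>\<^sup>+y. F y \<partial>spacing_law n) = ennreal (K * L) * (\<integral>\<^sup>+x. F x * ennreal (kern n d x) \<partial>EX.S)"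
    if F: "F \<in> borel_measurable seq_borel" "dep d F" for F
  proof -
    have "(\<integral>\<^sup>+y. F y \<partial>spacing_law n) = ennreal K * (\<integral>\<^sup>+x. F (per n x) * wt n (n - 1) x \<partial>EX.S)"
      unfolding K_def using d by (intro nn_integral_spacing_law F(1)) simp
    also have "(\<integral>\<^sup>+x. F (per n x) * wt n (n - 1) x \<partial>EX.S) = ennreal L * (\<integral>\<^sup>+x. F x * ennreal (kern n d x) \<partial>EX.S)"
      using per_marginal[OF d F] by (simp only: L_def of_nat_add of_nat_1)
    finally show ?thesis using pos by (simp add: ennreal_mult mult.assoc)
  qed
  then show ?thesis using mult_pos_pos[OF pos] by blast
qed

lemma integrable_kern: "d + 2 \<le> n \<Longrightarrow> integrable EX.S (kern n d)"
  by (rule EX.P.integrable_const_bound[where B = 1]) (auto simp: kern_nonneg kern_le_1)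

text \<open>The constant function 1 identifies the normalising factor as the reciprocal of the mean
  of \<open>kern\<close>. Its asymptotics will follow from the Gaussian limit of \<open>kern\<close>
  instead of from those of the factorials.\<close>

lemma spacing_law_kern:
  assumes d: "d + 2 \<le> n"
  shows "(\<integral>x. kern n d x \<partial>EX.S) > 0"
    and "F \<in> borel_measurable seq_borel \<Longrightarrow> dep d F \<Longrightarrow>
      (\<integral>\<^sup>+y. F y \<partial>spacing_law n) = ennreal (1 / (\<integral>x. kern n d x \<partial>EX.S)) * (\<integral>\<^sup>+x. F x * ennreal (kern n d x) \<partial>EX.S)"
proof -
  obtain C where C: "C > 0"
    "\<And>F. F \<in> borel_measurable seq_borel \<Longrightarrow> dep d F \<Longrightarrow>
      (\<integral>\<^sup>+y. F y \<partial>spacing_law n) = ennreal C * (\<integral>\<^sup>+x. F x * ennreal (kern n d x) \<partial>EX.S)"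
    using spacing_law_marginal[OF d] by blast
  interpret Sp: prob_space "spacing_law n" by (rule prob_space_spacing_law)
  have "1 = ennreal C * (\<integral>\<^sup>+x. ennreal (kern n d x) \<partial>EX.S)"
    using C(2)[of "\<lambda>_. 1"] Sp.emeasure_space_1 by (simp add: dep_def)
  also have "(\<integral>\<^sup>+x. ennreal (kern n d x) \<partial>EX.S) = ennreal (\<integral>x. kern n d x \<partial>EX.S)"
    by (rule nn_integral_eq_integral) (auto simp: integrable_kern[OF d] kern_nonneg)
  finally have "ennreal (C * (\<integral>x. kern n d x \<partial>EX.S)) = ennreal 1"
    using C(1) by (simp add: ennreal_mult kern_nonneg)
  then have 1: "C * (\<integral>x. kern n d x \<partial>EX.S) = 1"
    using C(1) by (subst (asm) ennreal_inj) (auto simp: kern_nonneg)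
  then show 2: "(\<integral>x. kern n d x \<partial>EX.S) > 0"
    using C(1) by (metis zero_less_mult_pos zero_less_one)
  have "C = 1 / (\<integral>x. kern n d x \<partial>EX.S)" using 1 2 by (simp add: field_simps)
  then show "F \<in> borel_measurable seq_borel \<Longrightarrow> dep d F \<Longrightarrow>
      (\<integral>\<^sup>+y. F y \<partial>spacing_law n) = ennreal (1 / (\<integral>x. kern n d x \<partial>EX.S)) * (\<integral>\<^sup>+x. F x * ennreal (kern n d x) \<partial>EX.S)"
    using C(2) by simp
qed

lemma dep_trunc: "dep d F \<Longrightarrow> F (trunc d x) = F x"
  by (erule depD) (simp add: trunc_def)

lemma integral_spacing_law:
  fixes F :: "_ \<Rightarrow> complex"
  assumes d: "d + 2 \<le> n" and [measurable]: "F \<in> borel_measurable seq_borel" and dep: "dep d F"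
    and bd: "\<And>x. cmod (F x) \<le> 1"
  shows "(\<integral>y. F y \<partial>spacing_law n)
    = (\<integral>x. kern n d x *\<^sub>R F x \<partial>EX.S) / complex_of_real (\<integral>x. kern n d x \<partial>EX.S)"
proof -
  define c where "c = 1 / (\<integral>x. kern n d x \<partial>EX.S)"
  have c: "c > 0" using spacing_law_kern(1)[OF d] by (simp add: c_def)
  define D where "D = density EX.S (\<lambda>x. ennreal (c * kern n d x))"
  have sD [measurable_cong]: "sets D = sets seq_borel" by (simp add: D_def)
  \<comment> \<open>The density formula holds for nonnegative functions of the first
    \<open>d\<close> coordinates. Comparing the image measures under \<open>trunc d\<close> carries
    it over to complex integrands.\<close>
  have eq: "distr (spacing_law n) seq_borel (trunc d) = distr D seq_borel (trunc d)"
  proof (rule measure_eqI)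
    fix A assume "A \<in> sets (distr (spacing_law n) seq_borel (trunc d))"
    then have [measurable]: "A \<in> sets seq_borel" by simp
    define G where "G y = (indicator A (trunc d y) :: ennreal)" for y
    have G [measurable]: "G \<in> borel_measurable seq_borel" unfolding G_def[abs_def] by measurable
    have Gd: "dep d G"
    proof (rule depI)
      fix x y :: "nat \<Rightarrow> real" assume "\<And>i. i < d \<Longrightarrow> x i = y i"
      then have "trunc d x = trunc d y" by (auto simp: trunc_def)
      then show "G x = G y" by (simp add: G_def)
    qed
    have "emeasure (distr (spacing_law n) seq_borel (trunc d)) A = (\<integral>\<^sup>+y. G y \<partial>spacing_law n)"
      unfolding G_def by (subst nn_integral_indicator[symmetric], simp, subst nn_integral_distr) auto
    also have "\<dots> = ennreal c * (\<integral>\<^sup>+x. G x * ennreal (kern n d x) \<partial>EX.S)"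
      unfolding c_def by (rule spacing_law_kern(2)[OF d G Gd])
    also have "\<dots> = (\<integral>\<^sup>+x. ennreal c * (G x * ennreal (kern n d x)) \<partial>EX.S)"
      by (rule nn_integral_cmult[symmetric]) measurable
    also have "\<dots> = (\<integral>\<^sup>+x. ennreal (c * kern n d x) * G x \<partial>EX.S)"
      using c by (intro nn_integral_cong) (simp add: ennreal_mult kern_nonneg ac_simps)
    also have "\<dots> = (\<integral>\<^sup>+x. G x \<partial>D)"
      unfolding D_def by (rule nn_integral_density[symmetric]) measurable
    also have "\<dots> = emeasure (distr D seq_borel (trunc d)) A"
      unfolding G_def by (subst nn_integral_indicator[symmetric], simp, subst nn_integral_distr) auto
    finally show "emeasure (distr (spacing_law n) seq_borel (trunc d)) A = emeasure (distr D seq_borel (trunc d)) A" .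
  qed simp
  have "(\<integral>y. F y \<partial>spacing_law n) = (\<integral>y. F y \<partial>distr (spacing_law n) seq_borel (trunc d))"
    by (subst integral_distr) (auto simp: dep_trunc[OF dep])
  also have "\<dots> = (\<integral>x. F x \<partial>D)"
    unfolding eq by (subst integral_distr) (auto simp: dep_trunc[OF dep])
  also have "\<dots> = (\<integral>x. (c * kern n d x) *\<^sub>R F x \<partial>EX.S)"
    unfolding D_def using c by (intro integral_density) (auto simp: kern_nonneg)
  also have "\<dots> = c *\<^sub>R (\<integral>x. kern n d x *\<^sub>R F x \<partial>EX.S)"
    by (simp only: scaleR_scaleR[symmetric] integral_scaleR_right)
  finally show ?thesis by (simp add: c_def scaleR_conv_of_real)
qed

text \<open>By rotation invariance \<open>f (shf a y)\<close> and \<open>f y\<close> have the same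
  law, so the window of \<open>d\<close> coordinates may lie anywhere and may even cross the end of
  the period. For the first \<open>d\<close> coordinates the density with respect to the
  exponentials is at most the reciprocal mean of \<open>kern\<close>.\<close>

lemma spacing_law_second_moment:
  fixes f :: "_ \<Rightarrow> real"
  assumes d: "d + 2 \<le> n" and [measurable]: "f \<in> borel_measurable seq_borel" and dep: "dep d f"
    and i: "integrable EX.S (\<lambda>x. (f x)\<^sup>2)"
  shows "integrable (spacing_law n) (\<lambda>y. (f (shf a y))\<^sup>2)"
    and "(\<integral>y. (f (shf a y))\<^sup>2 \<partial>spacing_law n) \<le> (\<integral>x. (f x)\<^sup>2 \<partial>EX.S) / (\<integral>x. kern n d x \<partial>EX.S)"
proof -
  define c where "c = 1 / (\<integral>x. kern n d x \<partial>EX.S)"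
  have c: "c > 0" using spacing_law_kern(1)[OF d] by (simp add: c_def)
  have "(\<integral>\<^sup>+y. ennreal ((f (shf a y))\<^sup>2) \<partial>spacing_law n) = (\<integral>\<^sup>+y. ennreal ((f y)\<^sup>2) \<partial>spacing_law n)"
    by (rule nn_integral_spacing_law_shf[where F = "\<lambda>y. ennreal ((f y)\<^sup>2)"]) (use d in auto)
  also have "\<dots> = ennreal c * (\<integral>\<^sup>+x. ennreal ((f x)\<^sup>2) * ennreal (kern n d x) \<partial>EX.S)"
    unfolding c_def by (rule spacing_law_kern(2)[OF d]) (auto intro: dep_comp[OF dep])
  also have "\<dots> \<le> ennreal c * (\<integral>\<^sup>+x. ennreal ((f x)\<^sup>2) \<partial>EX.S)"
  proof (intro mult_left_mono nn_integral_mono)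
    fix x
    have "(f x)\<^sup>2 * kern n d x \<le> (f x)\<^sup>2" using kern_le_1[OF d, of x] by (simp add: mult_left_le)
    then show "ennreal ((f x)\<^sup>2) * ennreal (kern n d x) \<le> ennreal ((f x)\<^sup>2)"
      by (subst ennreal_mult[symmetric]) (auto simp: kern_nonneg intro: ennreal_leI)
  qed simp
  also have "\<dots> = ennreal (c * (\<integral>x. (f x)\<^sup>2 \<partial>EX.S))"
    using c by (subst nn_integral_eq_integral[OF i]) (auto simp: ennreal_mult)
  finally have le: "(\<integral>\<^sup>+y. ennreal ((f (shf a y))\<^sup>2) \<partial>spacing_law n) \<le> ennreal (c * (\<integral>x. (f x)\<^sup>2 \<partial>EX.S))" .
  show 1: "integrable (spacing_law n) (\<lambda>y. (f (shf a y))\<^sup>2)"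
  proof (rule integrableI_bounded)
    show "(\<integral>\<^sup>+y. ennreal (norm ((f (shf a y))\<^sup>2)) \<partial>spacing_law n) < \<infinity>"
      using le by (simp add: le_less_trans)
  qed measurable
  have "ennreal (\<integral>y. (f (shf a y))\<^sup>2 \<partial>spacing_law n) \<le> ennreal (c * (\<integral>x. (f x)\<^sup>2 \<partial>EX.S))"
    using le nn_integral_eq_integral[OF 1] by simp
  then show "(\<integral>y. (f (shf a y))\<^sup>2 \<partial>spacing_law n) \<le> (\<integral>x. (f x)\<^sup>2 \<partial>EX.S) / (\<integral>x. kern n d x \<partial>EX.S)"
    using c by (subst (asm) ennreal_le_iff) (auto simp: c_def)
qed

section \<open>From the given random variables to laws on sequence space\<close>

lemma distr_indep_vars:
  assumes "prob_space P" and indep: "prob_space.indep_vars P (\<lambda>_. borel) X I" and "I \<noteq> {}"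
    and D: "sets D = sets borel" and X: "\<And>i. i \<in> I \<Longrightarrow> distr P borel (X i) = D"
  shows "distr P (\<Pi>\<^sub>M i\<in>I. D) (\<lambda>\<omega>. \<lambda>i\<in>I. X i \<omega>) = (\<Pi>\<^sub>M i\<in>I. D)"
proof -
  interpret prob_space P by fact
  have rv: "random_variable borel (X i)" if "i \<in> I" for i
    using indep that by (auto simp: indep_vars_def)
  have "distr P (\<Pi>\<^sub>M i\<in>I. borel) (\<lambda>\<omega>. \<lambda>i\<in>I. X i \<omega>) = (\<Pi>\<^sub>M i\<in>I. distr P borel (X i))"
    using indep_vars_iff_distr_eq_PiM'[OF \<open>I \<noteq> {}\<close>, where M' = "\<lambda>_. borel" and X = X] rv indep by simp
  also have "(\<Pi>\<^sub>M i\<in>I. distr P borel (X i)) = (\<Pi>\<^sub>M i\<in>I. D)"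
    by (rule PiM_cong) (auto simp: X)
  finally have "distr P (\<Pi>\<^sub>M i\<in>I. borel) (\<lambda>\<omega>. \<lambda>i\<in>I. X i \<omega>) = (\<Pi>\<^sub>M i\<in>I. D)" .
  moreover have "distr P (\<Pi>\<^sub>M i\<in>I. borel) (\<lambda>\<omega>. \<lambda>i\<in>I. X i \<omega>) = distr P (\<Pi>\<^sub>M i\<in>I. D) (\<lambda>\<omega>. \<lambda>i\<in>I. X i \<omega>)"
    by (rule distr_cong) (auto intro!: sets_PiM_cong simp: D)
  ultimately show ?thesis by simp
qed

lemma distr_exponential_sequence:
  assumes "prob_space P" and indep: "prob_space.indep_vars P (\<lambda>_. borel) X UNIV"
    and X: "\<And>i. distributed P lborel (X i) (exponential_density 1)"
  shows "(\<lambda>\<omega> i. X i \<omega>) \<in> P \<rightarrow>\<^sub>M seq_borel" and "distr P seq_borel (\<lambda>\<omega> i. X i \<omega>) = EX.S"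
proof -
  have rv: "X i \<in> borel_measurable P" for i
    using distributed_measurable[OF X[of i]] by simp
  then show "(\<lambda>\<omega> i. X i \<omega>) \<in> P \<rightarrow>\<^sub>M seq_borel" by (rule measurable_seqI)
  have "distr P borel (X i) = expm" for i
  proof -
    have "distr P borel (X i) = distr P lborel (X i)" by (rule distr_cong) auto
    then show ?thesis using distributed_distr_eq_density[OF X[of i]] by (simp add: expm_def)
  qed
  then have "distr P EX.S (\<lambda>\<omega>. \<lambda>i\<in>UNIV. X i \<omega>) = EX.S"
    using distr_indep_vars[OF assms(1,2), of expm] by simp
  moreover have "distr P EX.S (\<lambda>\<omega>. \<lambda>i\<in>UNIV. X i \<omega>) = distr P seq_borel (\<lambda>\<omega> i. X i \<omega>)"
    by (rule distr_cong) auto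
  ultimately show "distr P seq_borel (\<lambda>\<omega> i. X i \<omega>) = EX.S" by simp
qed

lemma distr_spacings:
  assumes "prob_space P" and indep: "prob_space.indep_vars P (\<lambda>_. borel) V {..<n - 1}"
    and V: "\<And>i. i < n - 1 \<Longrightarrow> distr P lborel (V i) = uniform_measure lborel {0..1}"
    and n: "n \<ge> 2"
  shows "(\<lambda>\<omega> k. real n * spacing n V \<omega> k) \<in> P \<rightarrow>\<^sub>M seq_borel"
    and "distr P seq_borel (\<lambda>\<omega> k. real n * spacing n V \<omega> k) = spacing_law n"
proof -
  interpret prob_space P by fact
  define I where "I = {..<n - 1}"
  have I: "I \<noteq> {}" "finite I" using n by (auto simp: I_def lessThan_empty_iff)
  \<comment> \<open>Only the \<open>n - 1\<close> sample variables are given. The other coordinates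
    are filled with 0, which the spacings do not see.\<close>
  define ex0 where "ex0 w = (\<lambda>i. if i \<in> I then w i else 0 :: real)" for w
  have ex0 [measurable]: "ex0 \<in> (\<Pi>\<^sub>M i\<in>I. borel) \<rightarrow>\<^sub>M seq_borel"
  proof (rule measurable_seqI)
    fix i show "(\<lambda>w. ex0 w i) \<in> borel_measurable (\<Pi>\<^sub>M i\<in>I. borel)"
      by (cases "i \<in> I") (simp_all add: ex0_def)
  qed
  have rv: "random_variable borel (V i)" if "i \<in> I" for i
    using indep that by (auto simp: indep_vars_def I_def)
  have sI [measurable_cong]: "sets (\<Pi>\<^sub>M i\<in>I. unim) = sets (\<Pi>\<^sub>M i\<in>I. borel)"
    by (rule sets_PiM_cong) auto
  have mV [measurable]: "(\<lambda>\<omega>. \<lambda>i\<in>I. V i \<omega>) \<in> P \<rightarrow>\<^sub>M (\<Pi>\<^sub>M i\<in>I. borel)"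
    by (rule measurable_restrict) (rule rv)
  have V_eq: "(\<lambda>\<omega> k. real n * spacing n V \<omega> k) = (\<lambda>\<omega>. seq_spacing n (ex0 (\<lambda>i\<in>I. V i \<omega>)))"
  proof
    fix \<omega>
    have "(\<lambda>k. real n * spacing n V \<omega> k) = seq_spacing n (\<lambda>i. V i \<omega>)"
      by (rule ext) (rule seq_spacing_eq)
    also have "\<dots> = seq_spacing n (ex0 (\<lambda>i\<in>I. V i \<omega>))"
      by (rule depD[OF seq_spacing_dep]) (simp add: ex0_def I_def)
    finally show "(\<lambda>k. real n * spacing n V \<omega> k) = seq_spacing n (ex0 (\<lambda>i\<in>I. V i \<omega>))" .
  qed
  show "(\<lambda>\<omega> k. real n * spacing n V \<omega> k) \<in> P \<rightarrow>\<^sub>M seq_borel"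
    unfolding V_eq by measurable
  have "distr P borel (V i) = unim" if "i \<in> I" for i
  proof -
    have "distr P borel (V i) = distr P lborel (V i)" by (rule distr_cong) auto
    then show ?thesis using V that by (simp add: unim_def I_def)
  qed
  then have 1: "distr P (\<Pi>\<^sub>M i\<in>I. unim) (\<lambda>\<omega>. \<lambda>i\<in>I. V i \<omega>) = (\<Pi>\<^sub>M i\<in>I. unim)"
    by (intro distr_indep_vars assms(1) indep[folded I_def] I) auto
  have 2: "distr UX.S (\<Pi>\<^sub>M i\<in>I. unim) (\<lambda>u. restrict u I) = (\<Pi>\<^sub>M i\<in>I. unim)"
    by (rule UX.distr_PiM_restrict_finite) (use I in auto)
  have mr [measurable]: "(\<lambda>u. restrict u I) \<in> seq_borel \<rightarrow>\<^sub>M (\<Pi>\<^sub>M i\<in>I. borel)"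
    by (rule measurable_restrict) simp
  have mE: "(\<lambda>w. seq_spacing n (ex0 w)) \<in> (\<Pi>\<^sub>M i\<in>I. unim) \<rightarrow>\<^sub>M seq_borel"
    using measurable_compose[OF ex0 measurable_seq_spacing] by (simp only: measurable_cong_sets[OF sI refl])
  have mV': "(\<lambda>\<omega>. \<lambda>i\<in>I. V i \<omega>) \<in> P \<rightarrow>\<^sub>M (\<Pi>\<^sub>M i\<in>I. unim)"
    using mV by (simp only: measurable_cong_sets[OF refl sI])
  have mr': "(\<lambda>u. restrict u I) \<in> UX.S \<rightarrow>\<^sub>M (\<Pi>\<^sub>M i\<in>I. unim)"
    using mr by (simp only: measurable_cong_sets[OF sets_seq_unim sI])
  have eq: "(\<lambda>u. seq_spacing n (ex0 (restrict u I))) = seq_spacing n"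
  proof
    fix u show "seq_spacing n (ex0 (restrict u I)) = seq_spacing n u"
      by (rule depD[OF seq_spacing_dep]) (simp add: ex0_def I_def)
  qed
  have "distr P seq_borel (\<lambda>\<omega>. seq_spacing n (ex0 (\<lambda>i\<in>I. V i \<omega>)))
    = distr (distr P (\<Pi>\<^sub>M i\<in>I. unim) (\<lambda>\<omega>. \<lambda>i\<in>I. V i \<omega>)) seq_borel (\<lambda>w. seq_spacing n (ex0 w))"
    by (simp only: distr_distr[OF mE mV'] comp_def)
  also have "\<dots> = distr (distr UX.S (\<Pi>\<^sub>M i\<in>I. unim) (\<lambda>u. restrict u I)) seq_borel (\<lambda>w. seq_spacing n (ex0 w))"
    by (simp only: 1 2)
  also have "\<dots> = distr UX.S seq_borel (seq_spacing n)"
    by (simp only: distr_distr[OF mE mr'] comp_def eq)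
  finally show "distr P seq_borel (\<lambda>\<omega> k. real n * spacing n V \<omega> k) = spacing_law n"
    by (simp only: V_eq spacing_law_def)
qed

lemma seq_spacing_sum:
  assumes "n \<ge> 1"
  shows "(\<Sum>k<n. seq_spacing n u k) = real n"
proof -
  have "(\<Sum>k<m. seq_spacing n u k) = real n * ustat n (\<lambda>i (w::nat \<Rightarrow> real). w i) u m" for m
    by (induction m) (simp_all add: seq_spacing_def spacing_def right_diff_distrib)
  moreover have "ustat n (\<lambda>i (w::nat \<Rightarrow> real). w i) u n = 1"
    using assms by (subst ustat.simps) simp
  ultimately show ?thesis by simp
qed

lemma AE_spacing_law:
  assumes "n \<ge> 1"
  shows "AE y in spacing_law n. (\<Sum>k<n. y k) = real n \<and> (\<forall>k. y (k + n) = y k)"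
proof -
  have 1: "AE y in spacing_law n. f y = g y"
    if [measurable]: "f \<in> borel_measurable seq_borel" "g \<in> borel_measurable seq_borel"
      and eq: "\<And>u. f (seq_spacing n u) = g (seq_spacing n u)" for f g :: "(nat \<Rightarrow> real) \<Rightarrow> real"
    unfolding spacing_law_def
    using borel_measurable_eq[OF that(1,2)] by (subst AE_distr_iff) (auto simp: eq)
  have "AE y in spacing_law n. (\<Sum>k<n. y k) = real n"
    by (rule 1) (auto simp: seq_spacing_sum[OF assms])
  moreover have "AE y in spacing_law n. \<forall>k. y (k + n) = y k"
    unfolding AE_all_countable
    by (intro allI 1) (auto simp: seq_spacing_periodic[OF assms])
  ultimately show ?thesis by eventually_elim simp
qed

section \<open>The Gaussian limit of the density\<close>

lemma expm_moment:
  shows integrable_expm_power: "integrable expm (\<lambda>x. x ^ i)"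
    and integral_expm_power: "(\<integral>x. x ^ i \<partial>expm) = fact i"
proof -
  have nonneg: "AE x in expm. 0 \<le> x ^ i"
    using AE_expm_nonneg by eventually_elim simp
  have "(\<integral>\<^sup>+x. ennreal (x ^ i) \<partial>expm) = (\<integral>\<^sup>+x. ennreal (exponential_density 1 x * x ^ i) \<partial>lborel)"
  proof -
    have "(\<integral>\<^sup>+x. ennreal (x ^ i) \<partial>expm)
        = (\<integral>\<^sup>+x. ennreal (exponential_density 1 x) * ennreal (x ^ i) \<partial>lborel)"
      unfolding expm_def by (rule nn_integral_density) measurable
    also have "\<dots> = (\<integral>\<^sup>+x. ennreal (exponential_density 1 x * x ^ i) \<partial>lborel)"
      by (intro nn_integral_cong ennreal_mult'[symmetric]) simp
    finally show ?thesis .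
  qed
  also have "\<dots> = ennreal (fact i)"
    using nn_integral_erlang_ith_moment[of 1 0 i] by simp
  finally have 1: "(\<integral>\<^sup>+x. ennreal (x ^ i) \<partial>expm) = ennreal (fact i)" .
  show i: "integrable expm (\<lambda>x. x ^ i)"
    by (rule integrableI_nonneg[OF _ nonneg]) (simp_all add: 1)
  show "(\<integral>x. x ^ i \<partial>expm) = fact i"
    using nn_integral_eq_integral[OF i nonneg] integral_nonneg_AE[OF nonneg]
    unfolding 1 by (simp only: ennreal_inj fact_ge_zero)
qed

lemma
  fixes f :: "real \<Rightarrow> real"
  assumes [measurable]: "f \<in> borel_measurable borel"
  shows integrable_EX_component: "integrable expm f \<Longrightarrow> integrable EX.S (\<lambda>x. f (x i))"
    and integral_EX_component: "(\<integral>x. f (x i) \<partial>EX.S) = (\<integral>t. f t \<partial>expm)"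
proof -
  have eq: "distr EX.S expm (\<lambda>x. x i) = expm" by (rule EX.PiM_component) simp
  show "integrable EX.S (\<lambda>x. f (x i))" if "integrable expm f"
    by (rule integrable_distr[of "\<lambda>x. x i" EX.S expm]) (auto simp: eq that)
  have "(\<integral>t. f t \<partial>expm) = (\<integral>t. f t \<partial>distr EX.S expm (\<lambda>x. x i))" by (simp only: eq)
  then show "(\<integral>x. f (x i) \<partial>EX.S) = (\<integral>t. f t \<partial>expm)"
    by (simp add: integral_distr)
qed

lemma expm_centred_moments:
  shows "integrable EX.S (\<lambda>x. x 0 - 1)" "(\<integral>x. x 0 - 1 \<partial>EX.S) = 0"
    and "integrable EX.S (\<lambda>x. (x 0 - 1)\<^sup>2)" "(\<integral>x. (x 0 - 1)\<^sup>2 \<partial>EX.S) = 1"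
    and "integrable EX.S (\<lambda>x. (x 0 - 1) ^ 3)"
    and "integrable EX.S (\<lambda>x. (x 0 - 1) ^ 4)" "(\<integral>x. (x 0 - 1) ^ 4 \<partial>EX.S) = 9"
proof -
  note one = prob_space.prob_space[OF prob_space_expm, simplified]
  have i: "integrable expm (\<lambda>x. x)" "integrable expm (\<lambda>x. x\<^sup>2)" "integrable expm (\<lambda>x. x ^ 3)" "integrable expm (\<lambda>x. x ^ 4)"
    using integrable_expm_power[of 1] integrable_expm_power[of 2] integrable_expm_power[of 3] integrable_expm_power[of 4] by simp_all
  have v: "(\<integral>x. x \<partial>expm) = 1" "(\<integral>x. x\<^sup>2 \<partial>expm) = 2" "(\<integral>x. x ^ 3 \<partial>expm) = 6" "(\<integral>x. x ^ 4 \<partial>expm) = 24"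
    using integral_expm_power[of 1] integral_expm_power[of 2] integral_expm_power[of 3] integral_expm_power[of 4]
    by (simp_all add: fact_numeral)
  have p: "(x - 1)\<^sup>2 = x\<^sup>2 - 2 * x + 1" "(x - 1) ^ 3 = x ^ 3 - 3 * x\<^sup>2 + 3 * x - 1"
    "(x - 1) ^ 4 = x ^ 4 - 4 * x ^ 3 + 6 * x\<^sup>2 - 4 * x + 1" for x :: real
    by (simp_all add: power2_eq_square power3_eq_cube power4_eq_xxxx algebra_simps)
  have c: "integrable expm (\<lambda>_. 1 :: real)"
    using prob_space.finite_measure[OF prob_space_expm] by (rule finite_measure.integrable_const)
  have I: "integrable expm (\<lambda>t. t - 1)" "integrable expm (\<lambda>t. (t - 1)\<^sup>2)"
    "integrable expm (\<lambda>t. (t - 1) ^ 3)" "integrable expm (\<lambda>t. (t - 1) ^ 4)"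
    unfolding p
    by (intro Bochner_Integration.integrable_add Bochner_Integration.integrable_diff integrable_mult_right i c)+
  have V: "(\<integral>t. t - 1 \<partial>expm) = 0" "(\<integral>t. (t - 1)\<^sup>2 \<partial>expm) = 1" "(\<integral>t. (t - 1) ^ 4 \<partial>expm) = 9"
    unfolding p using i c by (simp_all add: v one)
  show "integrable EX.S (\<lambda>x. x 0 - 1)" by (rule integrable_EX_component[OF _ I(1)]) simp
  show "integrable EX.S (\<lambda>x. (x 0 - 1)\<^sup>2)" by (rule integrable_EX_component[OF _ I(2)]) simp
  show "integrable EX.S (\<lambda>x. (x 0 - 1) ^ 3)" by (rule integrable_EX_component[OF _ I(3)]) simp
  show "integrable EX.S (\<lambda>x. (x 0 - 1) ^ 4)" by (rule integrable_EX_component[OF _ I(4)]) simp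
  have "(\<integral>x. x 0 - 1 \<partial>EX.S) = (\<integral>t. t - 1 \<partial>expm)" by (rule integral_EX_component) simp
  then show "(\<integral>x. x 0 - 1 \<partial>EX.S) = 0" by (simp only: V)
  have "(\<integral>x. (x 0 - 1)\<^sup>2 \<partial>EX.S) = (\<integral>t. (t - 1)\<^sup>2 \<partial>expm)" by (rule integral_EX_component) simp
  then show "(\<integral>x. (x 0 - 1)\<^sup>2 \<partial>EX.S) = 1" by (simp only: V)
  have "(\<integral>x. (x 0 - 1) ^ 4 \<partial>EX.S) = (\<integral>t. (t - 1) ^ 4 \<partial>expm)" by (rule integral_EX_component) simp
  then show "(\<integral>x. (x 0 - 1) ^ 4 \<partial>EX.S) = 9" by (simp only: V)
qed

definition csum :: "nat \<Rightarrow> (nat \<Rightarrow> real) \<Rightarrow> real" where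
  "csum d x = (\<Sum>i<d. x i - 1)"

lemma measurable_csum [measurable]: "csum d \<in> borel_measurable seq_borel"
  unfolding csum_def[abs_def] by measurable

lemma dep_csum: "dep d (csum d)"
proof (rule depI)
  fix x y :: "nat \<Rightarrow> real" assume "\<And>i. i < d \<Longrightarrow> x i = y i"
  then show "csum d x = csum d y" unfolding csum_def by (intro sum.cong) auto
qed

text \<open>The moments are treated in one induction, because the recursion of the fourth moment
  uses the lower ones. Its exact value is 3 d^2 + 6 d; the bound 9 d^2 is a crude form that passes
  through the induction.\<close>

lemma csum_moments:
  "(\<forall>p\<le>4. integrable EX.S (\<lambda>x. csum d x ^ p)) \<and> (\<integral>x. csum d x \<partial>EX.S) = 0 \<and>
    (\<integral>x. (csum d x)\<^sup>2 \<partial>EX.S) = d \<and> (\<integral>x. csum d x ^ 4 \<partial>EX.S) \<le> 9 * (real d)\<^sup>2"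
proof (induction d)
  case 0
  then show ?case by (simp add: csum_def)
next
  case (Suc d)
  define z :: "(nat \<Rightarrow> real) \<Rightarrow> real" where "z x = x 0 - 1" for x
  have eq: "csum (Suc d) x = csum d x + z (shf d x)" for x
    by (simp add: csum_def z_def shf_def)
  have z: "integrable EX.S (\<lambda>x. z x ^ 0)" "integrable EX.S (\<lambda>x. z x ^ 1)" "integrable EX.S (\<lambda>x. z x ^ 2)"
    "integrable EX.S (\<lambda>x. z x ^ 3)" "integrable EX.S (\<lambda>x. z x ^ 4)"
    and zv: "(\<integral>x. z x \<partial>EX.S) = 0" "(\<integral>x. (z x)\<^sup>2 \<partial>EX.S) = 1" "(\<integral>x. z x ^ 4 \<partial>EX.S) = 9"
    using expm_centred_moments by (simp_all add: z_def)
  have zi: "integrable EX.S (\<lambda>x. z x ^ p)" if p: "p \<le> 4" for p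
  proof -
    consider "p = 0" | "p = 1" | "p = 2" | "p = 3" | "p = 4" using p by linarith
    then show ?thesis using z by cases auto
  qed
  have ci: "integrable EX.S (\<lambda>x. csum d x ^ p)" if "p \<le> 4" for p
    using Suc that by simp
  have mi: "integrable EX.S (\<lambda>x. csum d x ^ a * z (shf d x) ^ b)" if "a \<le> 4" "b \<le> 4" for a b
    by (rule EX.integrable_mult_shf[OF ci[OF that(1)] zi[OF that(2)]]) (rule dep_comp[OF dep_csum])
  have mv: "(\<integral>x. csum d x ^ a * z (shf d x) ^ b \<partial>EX.S) = (\<integral>x. csum d x ^ a \<partial>EX.S) * (\<integral>x. z x ^ b \<partial>EX.S)"
    if "a \<le> 4" "b \<le> 4" for a b
    by (rule EX.integral_mult_shf[OF ci[OF that(1)] zi[OF that(2)]]) (rule dep_comp[OF dep_csum])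
  have int: "integrable EX.S (\<lambda>x. csum (Suc d) x ^ p)" if "p \<le> 4" for p
    unfolding eq binomial_ring using that by (auto intro!: Bochner_Integration.integrable_sum mi simp: mult.assoc)
  have m1: "(\<integral>x. csum (Suc d) x \<partial>EX.S) = 0"
    using Suc mi[of 1 0] mi[of 0 1] mv[of 0 1] zv by (simp add: eq EX.P.prob_space[simplified])
  have m2: "(\<integral>x. (csum (Suc d) x)\<^sup>2 \<partial>EX.S) = Suc d"
  proof -
    have "(\<integral>x. (csum (Suc d) x)\<^sup>2 \<partial>EX.S) = (\<integral>x. csum d x ^ 2 * z (shf d x) ^ 0 + 2 * (csum d x ^ 1 * z (shf d x) ^ 1) + csum d x ^ 0 * z (shf d x) ^ 2 \<partial>EX.S)"
      by (simp add: eq power2_eq_square algebra_simps)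
    also have "\<dots> = (\<integral>x. csum d x ^ 2 * z (shf d x) ^ 0 \<partial>EX.S) + 2 * (\<integral>x. csum d x ^ 1 * z (shf d x) ^ 1 \<partial>EX.S) + (\<integral>x. csum d x ^ 0 * z (shf d x) ^ 2 \<partial>EX.S)"
      using mi[of 2 0] mi[of 1 1] mi[of 0 2] by simp
    also have "\<dots> = Suc d"
      using Suc zv mv[of 2 0] mv[of 1 1] mv[of 0 2] by (simp add: EX.P.prob_space[simplified])
    finally show ?thesis .
  qed
  have m4: "(\<integral>x. csum (Suc d) x ^ 4 \<partial>EX.S) \<le> 9 * (real (Suc d))\<^sup>2"
  proof -
    have "(\<integral>x. csum (Suc d) x ^ 4 \<partial>EX.S) = (\<integral>x. csum d x ^ 4 * z (shf d x) ^ 0 + 4 * (csum d x ^ 3 * z (shf d x) ^ 1)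
       + 6 * (csum d x ^ 2 * z (shf d x) ^ 2) + 4 * (csum d x ^ 1 * z (shf d x) ^ 3) + csum d x ^ 0 * z (shf d x) ^ 4 \<partial>EX.S)"
      by (simp add: eq power2_eq_square power3_eq_cube power4_eq_xxxx algebra_simps)
    also have "\<dots> = (\<integral>x. csum d x ^ 4 * z (shf d x) ^ 0 \<partial>EX.S) + 4 * (\<integral>x. csum d x ^ 3 * z (shf d x) ^ 1 \<partial>EX.S)
       + 6 * (\<integral>x. csum d x ^ 2 * z (shf d x) ^ 2 \<partial>EX.S) + 4 * (\<integral>x. csum d x ^ 1 * z (shf d x) ^ 3 \<partial>EX.S)
       + (\<integral>x. csum d x ^ 0 * z (shf d x) ^ 4 \<partial>EX.S)"
      using mi[of 4 0] mi[of 3 1] mi[of 2 2] mi[of 1 3] mi[of 0 4] by simp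
    also have "\<dots> = (\<integral>x. csum d x ^ 4 \<partial>EX.S) + 6 * real d + 9"
      using Suc zv mv[of 4 0] mv[of 3 1] mv[of 2 2] mv[of 1 3] mv[of 0 4] by (simp add: EX.P.prob_space[simplified])
    also have "\<dots> \<le> 9 * (real d)\<^sup>2 + 6 * real d + 9" using Suc by simp
    also have "\<dots> \<le> 9 * (real (Suc d))\<^sup>2" by (simp add: power2_eq_square algebra_simps)
    finally show ?thesis .
  qed
  show ?case using int m1 m2 m4 by blast
qed

section \<open>Approximation of the kernel by a Gaussian factor\<close>

lemma ln_one_plus_cubic_bound:
  assumes "\<bar>y::real\<bar> \<le> 1 / 2"
  shows "\<bar>ln (1 + y) - y + y\<^sup>2 / 2\<bar> \<le> 2 * \<bar>y\<bar> ^ 3"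
proof -
  define F where "F t = ln (1 + t) - t + t\<^sup>2 / 2" for t :: real
  \<comment> \<open>The mean value inequality: the derivative t^2 / (1 + t) is at most 2 y^2 for |t|
    \<le> |y|, since 1 + t \<ge> 1 / 2 there.\<close>
  have "norm (F y - F 0) \<le> (2 * y\<^sup>2) * norm (y - 0)"
  proof (rule differentiable_bound[where S = "{-\<bar>y\<bar>..\<bar>y\<bar>}" and f' = "\<lambda>t. (*) (t\<^sup>2 / (1 + t))"])
    fix t assume t: "t \<in> {-\<bar>y\<bar>..\<bar>y\<bar>}"
    then have t2: "1 + t > 0" "1 + t \<ge> 1 / 2" "\<bar>t\<bar> \<le> \<bar>y\<bar>" using assms by auto
    have "(F has_real_derivative (1 / (1 + t) - 1 + t)) (at t within {-\<bar>y\<bar>..\<bar>y\<bar>})"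
      unfolding F_def using t2 by (auto intro!: derivative_eq_intros simp: field_simps)
    moreover have "1 / (1 + t) - 1 + t = t\<^sup>2 / (1 + t)"
      using t2 by (simp add: field_simps power2_eq_square)
    ultimately show "(F has_derivative (*) (t\<^sup>2 / (1 + t))) (at t within {-\<bar>y\<bar>..\<bar>y\<bar>})"
      by (simp add: has_field_derivative_def)
    have "t\<^sup>2 \<le> y\<^sup>2" using t2 by (simp add: abs_le_square_iff)
    have "t\<^sup>2 / (1 + t) \<le> y\<^sup>2 / (1 / 2)"
      using t2 \<open>t\<^sup>2 \<le> y\<^sup>2\<close> by (intro frac_le) auto
    then have "\<bar>t\<^sup>2 / (1 + t)\<bar> \<le> 2 * y\<^sup>2" using t2 by simp
    then have c: "norm (t\<^sup>2 / (1 + t)) \<le> 2 * y\<^sup>2" by simp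
    show "onorm ((*) (t\<^sup>2 / (1 + t))) \<le> 2 * y\<^sup>2"
    proof (rule onorm_bound)
      fix z :: real
      show "norm (t\<^sup>2 / (1 + t) * z) \<le> 2 * y\<^sup>2 * norm z"
        unfolding norm_mult by (rule mult_right_mono[OF c]) simp
    qed simp
  qed (auto)
  then show ?thesis
    by (simp add: F_def power2_eq_square power3_eq_cube)
qed

lemma abs_exp_minus_diff_le:
  fixes a b :: real
  assumes "a \<le> 0" "b \<le> 0"
  shows "\<bar>exp a - exp b\<bar> \<le> \<bar>a - b\<bar>"
proof -
  have *: "exp v - exp u \<le> v - u" if "u \<le> v" "v \<le> 0" for u v :: real
  proof -
    have "exp v - exp u = exp v * (1 - exp (u - v))"
      by (simp add: right_diff_distrib flip: exp_add)
    also have "\<dots> \<le> 1 * (1 - exp (u - v))"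
      using that by (intro mult_right_mono) auto
    finally have "exp v - exp u \<le> 1 - exp (u - v)" by simp
    moreover have "1 - exp (u - v) \<le> v - u"
      using exp_ge_add_one_self[of "u - v"] by linarith
    ultimately show ?thesis by linarith
  qed
  show ?thesis
    using *[of a b] *[of b a] assms by (cases "a \<le> b") (auto simp: abs_if)
qed

text \<open>With w = k (1 + y) the kernel is exp (k (ln (1 + y) - y)), where k y = 1 - s sqrt n; the
  1 appears because the mean of w is k + 1 whereas the kernel has its maximum at k. The exponents of
  both sides are at most 0, so it is enough to compare them, and the quadratic term of the logarithm
  gives n s^2 / k up to small errors.\<close>

lemma kern_approx:
  assumes d: "d + 2 \<le> n" and q: "q \<ge> 0" and A: "\<bar>s\<bar> \<le> A"
    and s: "csum d x = sqrt n * s" and small: "(1 + sqrt n * A) / real (n - d - 1) \<le> 1 / 2"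
  defines "k \<equiv> real (n - d - 1)"
  shows "\<bar>kern n d x - exp (- (q * s\<^sup>2 / 2))\<bar>
    \<le> 2 * (1 + sqrt n * A) ^ 3 / k\<^sup>2 + (1 / k + 2 * sqrt n * A / k + A\<^sup>2 * \<bar>n / k - q\<bar>) / 2"
proof -
  have k: "k > 0" "real n = real d + 1 + k" using d by (auto simp: k_def)
  define w where "w = real n - (\<Sum>i<d. x i)"
  define y where "y = (1 - sqrt n * s) / k"
  have "(\<Sum>i<d. x i) = csum d x + d" by (simp add: csum_def sum_subtractf)
  then have w: "w = k + 1 - sqrt n * s" by (simp add: w_def s k(2))
  have "k * y = 1 - sqrt n * s" using k(1) by (simp add: y_def)
  then have wy: "w = k * (1 + y)" by (simp add: w distrib_left)
  have A0: "A \<ge> 0" using A by linarith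
  have num: "\<bar>1 - sqrt n * s\<bar> \<le> 1 + sqrt n * A"
  proof -
    have "\<bar>sqrt n * s\<bar> \<le> sqrt n * A" using A by (simp add: abs_mult mult_left_mono)
    then show ?thesis by linarith
  qed
  have y: "\<bar>y\<bar> \<le> 1 / 2"
  proof -
    have "\<bar>y\<bar> \<le> (1 + sqrt n * A) / k" using num k by (simp add: y_def abs_divide divide_right_mono)
    then show ?thesis using small unfolding k_def by (rule order_trans)
  qed
  then have y1: "1 + y > 0" by linarith
  have "w > 0" using wy y1 k by simp
  then have "\<not> real n < (\<Sum>i<d. x i)" by (simp add: w_def)
  then have "kern n d x = (w / k) ^ (n - d - 1) * exp (k - w)"
    by (simp only: kern_def w_def k_def if_False)
  also have "w / k = 1 + y" using k by (simp add: wy)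
  also have "(1 + y) ^ (n - d - 1) = exp (k * ln (1 + y))"
    using y1 by (simp add: k_def exp_of_nat_mult)
  also have "\<dots> * exp (k - w) = exp (k * (ln (1 + y) - y))"
    by (simp add: exp_add[symmetric] wy algebra_simps)
  finally have kern: "kern n d x = exp (k * (ln (1 + y) - y))" .
  have le0: "k * (ln (1 + y) - y) \<le> 0"
    using ln_add_one_self_le_self2[of y] y1 k by (simp add: mult_nonneg_nonpos)
  have "\<bar>kern n d x - exp (- (q * s\<^sup>2 / 2))\<bar> \<le> \<bar>k * (ln (1 + y) - y) - (- (q * s\<^sup>2 / 2))\<bar>"
    unfolding kern by (rule abs_exp_minus_diff_le[OF le0]) (use q in simp)
  also have "\<dots> = \<bar>k * (ln (1 + y) - y + y\<^sup>2 / 2) - (k * y\<^sup>2 - q * s\<^sup>2) / 2\<bar>"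
    by (simp add: algebra_simps diff_divide_distrib)
  also have "\<dots> \<le> k * \<bar>ln (1 + y) - y + y\<^sup>2 / 2\<bar> + \<bar>k * y\<^sup>2 - q * s\<^sup>2\<bar> / 2"
    using k abs_triangle_ineq4[of "k * (ln (1 + y) - y + y\<^sup>2 / 2)" "(k * y\<^sup>2 - q * s\<^sup>2) / 2"] by (simp add: abs_mult)
  also have "k * \<bar>ln (1 + y) - y + y\<^sup>2 / 2\<bar> \<le> 2 * (1 + sqrt n * A) ^ 3 / k\<^sup>2"
  proof -
    have "\<bar>ln (1 + y) - y + y\<^sup>2 / 2\<bar> \<le> 2 * \<bar>y\<bar> ^ 3" by (rule ln_one_plus_cubic_bound[OF y])
    also have "\<bar>y\<bar> ^ 3 \<le> ((1 + sqrt n * A) / k) ^ 3"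
      using num k by (intro power_mono) (auto simp: y_def abs_divide divide_right_mono)
    finally have "k * \<bar>ln (1 + y) - y + y\<^sup>2 / 2\<bar> \<le> k * (2 * ((1 + sqrt n * A) / k) ^ 3)"
      using k by (intro mult_left_mono) auto
    also have "\<dots> = 2 * (1 + sqrt n * A) ^ 3 / k\<^sup>2"
      using k by (simp add: power_divide power2_eq_square power3_eq_cube)
    finally show ?thesis .
  qed
  also have "\<bar>k * y\<^sup>2 - q * s\<^sup>2\<bar> \<le> 1 / k + 2 * sqrt n * A / k + A\<^sup>2 * \<bar>n / k - q\<bar>"
  proof -
    have "k * y\<^sup>2 = (1 - sqrt n * s)\<^sup>2 / k" using k by (simp add: y_def power_divide power2_eq_square)
    also have "(1 - sqrt n * s)\<^sup>2 = 1 - 2 * (sqrt n * s) + n * s\<^sup>2"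
      by (simp add: power2_diff power_mult_distrib)
    finally have "k * y\<^sup>2 - q * s\<^sup>2 = 1 / k - 2 * (sqrt n * s) / k + s\<^sup>2 * (n / k - q)"
      by (simp add: add_divide_distrib diff_divide_distrib algebra_simps)
    then have "\<bar>k * y\<^sup>2 - q * s\<^sup>2\<bar> \<le> \<bar>1 / k\<bar> + \<bar>2 * (sqrt n * s) / k\<bar> + \<bar>s\<^sup>2 * (n / k - q)\<bar>"
      by linarith
    moreover have "\<bar>2 * (sqrt n * s) / k\<bar> \<le> 2 * sqrt n * A / k"
      using A k by (simp add: abs_divide abs_mult divide_right_mono mult_left_mono)
    moreover have "\<bar>s\<^sup>2 * (n / k - q)\<bar> \<le> A\<^sup>2 * \<bar>n / k - q\<bar>"
      using A A0 unfolding abs_mult by (intro mult_right_mono) (auto simp: abs_le_square_iff[symmetric])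
    ultimately show ?thesis using k by simp
  qed
  finally show ?thesis by simp
qed

text \<open>Multiplied by the standard normal density, the integrand is 1 / sqrt (1 + a) times the
  normal density of variance 1 / (1 + a).\<close>

lemma integral_exp_std_normal:
  assumes "a \<ge> 0"
  shows "(\<integral>g. exp (- (a * g\<^sup>2 / 2)) \<partial>std_normal_distribution) = 1 / sqrt (1 + a)"
proof -
  have "(\<integral>g. exp (- (a * g\<^sup>2 / 2)) \<partial>std_normal_distribution)
      = (\<integral>g. std_normal_density g * exp (- (a * g\<^sup>2 / 2)) \<partial>lborel)"
    by (subst integral_density) (auto simp: normal_density_nonneg)
  also have "\<dots> = (\<integral>g. 1 / sqrt (1 + a) * normal_density 0 (1 / sqrt (1 + a)) g \<partial>lborel)"
  proof (rule Bochner_Integration.integral_cong)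
    fix g :: real
    define b where "b = sqrt (1 + a)"
    have b: "b > 0" "b\<^sup>2 = 1 + a" using assms by (auto simp: b_def)
    have "normal_density 0 (1 / b) g = b / sqrt (2 * pi) * exp (- (g\<^sup>2 * b\<^sup>2 / 2))"
      unfolding normal_density_def using b(1)
      by (simp add: power_divide real_sqrt_divide real_sqrt_mult divide_simps)
    moreover have "std_normal_density g * exp (- (a * g\<^sup>2 / 2)) = 1 / sqrt (2 * pi) * exp (- (g\<^sup>2 * b\<^sup>2 / 2))"
      unfolding std_normal_density_def b(2) mult.assoc exp_add[symmetric] by (simp add: algebra_simps add_divide_distrib)
    ultimately show "std_normal_density g * exp (- (a * g\<^sup>2 / 2)) = 1 / sqrt (1 + a) * normal_density 0 (1 / sqrt (1 + a)) g"
      using b(1) by (simp add: b_def[symmetric])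
  qed simp
  also have "\<dots> = 1 / sqrt (1 + a)"
    using assms integral_normal_density[of "1 / sqrt (1 + a)" 0] by simp
  finally show ?thesis .
qed

lemma tendsto_zeroI_eps:
  fixes f :: "nat \<Rightarrow> real"
  assumes "\<And>n. 0 \<le> f n" and "\<And>\<epsilon>. \<epsilon> > 0 \<Longrightarrow> \<forall>\<^sub>F n in sequentially. f n < \<epsilon>"
  shows "f \<longlonglongrightarrow> 0"
  using assms by (intro order_tendstoI) (auto intro: always_eventually less_le_trans)

text \<open>Where the scaled coordinate sum is bounded by A, \<open>kern_approx\<close> is uniform.
  Elsewhere the difference is at most 1, and Chebyshev's inequality makes this region small.\<close>

lemma kern_L1_limit:
  assumes d: "\<forall>\<^sub>F n in sequentially. d n + 2 \<le> n"
    and lim: "(\<lambda>n. real n / real (n - d n - 1)) \<longlonglongrightarrow> q" and q: "q > 0"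
  shows "(\<lambda>n. \<integral>x. \<bar>kern n (d n) x - exp (- (q * (csum (d n) x / sqrt n)\<^sup>2 / 2))\<bar> \<partial>EX.S) \<longlonglongrightarrow> 0"
proof (rule tendsto_zeroI_eps)
  fix \<epsilon> :: real assume \<epsilon>: "\<epsilon> > 0"
  \<comment> \<open>The region beyond A contributes at most the second moment divided by A^2. The
    second moment is d / n \<le> 1, so this is at most \<epsilon> / 2.\<close>
  define A where "A = sqrt (2 / \<epsilon>)"
  have A: "A > 0" "1 / A\<^sup>2 = \<epsilon> / 2" using \<epsilon> by (auto simp: A_def)
  define u where "u n = 1 / sqrt (real n)" for n :: nat
  define v where "v n = real n / real (n - d n - 1)" for n
  have u: "u \<longlonglongrightarrow> 0"
    unfolding u_def[abs_def]
    by (rule tendsto_divide_0[OF tendsto_const])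
      (auto intro!: filterlim_at_top_imp_at_infinity filterlim_compose[OF sqrt_at_top] filterlim_real_sequentially)
  have v: "v \<longlonglongrightarrow> q" using lim by (simp add: v_def[abs_def])
  \<comment> \<open>The bound of \<open>kern_approx\<close> expressed through u = 1 / sqrt n and v =
    n / k, whose limits are known.\<close>
  define b where "b n = 2 * ((u n + A) ^ 3 * (v n)\<^sup>2 * u n) + (v n * (u n)\<^sup>2 + 2 * A * v n * u n + A\<^sup>2 * \<bar>v n - q\<bar>) / 2" for n
  have "(\<lambda>n. 2 * ((u n + A) ^ 3 * (v n)\<^sup>2 * u n) + (v n * (u n)\<^sup>2 + 2 * A * v n * u n + A\<^sup>2 * \<bar>v n - q\<bar>) / 2)
     \<longlonglongrightarrow> 2 * ((0 + A) ^ 3 * q\<^sup>2 * 0) + (q * 0\<^sup>2 + 2 * A * q * 0 + A\<^sup>2 * \<bar>q - q\<bar>) / 2"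
    by (intro tendsto_intros u v) auto
  then have b: "b \<longlonglongrightarrow> 0" by (simp add: b_def[abs_def])
  have "(\<lambda>n. (u n + A) * v n * u n) \<longlonglongrightarrow> (0 + A) * q * 0"
    by (intro tendsto_intros u v)
  then have small: "\<forall>\<^sub>F n in sequentially. (u n + A) * v n * u n < 1 / 2"
    by (intro order_tendstoD) auto
  have "\<forall>\<^sub>F n in sequentially. b n < \<epsilon> / 2"
    using b \<epsilon> by (intro order_tendstoD) auto
  then show "\<forall>\<^sub>F n in sequentially. (\<integral>x. \<bar>kern n (d n) x - exp (- (q * (csum (d n) x / sqrt n)\<^sup>2 / 2))\<bar> \<partial>EX.S) < \<epsilon>"
    using small d
  proof eventually_elim
    case (elim n)
    have n: "real n > 0" using elim by simp
    define k where "k = real (n - d n - 1)"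
    have k: "k > 0" using elim by (simp add: k_def)
    define \<Lambda> where "\<Lambda> x = csum (d n) x / sqrt n" for x
    have m [measurable]: "\<Lambda> \<in> borel_measurable seq_borel" unfolding \<Lambda>_def[abs_def] by measurable
    have sq: "sqrt n * sqrt n = n" by simp
    have e1: "(u n + A) * v n * u n = (1 + sqrt n * A) / k"
    proof -
      have "(u n + A) * u n = (1 + sqrt n * A) / n"
        using n by (simp add: u_def field_simps)
      moreover have "(u n + A) * v n * u n = ((u n + A) * u n) * v n" by (simp only: ac_simps)
      ultimately have "(u n + A) * v n * u n = (1 + sqrt n * A) / n * v n" by (simp only:)
      then show ?thesis using n by (simp add: v_def k_def)
    qed
    have e2: "(u n + A) ^ 3 * (v n)\<^sup>2 * u n = (1 + sqrt n * A) ^ 3 / k\<^sup>2"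
    proof -
      have "u n + A = (1 + sqrt n * A) / sqrt n" using n by (simp add: u_def field_simps)
      then have "(u n + A) ^ 3 * u n = (1 + sqrt n * A) ^ 3 / (sqrt n ^ 3 * sqrt n)"
        by (simp add: power_divide u_def)
      also have "sqrt n ^ 3 * sqrt n = (real n)\<^sup>2"
      proof -
        have "sqrt n ^ 3 * sqrt n = (sqrt n * sqrt n) * (sqrt n * sqrt n)"
          by (simp only: power3_eq_cube ac_simps)
        then show ?thesis by (simp only: sq power2_eq_square)
      qed
      finally have "(u n + A) ^ 3 * u n = (1 + sqrt n * A) ^ 3 / (real n)\<^sup>2" .
      moreover have "(u n + A) ^ 3 * (v n)\<^sup>2 * u n = ((u n + A) ^ 3 * u n) * (v n)\<^sup>2" by (simp only: ac_simps)
      ultimately have "(u n + A) ^ 3 * (v n)\<^sup>2 * u n = (1 + sqrt n * A) ^ 3 / (real n)\<^sup>2 * (v n)\<^sup>2" by (simp only:)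
      then show ?thesis using n by (simp add: v_def k_def power_divide)
    qed
    have e3: "v n * (u n)\<^sup>2 = 1 / k" using n by (simp add: u_def v_def k_def power_divide)
    have e4: "2 * A * v n * u n = 2 * sqrt n * A / k"
    proof -
      have "2 * A * v n * u n = 2 * (n / sqrt n) * A / k" by (simp add: u_def v_def k_def ac_simps)
      then show ?thesis by (simp only: real_div_sqrt[OF of_nat_0_le_iff])
    qed
    have b_eq: "b n = 2 * (1 + sqrt n * A) ^ 3 / k\<^sup>2 + (1 / k + 2 * sqrt n * A / k + A\<^sup>2 * \<bar>n / k - q\<bar>) / 2"
      unfolding b_def e2 e3 e4 by (simp add: v_def k_def)
    have b0: "b n \<ge> 0" unfolding b_eq using k A by simp
    have pt: "\<bar>kern n (d n) x - exp (- (q * (\<Lambda> x)\<^sup>2 / 2))\<bar> \<le> b n + (\<Lambda> x)\<^sup>2 / A\<^sup>2" for x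
    proof (cases "\<bar>\<Lambda> x\<bar> \<le> A")
      case True
      have "\<bar>kern n (d n) x - exp (- (q * (\<Lambda> x)\<^sup>2 / 2))\<bar>
        \<le> 2 * (1 + sqrt n * A) ^ 3 / (real (n - d n - 1))\<^sup>2 + (1 / real (n - d n - 1) + 2 * sqrt n * A / real (n - d n - 1) + A\<^sup>2 * \<bar>n / real (n - d n - 1) - q\<bar>) / 2"
        by (rule kern_approx) (use elim e1 n q True in \<open>auto simp: \<Lambda>_def k_def\<close>)
      also have "\<dots> = b n" unfolding b_eq k_def ..
      finally show ?thesis using A by (simp add: add_increasing2)
    next
      case False
      have "exp (- (q * (\<Lambda> x)\<^sup>2 / 2)) \<le> 1" using q by simp
      then have "\<bar>kern n (d n) x - exp (- (q * (\<Lambda> x)\<^sup>2 / 2))\<bar> \<le> 1"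
        using kern_nonneg[of n "d n" x] kern_le_1[of "d n" n x] elim exp_ge_zero[of "- (q * (\<Lambda> x)\<^sup>2 / 2)"]
        unfolding abs_le_iff by linarith
      also have "1 \<le> (\<Lambda> x)\<^sup>2 / A\<^sup>2"
      proof -
        have "\<bar>A\<bar> \<le> \<bar>\<Lambda> x\<bar>" using False A by simp
        then have "A\<^sup>2 \<le> (\<Lambda> x)\<^sup>2" by (simp only: abs_le_square_iff)
        then show ?thesis using A by simp
      qed
      finally show ?thesis using b0 by linarith
    qed
    have \<Lambda>2: "integrable EX.S (\<lambda>x. (\<Lambda> x)\<^sup>2)" "(\<integral>x. (\<Lambda> x)\<^sup>2 \<partial>EX.S) = real (d n) / n"
      using csum_moments[of "d n"] n by (auto simp: \<Lambda>_def power_divide)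
    have "(\<integral>x. \<bar>kern n (d n) x - exp (- (q * (\<Lambda> x)\<^sup>2 / 2))\<bar> \<partial>EX.S) \<le> (\<integral>x. b n + (\<Lambda> x)\<^sup>2 / A\<^sup>2 \<partial>EX.S)"
    proof (rule integral_mono[OF _ _ pt])
      show "integrable EX.S (\<lambda>x. \<bar>kern n (d n) x - exp (- (q * (\<Lambda> x)\<^sup>2 / 2))\<bar>)"
      proof (rule Bochner_Integration.integrable_bound)
        show "integrable EX.S (\<lambda>x. b n + (\<Lambda> x)\<^sup>2 / A\<^sup>2)" using \<Lambda>2 by simp
        show "(\<lambda>x. \<bar>kern n (d n) x - exp (- (q * (\<Lambda> x)\<^sup>2 / 2))\<bar>) \<in> borel_measurable EX.S" by measurable
        show "AE x in EX.S. norm \<bar>kern n (d n) x - exp (- (q * (\<Lambda> x)\<^sup>2 / 2))\<bar> \<le> norm (b n + (\<Lambda> x)\<^sup>2 / A\<^sup>2)"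
          unfolding real_norm_def abs_idempotent by (intro AE_I2 order_trans[OF pt abs_ge_self])
      qed
      show "integrable EX.S (\<lambda>x. b n + (\<Lambda> x)\<^sup>2 / A\<^sup>2)" using \<Lambda>2 by simp
    qed
    also have "\<dots> = b n + (real (d n) / n) * (1 / A\<^sup>2)"
      using \<Lambda>2 by (simp add: EX.P.prob_space[simplified])
    also have "\<dots> \<le> b n + 1 * (1 / A\<^sup>2)"
      using elim n by (intro add_left_mono mult_right_mono) auto
    also have "\<dots> < \<epsilon>" using elim A(2) by simp
    finally show ?case by (simp add: \<Lambda>_def)
  qed
qed (auto)

section \<open>Characteristic functions weighted by the kernel\<close>

lemma integral_gauss_mixture:
  assumes [measurable]: "T \<in> borel_measurable seq_borel" "L \<in> borel_measurable seq_borel" and q: "q \<ge> 0"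
  shows "(\<integral>x. exp (- (q * (L x)\<^sup>2 / 2)) *\<^sub>R iexp (T x) \<partial>EX.S)
    = (\<integral>g. (\<integral>x. iexp (T x + (sqrt q * g) * L x) \<partial>EX.S) \<partial>std_normal_distribution)"
proof -
  interpret N: real_distribution std_normal_distribution by (rule real_dist_normal_dist)
  interpret PS: pair_prob_space EX.S std_normal_distribution ..
  have i: "integrable (EX.S \<Otimes>\<^sub>M std_normal_distribution) (\<lambda>(x, g). iexp (T x + (sqrt q * g) * L x))"
    by (rule PS.integrable_const_bound[where B = 1]) (auto simp: split_beta')
  have "(\<integral>g. (\<integral>x. iexp (T x + (sqrt q * g) * L x) \<partial>EX.S) \<partial>std_normal_distribution)
    = (\<integral>x. (\<integral>g. iexp (T x + (sqrt q * g) * L x) \<partial>std_normal_distribution) \<partial>EX.S)"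
    by (rule PS.Fubini_integral[OF i])
  also have "\<dots> = (\<integral>x. exp (- (q * (L x)\<^sup>2 / 2)) *\<^sub>R iexp (T x) \<partial>EX.S)"
  proof (rule Bochner_Integration.integral_cong)
    fix x
    have "(\<integral>g. iexp (T x + (sqrt q * g) * L x) \<partial>std_normal_distribution)
      = (\<integral>g. iexp (T x) * iexp ((sqrt q * L x) * g) \<partial>std_normal_distribution)"
      by (rule Bochner_Integration.integral_cong) (simp_all add: exp_add[symmetric] algebra_simps)
    also have "\<dots> = iexp (T x) * char std_normal_distribution (sqrt q * L x)"
      unfolding char_def by (rule integral_mult_right_zero)
    also have "char std_normal_distribution (sqrt q * L x) = complex_of_real (exp (- (q * (L x)\<^sup>2 / 2)))"
      using q by (simp add: char_std_normal_distribution power_mult_distrib)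
    finally show "(\<integral>g. iexp (T x + (sqrt q * g) * L x) \<partial>std_normal_distribution) = exp (- (q * (L x)\<^sup>2 / 2)) *\<^sub>R iexp (T x)"
      by (simp add: scaleR_conv_of_real mult.commute)
  qed simp
  finally show ?thesis by simp
qed

text \<open>\<open>c\<close> is the limiting characteristic function of the statistic at a fixed
  argument, and \<beta> the limiting variance of the scaled coordinate sum; the product in
  \<open>conv\<close> expresses their asymptotic independence. Pointwise convergence in
  \<open>u\<close> is enough, since the inner integrals are bounded by 1 and are averaged over a
  normal law.\<close>

lemma kern_char_limit:
  assumes d: "\<forall>\<^sub>F n in sequentially. d n + 2 \<le> n"
    and lim: "(\<lambda>n. real n / real (n - d n - 1)) \<longlonglongrightarrow> q" and q: "q > 0"
    and T: "\<And>n. T n \<in> borel_measurable seq_borel" and \<beta>: "\<beta> \<ge> 0"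
    and conv: "\<And>u. (\<lambda>n. \<integral>x. iexp (T n x + u * (csum (d n) x / sqrt n)) \<partial>EX.S)
      \<longlonglongrightarrow> complex_of_real (c * exp (- (\<beta> * u\<^sup>2 / 2)))"
  shows "(\<lambda>n. \<integral>x. kern n (d n) x *\<^sub>R iexp (T n x) \<partial>EX.S) \<longlonglongrightarrow> complex_of_real (c / sqrt (1 + \<beta> * q))"
proof -
  interpret N: real_distribution std_normal_distribution by (rule real_dist_normal_dist)
  note T [measurable]
  define \<Lambda> where "\<Lambda> n x = csum (d n) x / sqrt n" for n :: nat and x
  have [measurable]: "\<Lambda> n \<in> borel_measurable seq_borel" for n
    unfolding \<Lambda>_def[abs_def] by measurable
  define E where "E n x = exp (- (q * (\<Lambda> n x)\<^sup>2 / 2))" for n x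
  have [measurable]: "E n \<in> borel_measurable seq_borel" for n
    unfolding E_def[abs_def] by measurable
  have E1: "0 \<le> E n x" "E n x \<le> 1" for n x using q by (auto simp: E_def)
  have "(\<lambda>n. \<integral>x. E n x *\<^sub>R iexp (T n x) \<partial>EX.S)
      = (\<lambda>n. \<integral>g. (\<integral>x. iexp (T n x + (sqrt q * g) * \<Lambda> n x) \<partial>EX.S) \<partial>std_normal_distribution)"
    unfolding E_def using q by (intro ext integral_gauss_mixture) auto
  also have "\<dots> \<longlonglongrightarrow> (\<integral>g. complex_of_real (c * exp (- (\<beta> * (sqrt q * g)\<^sup>2 / 2))) \<partial>std_normal_distribution)"
  proof (rule integral_dominated_convergence[where w = "\<lambda>_. 1"])
    show "AE g in std_normal_distribution. (\<lambda>n. \<integral>x. iexp (T n x + (sqrt q * g) * \<Lambda> n x) \<partial>EX.S)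
       \<longlonglongrightarrow> complex_of_real (c * exp (- (\<beta> * (sqrt q * g)\<^sup>2 / 2)))"
      unfolding \<Lambda>_def by (intro AE_I2 conv)
    show "AE g in std_normal_distribution. cmod (\<integral>x. iexp (T n x + (sqrt q * g) * \<Lambda> n x) \<partial>EX.S) \<le> 1" for n
    proof (rule AE_I2)
      fix g
      have "cmod (\<integral>x. iexp (T n x + (sqrt q * g) * \<Lambda> n x) \<partial>EX.S)
        \<le> (\<integral>x. cmod (iexp (T n x + (sqrt q * g) * \<Lambda> n x)) \<partial>EX.S)"
        by (rule integral_norm_bound)
      also have "\<dots> = 1" by (simp only: norm_exp_i_times) (simp add: EX.P.prob_space[simplified])
      finally show "cmod (\<integral>x. iexp (T n x + (sqrt q * g) * \<Lambda> n x) \<partial>EX.S) \<le> 1" .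
    qed
    show "(\<lambda>g. complex_of_real (c * exp (- (\<beta> * (sqrt q * g)\<^sup>2 / 2)))) \<in> borel_measurable std_normal_distribution"
      by measurable
    show "(\<lambda>g. \<integral>x. iexp (T n x + (sqrt q * g) * \<Lambda> n x) \<partial>EX.S) \<in> borel_measurable std_normal_distribution" for n
      by (rule EX.P.borel_measurable_lebesgue_integral) measurable
    show "integrable std_normal_distribution (\<lambda>_. 1 :: real)"
      by (rule N.integrable_const)
  qed
  also have "(\<integral>g. complex_of_real (c * exp (- (\<beta> * (sqrt q * g)\<^sup>2 / 2))) \<partial>std_normal_distribution)
     = complex_of_real (c * (\<integral>g. exp (- ((\<beta> * q) * g\<^sup>2 / 2)) \<partial>std_normal_distribution))"
    using q by (simp add: power_mult_distrib mult.assoc)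
  also have "(\<integral>g. exp (- ((\<beta> * q) * g\<^sup>2 / 2)) \<partial>std_normal_distribution) = 1 / sqrt (1 + \<beta> * q)"
    by (rule integral_exp_std_normal) (use \<beta> q in simp)
  also have "c * (1 / sqrt (1 + \<beta> * q)) = c / sqrt (1 + \<beta> * q)"
    by simp
  finally have 1: "(\<lambda>n. \<integral>x. E n x *\<^sub>R iexp (T n x) \<partial>EX.S) \<longlonglongrightarrow> complex_of_real (c / sqrt (1 + \<beta> * q))" .
  have "(\<lambda>n. (\<integral>x. kern n (d n) x *\<^sub>R iexp (T n x) \<partial>EX.S) - (\<integral>x. E n x *\<^sub>R iexp (T n x) \<partial>EX.S)) \<longlonglongrightarrow> 0"
  proof (rule Lim_null_comparison)
    show "(\<lambda>n. \<integral>x. \<bar>kern n (d n) x - E n x\<bar> \<partial>EX.S) \<longlonglongrightarrow> 0"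
      unfolding E_def \<Lambda>_def by (rule kern_L1_limit[OF d lim q])
    show "\<forall>\<^sub>F n in sequentially. cmod ((\<integral>x. kern n (d n) x *\<^sub>R iexp (T n x) \<partial>EX.S) - (\<integral>x. E n x *\<^sub>R iexp (T n x) \<partial>EX.S))
      \<le> (\<integral>x. \<bar>kern n (d n) x - E n x\<bar> \<partial>EX.S)"
      using d
    proof eventually_elim
      case (elim n)
      have i1: "integrable EX.S (\<lambda>x. kern n (d n) x *\<^sub>R iexp (T n x))"
      proof (rule EX.P.integrable_const_bound[where B = 1])
        show "AE x in EX.S. cmod (kern n (d n) x *\<^sub>R iexp (T n x)) \<le> 1"
        proof (rule AE_I2)
          fix x
          have "cmod (kern n (d n) x *\<^sub>R iexp (T n x)) = kern n (d n) x"
            unfolding norm_scaleR norm_exp_i_times using kern_nonneg[of n "d n" x] by simp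
          then show "cmod (kern n (d n) x *\<^sub>R iexp (T n x)) \<le> 1"
            using kern_le_1[OF elim, of x] by (simp only:)
        qed
      qed auto
      have i2: "integrable EX.S (\<lambda>x. E n x *\<^sub>R iexp (T n x))"
      proof (rule EX.P.integrable_const_bound[where B = 1])
        show "AE x in EX.S. cmod (E n x *\<^sub>R iexp (T n x)) \<le> 1"
        proof (rule AE_I2)
          fix x
          have "cmod (E n x *\<^sub>R iexp (T n x)) = E n x"
            unfolding norm_scaleR norm_exp_i_times using E1(1)[of n x] by simp
          then show "cmod (E n x *\<^sub>R iexp (T n x)) \<le> 1"
            using E1(2)[of n x] by (simp only:)
        qed
      qed auto
      have "(\<integral>x. kern n (d n) x *\<^sub>R iexp (T n x) \<partial>EX.S) - (\<integral>x. E n x *\<^sub>R iexp (T n x) \<partial>EX.S)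
        = (\<integral>x. (kern n (d n) x - E n x) *\<^sub>R iexp (T n x) \<partial>EX.S)"
        unfolding scaleR_left_diff_distrib by (rule Bochner_Integration.integral_diff[OF i1 i2, symmetric])
      also have "cmod \<dots> \<le> (\<integral>x. cmod ((kern n (d n) x - E n x) *\<^sub>R iexp (T n x)) \<partial>EX.S)"
        by (rule integral_norm_bound)
      finally show ?case by simp
    qed
  qed
  from tendsto_add[OF this 1] show ?thesis by simp
qed

lemma tendsto_zero_by_eps:
  fixes f :: "nat \<Rightarrow> real" and C :: real
  assumes "\<And>n. 0 \<le> f n"
    and "\<And>\<delta>. \<delta> > 0 \<Longrightarrow> \<exists>a. a \<longlonglongrightarrow> 0 \<and> (\<forall>\<^sub>F n in sequentially. f n \<le> a n + C * \<delta>)"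
  shows "f \<longlonglongrightarrow> 0"
proof (rule tendsto_zeroI_eps[OF assms(1)])
  fix \<epsilon> :: real assume \<epsilon>: "\<epsilon> > 0"
  define \<delta> where "\<delta> = \<epsilon> / (2 * (\<bar>C\<bar> + 1))"
  have \<delta>: "\<delta> > 0" using \<epsilon> by (simp add: \<delta>_def)
  have C: "C * \<delta> \<le> \<epsilon> / 2"
  proof -
    have "C * \<delta> \<le> (\<bar>C\<bar> + 1) * \<delta>" using \<delta> by (intro mult_right_mono) auto
    also have "\<dots> = \<epsilon> / 2" by (simp add: \<delta>_def field_simps)
    finally show ?thesis .
  qed
  obtain a where a: "a \<longlonglongrightarrow> 0" "\<forall>\<^sub>F n in sequentially. f n \<le> a n + C * \<delta>"
    using assms(2)[OF \<delta>] by blast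
  have "\<forall>\<^sub>F n in sequentially. a n < \<epsilon> / 2"
    using a(1) \<epsilon> by (intro order_tendstoD) auto
  with a(2) show "\<forall>\<^sub>F n in sequentially. f n < \<epsilon>"
    by eventually_elim (use C in linarith)
qed

section \<open>Sums over spacings\<close>

text \<open>The functions of a row are already divided by \<sigma> sqrt n, so that the long run
  variance of row \<open>n\<close> is 1 / n and sums of \<open>n\<close> terms have the scale of the
  limit. The exponential coordinates are scaled by sqrt n accordingly.\<close>

locale spacing_array =
  fixes m :: "nat \<Rightarrow> nat" and G :: "nat \<Rightarrow> (nat \<Rightarrow> real) \<Rightarrow> real" and r :: real
  assumes dependent: "\<forall>\<^sub>F n in sequentially.
      dependent_sequence expm (m n) (G n) (\<lambda>x. (x 0 - 1) / sqrt n) (1 / n)"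
    and r: "r > 2"
    and G_int: "\<forall>\<^sub>F n in sequentially. integrable EX.S (\<lambda>x. \<bar>G n x\<bar> powr r)"
    and lyapunov: "(\<lambda>n. real n * (real (m n) powr (r - 1) * (\<integral>x. \<bar>G n x\<bar> powr r \<partial>EX.S))) \<longlonglongrightarrow> 0"
    and m_small: "(\<lambda>n. real (m n) / real n) \<longlonglongrightarrow> 0"
begin

text \<open>
  The blocks of length \<open>q * m n\<close> fill about the first \<open>(1 - 1 / q) * n\<close> coordinates, so that
  \<open>n / (n - front q n - 1)\<close>, which governs the Gaussian limit of \<open>kern n (front q n)\<close>, tends to \<open>q\<close>.
\<close>
definition nblocks :: "nat \<Rightarrow> nat \<Rightarrow> nat" where
  "nblocks q n = (n * (q - 1)) div (q * q * m n)"

definition front :: "nat \<Rightarrow> nat \<Rightarrow> nat" where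
  "front q n = nblocks q n * q * m n"

definition mG :: "nat \<Rightarrow> real" where
  "mG n = real (m n) powr r * (\<integral>x. \<bar>G n x\<bar> powr r \<partial>EX.S)"

lemma m_ge_1: "\<forall>\<^sub>F n in sequentially. m n \<ge> 1"
  using dependent by eventually_elim (auto simp: dependent_sequence_def dependent_sequence_axioms_def)

lemma m_le: "c > 0 \<Longrightarrow> \<forall>\<^sub>F n in sequentially. real (m n) \<le> c * real n"
proof -
  assume "c > 0"
  then have "\<forall>\<^sub>F n in sequentially. real (m n) / real n < c"
    using m_small by (intro order_tendstoD) auto
  then show ?thesis
    using eventually_gt_at_top[of 0]
    by eventually_elim (simp add: divide_less_eq)
qed

lemma mG_nonneg: "0 \<le> mG n"
  by (simp add: mG_def)

lemma nblocks_bounds: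
  assumes "q \<ge> 1" "m n \<ge> 1"
  shows "real q * real (front q n) \<le> real n * (real q - 1)"
    and "real n * (real q - 1) \<le> real q * real (front q n) + (real q)\<^sup>2 * real (m n)"
proof -
  define c where "c = q * q * m n"
  have c: "c > 0" using assms by (simp add: c_def)
  have "nblocks q n * c \<le> n * (q - 1)" unfolding nblocks_def c_def by simp
  moreover have "nblocks q n * c = q * front q n" by (simp add: c_def front_def)
  ultimately have "real (q * front q n) \<le> real (n * (q - 1))" by (simp only: of_nat_le_iff)
  then show "real q * real (front q n) \<le> real n * (real q - 1)" using assms by (simp add: of_nat_diff)
  have "n * (q - 1) \<le> nblocks q n * c + c"
    using div_mult_mod_eq[of "n * (q - 1)" c] mod_less_divisor[OF c, of "n * (q - 1)"]
    unfolding nblocks_def c_def[symmetric] by linarith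
  then have "real (n * (q - 1)) \<le> real (q * front q n + q * q * m n)"
    unfolding \<open>nblocks q n * c = q * front q n\<close> c_def[symmetric] by (simp only: of_nat_le_iff)
  then show "real n * (real q - 1) \<le> real q * real (front q n) + (real q)\<^sup>2 * real (m n)"
    using assms by (simp add: of_nat_diff power2_eq_square)
qed

lemma front_limit:
  assumes "q \<ge> 1"
  shows "(\<lambda>n. real (front q n) / real n) \<longlonglongrightarrow> (real q - 1) / real q"
proof (rule tendsto_sandwich)
  have q: "real q > 0" using assms by simp
  show "\<forall>\<^sub>F n in sequentially. (real q - 1) / real q - real q * (real (m n) / real n) \<le> real (front q n) / real n"
    using m_ge_1 eventually_gt_at_top[of 0]
  proof eventually_elim
    case (elim n)
    have "real n * (real q - 1) / (real q * real n) \<le> (real q * real (front q n) + (real q)\<^sup>2 * real (m n)) / (real q * real n)"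
      using nblocks_bounds(2)[OF assms, of n] elim q by (intro divide_right_mono) auto
    then show ?case using elim q by (simp add: add_divide_distrib power2_eq_square)
  qed
  show "\<forall>\<^sub>F n in sequentially. real (front q n) / real n \<le> (real q - 1) / real q"
    using m_ge_1 eventually_gt_at_top[of 0]
  proof eventually_elim
    case (elim n)
    have "real q * real (front q n) / (real q * real n) \<le> real n * (real q - 1) / (real q * real n)"
      using nblocks_bounds(1)[OF assms, of n] elim q by (intro divide_right_mono) auto
    then show ?case using elim q by simp
  qed
  have "(\<lambda>n. (real q - 1) / real q - real q * (real (m n) / real n)) \<longlonglongrightarrow> (real q - 1) / real q - real q * 0"
    by (intro tendsto_intros m_small)
  then show "(\<lambda>n. (real q - 1) / real q - real q * (real (m n) / real n)) \<longlonglongrightarrow> (real q - 1) / real q" by simp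
qed simp

text \<open>The inequality \<open>n + 2 * m n \<le> 2 * front q n\<close> says that what follows the
  blocks, enlarged by the overlaps of the windows, fits into \<open>front q n\<close> coordinates
  after a rotation. It holds eventually because 2 (q - 1) / q > 1 for q \<ge> 3.\<close>

lemma front_bounds:
  assumes q: "q \<ge> 3"
  shows "\<forall>\<^sub>F n in sequentially. front q n + 2 \<le> n \<and> n + 2 * m n \<le> 2 * front q n \<and> nblocks q n \<ge> 1 \<and> m n \<ge> 1 \<and> m n \<le> n"
proof -
  have q0: "real q \<ge> 3" using q by simp
  have lim: "(\<lambda>n. real (front q n) / real n) \<longlonglongrightarrow> (real q - 1) / real q"
    using front_limit[of q] q by simp
  have lim2: "(\<lambda>n. 2 * (real (front q n) / real n) - 2 * (real (m n) / real n)) \<longlonglongrightarrow> 2 * ((real q - 1) / real q) - 2 * 0"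
    by (intro tendsto_intros lim m_small)
  have "2 * ((real q - 1) / real q) - 2 * 0 > 1"
    using q0 by (simp add: divide_simps)
  then have ev2: "\<forall>\<^sub>F n in sequentially. 2 * (real (front q n) / real n) - 2 * (real (m n) / real n) > 1"
    using lim2 by (intro order_tendstoD) auto
  show ?thesis
    using m_ge_1 ev2 m_le[of 1, simplified] eventually_ge_at_top[of "2 * q"]
  proof eventually_elim
    case (elim n)
    have n: "real n > 0" using elim q by simp
    have "real n \<ge> 2 * real q" using elim(4) by (metis of_nat_le_iff of_nat_mult of_nat_numeral)
    have "real q * (real (front q n) + 2) \<le> real n * (real q - 1) + 2 * real q"
      using nblocks_bounds(1)[of q n] elim q by (simp add: distrib_left)
    also have "\<dots> \<le> real q * real n"
      using \<open>real n \<ge> 2 * real q\<close> by (simp add: right_diff_distrib mult.commute)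
    finally have "real (front q n) + 2 \<le> real n" using q0 by simp
    moreover have "real n + 2 * real (m n) < 2 * real (front q n)"
    proof -
      have "1 * real n < (2 * (real (front q n) / real n) - 2 * (real (m n) / real n)) * real n"
        by (rule mult_strict_right_mono[OF elim(2) n])
      also have "\<dots> = 2 * real (front q n) - 2 * real (m n)" using n by (simp add: left_diff_distrib)
      finally show ?thesis by simp
    qed
    moreover have "nblocks q n \<ge> 1"
    proof (rule ccontr)
      assume "\<not> nblocks q n \<ge> 1"
      then have "front q n = 0" by (simp add: front_def)
      with calculation show False using n by simp
    qed
    ultimately show ?case using elim by linarith
  qed
qed

lemma front_ratio_limit:
  assumes q: "q \<ge> 3"
  shows "(\<lambda>n. real n / real (n - front q n - 1)) \<longlonglongrightarrow> real q"
proof -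
  have q0: "real q > 0" using q by simp
  have "(\<lambda>n. 1 - real (front q n) / real n - 1 / real n) \<longlonglongrightarrow> 1 - (real q - 1) / real q - 0"
    by (intro tendsto_diff tendsto_const front_limit lim_1_over_n) (use q in simp)
  also have "1 - (real q - 1) / real q - 0 = 1 / real q" using q0 by (simp add: field_simps)
  finally have "(\<lambda>n. inverse (1 - real (front q n) / real n - 1 / real n)) \<longlonglongrightarrow> inverse (1 / real q)"
    using q0 by (intro tendsto_inverse) auto
  moreover have "\<forall>\<^sub>F n in sequentially. inverse (1 - real (front q n) / real n - 1 / real n) = real n / real (n - front q n - 1)"
    using front_bounds[OF q]
  proof eventually_elim
    case (elim n)
    have "real (n - front q n - 1) = real n - real (front q n) - 1" using elim by (simp add: of_nat_diff)
    moreover have "1 - real (front q n) / real n - 1 / real n = (real n - real (front q n) - 1) / real n"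
      using elim by (simp add: diff_divide_distrib)
    ultimately show ?case by simp
  qed
  ultimately show ?thesis by (simp add: tendsto_cong)
qed

lemma mG_limit: "mG \<longlonglongrightarrow> 0"
proof (rule Lim_null_comparison[OF _ lyapunov])
  show "\<forall>\<^sub>F n in sequentially. norm (mG n) \<le> real n * (real (m n) powr (r - 1) * (\<integral>x. \<bar>G n x\<bar> powr r \<partial>EX.S))"
    using m_ge_1 m_le[of 1, simplified]
  proof eventually_elim
    case (elim n)
    have "mG n = real (m n) * (real (m n) powr (r - 1) * (\<integral>x. \<bar>G n x\<bar> powr r \<partial>EX.S))"
      using elim by (simp add: mG_def powr_diff)
    also have "\<dots> \<le> real n * (real (m n) powr (r - 1) * (\<integral>x. \<bar>G n x\<bar> powr r \<partial>EX.S))"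
      using elim by (intro mult_right_mono) auto
    finally show ?case using mG_nonneg[of n] by simp
  qed
qed

text \<open>This controls the boundary terms, whose variance need not be comparable with m \<tau>.
  Splitting at m |G| = sqrt \<delta> reduces the second moment to \<delta> plus a multiple of
  \<open>mG\<close>.\<close>

lemma gvar_limit: "(\<lambda>n. (real (m n))\<^sup>2 * (\<integral>x. (G n x)\<^sup>2 \<partial>EX.S)) \<longlonglongrightarrow> 0"
proof (rule tendsto_zero_by_eps[where C = 1])
  fix \<delta> :: real assume \<delta>: "\<delta> > 0"
  define b where "b = sqrt \<delta>"
  have b: "b > 0" "b\<^sup>2 = \<delta>" using \<delta> by (auto simp: b_def)
  have pt: "x\<^sup>2 \<le> b\<^sup>2 + b powr (2 - r) * \<bar>x\<bar> powr r" for x :: real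
  proof (cases "\<bar>x\<bar> \<le> b")
    case True
    then have "x\<^sup>2 \<le> b\<^sup>2" using b(1) abs_le_square_iff[of x b] by simp
    then show ?thesis by (simp add: add_increasing2)
  next
    case False
    then have x: "\<bar>x\<bar> > 0" using b by linarith
    have "\<bar>x\<bar> powr (2 - r) \<le> b powr (2 - r)" using False b r by (intro powr_mono2') auto
    then have "\<bar>x\<bar> powr (2 - r) * \<bar>x\<bar> powr r \<le> b powr (2 - r) * \<bar>x\<bar> powr r" by (intro mult_right_mono) auto
    moreover have "\<bar>x\<bar> powr (2 - r) * \<bar>x\<bar> powr r = x\<^sup>2" using x by (simp add: powr_add[symmetric] powr_numeral)
    ultimately have "x\<^sup>2 \<le> b powr (2 - r) * \<bar>x\<bar> powr r" by simp
    then show ?thesis by (simp add: add_increasing)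
  qed
  have "(\<lambda>n. b powr (2 - r) * mG n) \<longlonglongrightarrow> b powr (2 - r) * 0" by (intro tendsto_intros mG_limit)
  then have lim: "(\<lambda>n. b powr (2 - r) * mG n) \<longlonglongrightarrow> 0" by simp
  moreover have "\<forall>\<^sub>F n in sequentially. (real (m n))\<^sup>2 * (\<integral>x. (G n x)\<^sup>2 \<partial>EX.S) \<le> b powr (2 - r) * mG n + 1 * \<delta>"
    using dependent G_int
  proof eventually_elim
    case (elim n)
    interpret D: dependent_sequence expm "m n" "G n" "\<lambda>x. (x 0 - 1) / sqrt n" "1 / n" by fact
    have i2: "integrable EX.S (\<lambda>x. (G n x)\<^sup>2)" using D.g_sqi by (rule EX.sqi_integrable_sq)
    have "(real (m n))\<^sup>2 * (\<integral>x. (G n x)\<^sup>2 \<partial>EX.S) = (\<integral>x. (real (m n) * G n x)\<^sup>2 \<partial>EX.S)"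
      by (simp add: power_mult_distrib)
    also have "\<dots> \<le> (\<integral>x. b\<^sup>2 + b powr (2 - r) * (real (m n) powr r * \<bar>G n x\<bar> powr r) \<partial>EX.S)"
    proof (rule integral_mono)
      show "integrable EX.S (\<lambda>x. (real (m n) * G n x)\<^sup>2)" using i2 by (simp add: power_mult_distrib)
      show "integrable EX.S (\<lambda>x. b\<^sup>2 + b powr (2 - r) * (real (m n) powr r * \<bar>G n x\<bar> powr r))" using elim by simp
      show "(real (m n) * G n x)\<^sup>2 \<le> b\<^sup>2 + b powr (2 - r) * (real (m n) powr r * \<bar>G n x\<bar> powr r)" for x
        using pt[of "real (m n) * G n x"] by (simp add: abs_mult powr_mult)
    qed
    also have "\<dots> = b\<^sup>2 + b powr (2 - r) * mG n"
      using elim by (simp add: mG_def EX.P.prob_space[simplified])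
    finally show ?case by (simp add: b)
  qed
  ultimately show "\<exists>a. a \<longlonglongrightarrow> 0 \<and> (\<forall>\<^sub>F n in sequentially. (real (m n))\<^sup>2 * (\<integral>x. (G n x)\<^sup>2 \<partial>EX.S) \<le> a n + 1 * \<delta>)"
    by blast
qed simp

definition front_blocks :: "nat \<Rightarrow> nat \<Rightarrow> (nat \<Rightarrow> real) \<Rightarrow> real" where
  "front_blocks q n = dependent_sequence.blocks expm (m n) (G n) q (nblocks q n)"

lemma evar_eq:
  assumes "dependent_sequence expm (m n) (G n) (\<lambda>x. (x 0 - 1) / sqrt n) (1 / n)" "n > 0"
  shows "dependent_sequence.evar expm (\<lambda>x. (x 0 - 1) / sqrt n) = 1 / n"
proof -
  interpret D: dependent_sequence expm "m n" "G n" "\<lambda>x. (x 0 - 1) / sqrt n" "1 / n" by fact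
  show ?thesis
    unfolding D.evar_def using assms(2) expm_centred_moments(4) by (simp add: power_divide)
qed

lemma lin_fourth:
  assumes "dependent_sequence expm (m n) (G n) (\<lambda>x. (x 0 - 1) / sqrt n) (1 / n)" "n > 0"
  shows "integrable EX.S (\<lambda>x. dependent_sequence.lin (m n) (\<lambda>x. (x 0 - 1) / sqrt n) x ^ 4)"
    and "(\<integral>x. dependent_sequence.lin (m n) (\<lambda>x. (x 0 - 1) / sqrt n) x ^ 4 \<partial>EX.S) \<le> 9 * (real (m n) / real n)\<^sup>2"
proof -
  interpret D: dependent_sequence expm "m n" "G n" "\<lambda>x. (x 0 - 1) / sqrt n" "1 / n" by fact
  have lin: "D.lin x = csum (m n) x / sqrt n" for x
    by (simp add: D.lin_def csum_def shf_def sum_divide_distrib)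
  have n4: "sqrt (real n) ^ 4 = (real n)\<^sup>2"
    using power_mult[of "sqrt (real n)" 2 2] by simp
  have *: "(\<lambda>x. D.lin x ^ 4) = (\<lambda>x. csum (m n) x ^ 4 / (real n)\<^sup>2)"
    by (simp add: lin power_divide n4)
  show "integrable EX.S (\<lambda>x. D.lin x ^ 4)"
    unfolding * using csum_moments[of "m n"] by simp
  have "(\<integral>x. D.lin x ^ 4 \<partial>EX.S) = (\<integral>x. csum (m n) x ^ 4 \<partial>EX.S) / (real n)\<^sup>2"
    unfolding * by simp
  also have "\<dots> \<le> 9 * (real (m n))\<^sup>2 / (real n)\<^sup>2"
    using csum_moments[of "m n"] by (intro divide_right_mono) auto
  finally show "(\<integral>x. D.lin x ^ 4 \<partial>EX.S) \<le> 9 * (real (m n) / real n)\<^sup>2"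
    by (simp add: power_divide)
qed

end

lemma cmod_iexp_diff_le: "cmod (iexp a - iexp b) \<le> \<bar>a - b\<bar>"
proof -
  have "iexp a - iexp b = iexp b * (iexp (a - b) - 1)"
    by (simp add: right_diff_distrib exp_add[symmetric] algebra_simps)
  then have "cmod (iexp a - iexp b) = cmod (iexp (a - b) - 1)"
    by (simp only: norm_mult norm_exp_i_times mult_1)
  also have "\<dots> \<le> \<bar>a - b\<bar>"
    using iexp_approx1[of "a - b" 0] by simp
  finally show ?thesis .
qed

lemma (in prob_space) integral_iexp_diff_le:
  fixes f g :: "'a \<Rightarrow> real"
  assumes [measurable]: "f \<in> borel_measurable M" "g \<in> borel_measurable M"
    and i: "integrable M (\<lambda>x. (f x - g x)\<^sup>2)"
  shows "cmod ((\<integral>x. iexp (f x) \<partial>M) - (\<integral>x. iexp (g x) \<partial>M)) \<le> sqrt (\<integral>x. (f x - g x)\<^sup>2 \<partial>M)"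
proof -
  have i1: "integrable M (\<lambda>x. \<bar>f x - g x\<bar>)"
  proof (rule Bochner_Integration.integrable_bound)
    show "integrable M (\<lambda>x. 1 + (f x - g x)\<^sup>2)" using i by simp
    have "\<bar>a\<bar> \<le> 1 + a\<^sup>2" for a :: real
    proof -
      have "0 \<le> (\<bar>a\<bar> - 1)\<^sup>2" "0 \<le> \<bar>a\<bar>" by simp_all
      then show ?thesis by (simp add: power2_diff)
    qed
    then show "AE x in M. norm \<bar>f x - g x\<bar> \<le> norm (1 + (f x - g x)\<^sup>2)"
      by (intro AE_I2) simp
  qed measurable
  have ii: "integrable M (\<lambda>x. iexp (f x))" "integrable M (\<lambda>x. iexp (g x))"
    by (rule integrable_const_bound[where B = 1]; simp)+
  have "cmod ((\<integral>x. iexp (f x) \<partial>M) - (\<integral>x. iexp (g x) \<partial>M)) = cmod (\<integral>x. iexp (f x) - iexp (g x) \<partial>M)"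
    by (simp only: Bochner_Integration.integral_diff[OF ii])
  also have "\<dots> \<le> (\<integral>x. cmod (iexp (f x) - iexp (g x)) \<partial>M)" by (rule integral_norm_bound)
  also have "\<dots> \<le> (\<integral>x. \<bar>f x - g x\<bar> \<partial>M)"
    by (rule integral_mono[OF integrable_norm[OF Bochner_Integration.integrable_diff[OF ii]] i1 cmod_iexp_diff_le])
  also have "\<dots> \<le> sqrt (\<integral>x. (f x - g x)\<^sup>2 \<partial>M)"
  proof (rule real_le_rsqrt)
    have "(\<lambda>x. x\<^sup>2) (\<integral>x. \<bar>f x - g x\<bar> \<partial>M) \<le> (\<integral>x. (\<bar>f x - g x\<bar>)\<^sup>2 \<partial>M)"
      by (rule jensens_inequality[where I = UNIV]) (use i1 i convex_power2 in auto)
    then show "(\<integral>x. \<bar>f x - g x\<bar> \<partial>M)\<^sup>2 \<le> (\<integral>x. (f x - g x)\<^sup>2 \<partial>M)" by simp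
  qed
  finally show ?thesis .
qed

context spacing_array
begin

text \<open>The \<open>K\<close> groups together have variance \<open>w n\<close>. Its coefficient
  of s^2 tends to \<rho>^2: one factor \<rho> is the proportion of coordinates in the front, the
  other the proportion of retained differences. The coordinate sum omits nothing, so it has only the
  first factor.\<close>

lemma front_blocks_limit:
  assumes q: "q \<ge> 3"
  defines "\<rho> \<equiv> (real q - 1) / real q"
  shows "(\<lambda>n. \<integral>x. iexp (s * front_blocks q n x + u * (csum (front q n) x / sqrt n)) \<partial>EX.S)
    \<longlonglongrightarrow> complex_of_real (exp (- (\<rho>\<^sup>2 * s\<^sup>2 / 2)) * exp (- (\<rho> * u\<^sup>2 / 2)))"
proof -
  have q0: "real q > 0" "q \<ge> 1" "real (q - 1) = real q - 1" using q by (auto simp: of_nat_diff)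
  define F where "F n = (\<integral>x. iexp (s * front_blocks q n x + u * (csum (front q n) x / sqrt n)) \<partial>EX.S)" for n
  define mn where "mn n = real (m n) / real n" for n
  define w where "w n = s\<^sup>2 * (real (front q n) / real n * \<rho>) + u\<^sup>2 * (real (front q n) / real n)" for n
  define v where "v n = s\<^sup>2 * (real (q - 1) * mn n) + u\<^sup>2 * (real q * mn n)" for n
  define C0 where "C0 = (2 * real q) ^ 3 * real q"
  define A1 where "A1 = (1 + \<bar>s\<bar>) ^ 3"
  define A2 where "A2 = (1 + \<bar>u\<bar>) ^ 3"
  have pos: "C0 \<ge> 0" "A1 \<ge> 0" "A2 \<ge> 0" by (auto simp: C0_def A1_def A2_def)
  define ly where "ly n = real n * (real (m n) powr (r - 1) * (\<integral>x. \<bar>G n x\<bar> powr r \<partial>EX.S))" for n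
  have fl: "(\<lambda>n. real (front q n) / real n) \<longlonglongrightarrow> \<rho>"
    unfolding \<rho>_def using q by (intro front_limit) simp
  have w: "w \<longlonglongrightarrow> s\<^sup>2 * (\<rho> * \<rho>) + u\<^sup>2 * \<rho>"
    unfolding w_def[abs_def] by (intro tendsto_intros fl)
  have mn: "mn \<longlonglongrightarrow> 0" unfolding mn_def[abs_def] by (rule m_small)
  have "v \<longlonglongrightarrow> s\<^sup>2 * (real (q - 1) * 0) + u\<^sup>2 * (real q * 0)"
    unfolding v_def[abs_def] by (intro tendsto_intros mn)
  then have v: "v \<longlonglongrightarrow> 0" by simp
  have err: "(\<lambda>n. cmod (F n - complex_of_real (exp (- (w n / 2))))) \<longlonglongrightarrow> 0"
  proof (rule tendsto_zero_by_eps[where C = "C0 * (A1 + A2)"])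
    fix \<delta> :: real assume \<delta>: "\<delta> > 0"
    define B1 where "B1 = 6 * \<delta> powr (2 - r) * 3 powr r"
    define B2 where "B2 = 6 * \<delta> powr (-2) * 9"
    have Bpos: "B1 \<ge> 0" "B2 \<ge> 0" by (auto simp: B1_def B2_def)
    define a where "a n = w n * v n + C0 * (A1 * (B1 * ly n) + A2 * (B2 * mn n))" for n
    have "(\<lambda>n. w n * v n + C0 * (A1 * (B1 * ly n) + A2 * (B2 * mn n))) \<longlonglongrightarrow>
        (s\<^sup>2 * (\<rho> * \<rho>) + u\<^sup>2 * \<rho>) * 0 + C0 * (A1 * (B1 * 0) + A2 * (B2 * 0))"
      unfolding ly_def by (intro tendsto_intros w v mn lyapunov)
    then have a: "a \<longlonglongrightarrow> 0" by (simp add: a_def[abs_def])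
    have "\<forall>\<^sub>F n in sequentially. cmod (F n - complex_of_real (exp (- (w n / 2)))) \<le> a n + C0 * (A1 + A2) * \<delta>"
      using dependent G_int front_bounds[OF q]
    proof eventually_elim
      case (elim n)
      interpret D: dependent_sequence expm "m n" "G n" "\<lambda>x. (x 0 - 1) / sqrt n" "1 / n" by fact
      have n: "n > 0" "m n \<ge> 1" "real n > 0" using elim by auto
      define K where "K = nblocks q n"
      have front: "front q n = K * q * m n" by (simp add: front_def K_def)
      have "K * m n \<le> front q n" unfolding front using q0 by simp
      then have Km: "real K * real (m n) \<le> real n"
        using elim by (metis (no_types, lifting) add_leD1 le_trans of_nat_le_iff of_nat_mult)
      have Kmn: "real K * mn n \<le> 1" using Km n by (simp add: mn_def divide_le_eq)
      have mn0: "mn n \<ge> 0" by (simp add: mn_def)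
      have evar: "D.evar = 1 / n" by (rule evar_eq) (use elim n in auto)
      have csum: "(\<Sum>i<K * q * m n. (shf i x 0 - 1) / sqrt n) = csum (front q n) x / sqrt n" for x
        by (simp add: csum_def front shf_def sum_divide_distrib)
      have vv: "s\<^sup>2 * (real (q - 1) * (real (m n) * (1 / real n))) + u\<^sup>2 * (real q * (real (m n) * D.evar)) = v n"
        by (simp add: v_def mn_def evar)
      have fm: "real (front q n) / real n = real K * (real q * mn n)"
        by (simp add: front mn_def)
      have rq: "real (q - 1) = \<rho> * real q"
        unfolding \<rho>_def q0(3) using q0(1) by simp
      have Kv: "real K * v n = w n"
        unfolding w_def v_def fm rq by (simp add: algebra_simps)
      have "cmod (F n - complex_of_real (exp (- (real K * v n / 2))))
        \<le> K * ((v n)\<^sup>2 + (2 * real q) ^ 3 * (real q *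
          (A1 * (\<delta> * (m n * (1 / n)) + 6 * \<delta> powr (2 - r) * (3 powr r * (m n powr r * (\<integral>x. \<bar>G n x\<bar> powr r \<partial>EX.S))))
         + A2 * (\<delta> * (m n * D.evar) + 6 * \<delta> powr (-2) * (\<integral>x. D.lin x ^ 4 \<partial>EX.S)))))"
        using D.blocks_char[of q r \<delta> s K u] q0 r elim lin_fourth(1)[of n] n \<delta>
        unfolding vv csum F_def front_blocks_def K_def[symmetric] A1_def A2_def by simp
      also have "\<dots> = w n * v n + C0 * (A1 * (\<delta> * (K * mn n) + B1 * (K * mG n)) + A2 * (\<delta> * (K * mn n) + 6 * \<delta> powr (-2) * (K * (\<integral>x. D.lin x ^ 4 \<partial>EX.S))))"
        unfolding Kv[symmetric] evar C0_def B1_def mn_def mG_def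
        by (simp add: algebra_simps power2_eq_square)
      \<comment> \<open>Here K m \<le> n is used: it bounds K m / n by 1, it bounds
        \<open>K * mG n\<close> by the Lyapunov quantity, and of the fourth moments of order (m /
        n)^2 it leaves one factor m / n.\<close>
      also have "\<dots> \<le> w n * v n + C0 * (A1 * (\<delta> * 1 + B1 * ly n) + A2 * (\<delta> * 1 + 6 * \<delta> powr (-2) * (9 * mn n)))"
      proof -
        have "K * mG n \<le> ly n"
        proof -
          have "real K * mG n = (real K * real (m n)) * (real (m n) powr (r - 1) * (\<integral>x. \<bar>G n x\<bar> powr r \<partial>EX.S))"
            using n by (simp add: mG_def powr_diff)
          also have "\<dots> \<le> ly n" unfolding ly_def using Km by (intro mult_right_mono) auto
          finally show ?thesis .
        qed
        moreover have "K * (\<integral>x. D.lin x ^ 4 \<partial>EX.S) \<le> 9 * mn n"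
        proof -
          have "real K * (\<integral>x. D.lin x ^ 4 \<partial>EX.S) \<le> real K * (9 * (mn n)\<^sup>2)"
            unfolding mn_def using lin_fourth(2)[OF elim(1)] n by (intro mult_left_mono) auto
          also have "\<dots> = 9 * (real K * mn n) * mn n" by (simp add: power2_eq_square)
          also have "\<dots> \<le> 9 * 1 * mn n" using Kmn mn0 by (intro mult_right_mono mult_left_mono) auto
          finally show ?thesis by simp
        qed
        ultimately show ?thesis
          using Kmn pos Bpos \<delta> by (intro add_left_mono mult_left_mono add_mono) auto
      qed
      also have "\<dots> = a n + C0 * (A1 + A2) * \<delta>"
        by (simp add: a_def B2_def algebra_simps)
      finally show ?case unfolding Kv .
    qed
    with a show "\<exists>a. a \<longlonglongrightarrow> 0 \<and> (\<forall>\<^sub>F n in sequentially.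
        cmod (F n - complex_of_real (exp (- (w n / 2)))) \<le> a n + C0 * (A1 + A2) * \<delta>)" by blast
  qed simp
  have "(\<lambda>n. complex_of_real (exp (- (w n / 2)))) \<longlonglongrightarrow> complex_of_real (exp (- ((s\<^sup>2 * (\<rho> * \<rho>) + u\<^sup>2 * \<rho>) / 2)))"
    by (intro tendsto_intros w) auto
  from tendsto_add[OF tendsto_norm_zero_cancel[OF err] this]
  have "F \<longlonglongrightarrow> complex_of_real (exp (- ((s\<^sup>2 * (\<rho> * \<rho>) + u\<^sup>2 * \<rho>) / 2)))" by simp
  also have "exp (- ((s\<^sup>2 * (\<rho> * \<rho>) + u\<^sup>2 * \<rho>) / 2)) = exp (- (\<rho>\<^sup>2 * s\<^sup>2 / 2)) * exp (- (\<rho> * u\<^sup>2 / 2))"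
    unfolding exp_add[symmetric] by (simp add: power2_eq_square algebra_simps add_divide_distrib)
  finally show ?thesis by (simp add: F_def[abs_def])
qed

lemma kern_blocks_limit:
  assumes q: "q \<ge> 3"
  shows "(\<lambda>n. \<integral>x. kern n (front q n) x *\<^sub>R iexp (s * front_blocks q n x) \<partial>EX.S)
    \<longlonglongrightarrow> complex_of_real (exp (- (((real q - 1) / real q)\<^sup>2 * s\<^sup>2 / 2)) / sqrt q)"
proof -
  have q0: "real q > 0" using q by simp
  define \<rho> where "\<rho> = (real q - 1) / real q"
  \<comment> \<open>The identity 1 + \<rho> q = q makes the Gaussian average equal to 1 / sqrt q for
    every \<open>s\<close>.\<close>
  have \<rho>: "\<rho> \<ge> 0" "1 + \<rho> * real q = real q" using q by (auto simp: \<rho>_def)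
  define ok where "ok n \<longleftrightarrow> dependent_sequence expm (m n) (G n) (\<lambda>x. (x 0 - 1) / sqrt n) (1 / n)" for n
  \<comment> \<open>\<open>kern_char_limit\<close> asks for measurability in every row, while the
    structure is available eventually; the other rows are set to 0.\<close>
  define T where "T n x = (if ok n then s * front_blocks q n x else 0)" for n x
  have ok: "\<forall>\<^sub>F n in sequentially. ok n" unfolding ok_def by (rule dependent)
  have mT: "T n \<in> borel_measurable seq_borel" for n
  proof (cases "ok n")
    case True
    then interpret D: dependent_sequence expm "m n" "G n" "\<lambda>x. (x 0 - 1) / sqrt n" "1 / n" by (simp add: ok_def)
    have "front_blocks q n \<in> borel_measurable EX.S"
      unfolding front_blocks_def by (rule EX.sqi_measurable[OF D.blocks_sqi])
    with True show ?thesis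
      unfolding T_def by (simp add: measurable_cong_sets[OF sets_seq_expm refl])
  qed (simp add: T_def[abs_def])
  have "(\<lambda>n. \<integral>x. kern n (front q n) x *\<^sub>R iexp (T n x) \<partial>EX.S)
    \<longlonglongrightarrow> complex_of_real (exp (- (\<rho>\<^sup>2 * s\<^sup>2 / 2)) / sqrt (1 + \<rho> * real q))"
  proof (rule kern_char_limit)
    show "\<forall>\<^sub>F n in sequentially. front q n + 2 \<le> n" using front_bounds[OF q] by eventually_elim simp
    show "(\<lambda>n. real n / real (n - front q n - 1)) \<longlonglongrightarrow> real q" by (rule front_ratio_limit[OF q])
    fix u
    have ev: "\<forall>\<^sub>F n in sequentially. (\<integral>x. iexp (T n x + u * (csum (front q n) x / sqrt n)) \<partial>EX.S)
       = (\<integral>x. iexp (s * front_blocks q n x + u * (csum (front q n) x / sqrt n)) \<partial>EX.S)"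
      using ok by eventually_elim (simp add: T_def)
    show "(\<lambda>n. \<integral>x. iexp (T n x + u * (csum (front q n) x / sqrt n)) \<partial>EX.S)
      \<longlonglongrightarrow> complex_of_real (exp (- (\<rho>\<^sup>2 * s\<^sup>2 / 2)) * exp (- (\<rho> * u\<^sup>2 / 2)))"
      unfolding tendsto_cong[OF ev] \<rho>_def by (rule front_blocks_limit[OF q])
  qed (use q0 \<rho> mT in auto)
  moreover have "\<forall>\<^sub>F n in sequentially. (\<integral>x. kern n (front q n) x *\<^sub>R iexp (T n x) \<partial>EX.S)
      = (\<integral>x. kern n (front q n) x *\<^sub>R iexp (s * front_blocks q n x) \<partial>EX.S)"
    using ok by eventually_elim (simp add: T_def)
  ultimately show ?thesis by (simp add: tendsto_cong \<rho>(2) \<rho>_def[symmetric])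
qed

text \<open>The case \<open>s = 0\<close> of the preceding limit is the asymptotics of the
  normalising constant.\<close>

lemma kern_mean_limit:
  assumes q: "q \<ge> 3"
  shows "(\<lambda>n. \<integral>x. kern n (front q n) x \<partial>EX.S) \<longlonglongrightarrow> 1 / sqrt q"
proof -
  have "(\<lambda>n. \<integral>x. complex_of_real (kern n (front q n) x) \<partial>EX.S) \<longlonglongrightarrow> complex_of_real (1 / sqrt q)"
    using kern_blocks_limit[OF q, of 0] by (simp add: scaleR_conv_of_real)
  then have "(\<lambda>n. complex_of_real (\<integral>x. kern n (front q n) x \<partial>EX.S)) \<longlonglongrightarrow> complex_of_real (1 / sqrt q)"
    by (simp only: integral_complex_of_real)
  then show ?thesis by (simp only: tendsto_of_real_iff)
qed

lemma spacing_blocks_limit: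
  assumes q: "q \<ge> 3"
  shows "(\<lambda>n. \<integral>y. iexp (s * front_blocks q n y) \<partial>spacing_law n)
    \<longlonglongrightarrow> complex_of_real (exp (- (((real q - 1) / real q)\<^sup>2 * s\<^sup>2 / 2)))"
proof -
  have "sqrt (real q) > 0" using q by simp
  then have "(\<lambda>n. (\<integral>x. kern n (front q n) x *\<^sub>R iexp (s * front_blocks q n x) \<partial>EX.S) / complex_of_real (\<integral>x. kern n (front q n) x \<partial>EX.S))
    \<longlonglongrightarrow> complex_of_real (exp (- (((real q - 1) / real q)\<^sup>2 * s\<^sup>2 / 2)) / sqrt q) / complex_of_real (1 / sqrt q)"
    by (intro tendsto_divide kern_blocks_limit[OF q] tendsto_of_real kern_mean_limit[OF q]) auto
  moreover have "\<forall>\<^sub>F n in sequentially. (\<integral>x. kern n (front q n) x *\<^sub>R iexp (s * front_blocks q n x) \<partial>EX.S) / complex_of_real (\<integral>x. kern n (front q n) x \<partial>EX.S)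
     = (\<integral>y. iexp (s * front_blocks q n y) \<partial>spacing_law n)"
    using dependent front_bounds[OF q]
  proof eventually_elim
    case (elim n)
    interpret D: dependent_sequence expm "m n" "G n" "\<lambda>x. (x 0 - 1) / sqrt n" "1 / n" by fact
    have "front_blocks q n \<in> borel_measurable EX.S"
      unfolding front_blocks_def by (rule EX.sqi_measurable[OF D.blocks_sqi])
    then have [measurable]: "front_blocks q n \<in> borel_measurable seq_borel"
      by (simp add: measurable_cong_sets[OF sets_seq_expm refl])
    have dep: "dep (front q n) (front_blocks q n)"
      unfolding front_blocks_def front_def by (rule D.blocks_dep)
    show ?case
      using elim by (intro integral_spacing_law[symmetric]) (auto intro: dep_comp[OF dep])
  qed
  ultimately have "(\<lambda>n. \<integral>y. iexp (s * front_blocks q n y) \<partial>spacing_law n)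
    \<longlonglongrightarrow> complex_of_real (exp (- (((real q - 1) / real q)\<^sup>2 * s\<^sup>2 / 2)) / sqrt q) / complex_of_real (1 / sqrt q)"
    by (simp only: tendsto_cong)
  then show ?thesis using \<open>sqrt (real q) > 0\<close> by simp
qed

text \<open>The remainder consists of \<open>gaps\<close> and of the sum from
  \<open>a = front q n - m n\<close> on, whose windows run past the end of the period. Both are
  functions of at most \<open>front q n\<close> consecutive coordinates up to a rotation, so their
  second moments are taken over from the exponentials at the cost of the mean of
  \<open>kern\<close>. The constants 6 and 12 are twice those of \<open>gaps_sq_le\<close>, with K m
  / n \<le> 1 / q.\<close>

lemma remainder_bound:
  assumes q: "q \<ge> 3"
  defines "\<gamma> n \<equiv> (real (m n))\<^sup>2 * (\<integral>x. (G n x)\<^sup>2 \<partial>EX.S)"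
  shows "\<forall>\<^sub>F n in sequentially.
    integrable (spacing_law n) (\<lambda>y. ((\<Sum>k<n. G n (shf k y)) - front_blocks q n y)\<^sup>2) \<and>
    (\<integral>y. ((\<Sum>k<n. G n (shf k y)) - front_blocks q n y)\<^sup>2 \<partial>spacing_law n)
      \<le> (6 / q + 12 * (2 * \<gamma> n + real (m n) / real n)
           + 2 * (2 * \<gamma> n + (1 - real (front q n) / real n + real (m n) / real n))) / (\<integral>x. kern n (front q n) x \<partial>EX.S)"
  using dependent front_bounds[OF q]
proof eventually_elim
  case (elim n)
  interpret D: dependent_sequence expm "m n" "G n" "\<lambda>x. (x 0 - 1) / sqrt n" "1 / n" by fact
  define K where "K = nblocks q n"
  define d where "d = front q n"
  define \<kappa> where "\<kappa> = (\<integral>x. kern n d x \<partial>EX.S)"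
  have n: "real n > 0" "d + 2 \<le> n" "n + 2 * m n \<le> 2 * d" "K \<ge> 1" "m n \<ge> 1" using elim by (auto simp: d_def K_def)
  have \<kappa>: "\<kappa> > 0" unfolding \<kappa>_def by (rule spacing_law_kern(1)) (use n in simp)
  have d: "d = K * q * m n" by (simp add: d_def K_def front_def)
  define a where "a = (K * q - 1) * m n"
  have a: "a + m n = d" using n(4) q by (simp add: a_def d diff_mult_distrib)
  have sumG: "(\<Sum>k<n. G n (shf k y)) = D.gsum a y + D.gsum (n - a) (shf a y)" for y
  proof -
    have "(\<Sum>k<n. G n (shf k y)) = (\<Sum>k<a. G n (shf k y)) + (\<Sum>k=a..<n. G n (shf k y))"
      using sum.atLeastLessThan_concat[of 0 a n "\<lambda>k. G n (shf k y)"] a n by (simp add: lessThan_atLeast0)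
    also have "(\<Sum>k=a..<n. G n (shf k y)) = (\<Sum>k<n - a. G n (shf (a + k) y))"
      by (rule sum.reindex_bij_witness[of _ "\<lambda>k. a + k" "\<lambda>k. k - a"]) auto
    finally show ?thesis by (simp add: D.gsum_def add.commute)
  qed
  have decomp: "D.gsum a y = front_blocks q n y + D.gaps q K y" for y
    unfolding a_def front_blocks_def K_def[symmetric] by (rule D.gsum_decomp) (use n q in auto)
  have rem: "(\<Sum>k<n. G n (shf k y)) - front_blocks q n y = D.gaps q K y + D.gsum (n - a) (shf a y)" for y
    by (simp add: sumG decomp)
  have gd: "dep d (D.gaps q K)" unfolding d by (rule D.gaps_dep) (use n q in auto)
  \<comment> \<open>The sum uses fewer than n - a + m coordinates, and with a = d - m this is n - d
    + 2 m \<le> d.\<close>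
  have sd: "dep d (D.gsum (n - a))" by (rule D.gsum_dep) (use n a in linarith)
  have gm [measurable]: "D.gaps q K \<in> borel_measurable seq_borel" "D.gsum (n - a) \<in> borel_measurable seq_borel"
    using EX.sqi_measurable[OF D.gaps_sqi[of q K]] EX.sqi_measurable[OF D.gsum_sqi[of "n - a"]]
    by (simp_all add: measurable_cong_sets[OF sets_seq_expm refl])
  note g2 = spacing_law_second_moment[OF n(2) gm(1) gd EX.sqi_integrable_sq[OF D.gaps_sqi], of 0, simplified]
  note s2 = spacing_law_second_moment[OF n(2) gm(2) sd EX.sqi_integrable_sq[OF D.gsum_sqi], of a]
  have sq: "(x + y)\<^sup>2 \<le> 2 * x\<^sup>2 + 2 * y\<^sup>2" for x y :: real
    using sum_squares_bound[of x y] by (simp add: power2_sum)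
  have ib: "integrable (spacing_law n) (\<lambda>y. 2 * (D.gaps q K y)\<^sup>2 + 2 * (D.gsum (n - a) (shf a y))\<^sup>2)"
    using g2(1) s2(1) by simp
  have i: "integrable (spacing_law n) (\<lambda>y. ((\<Sum>k<n. G n (shf k y)) - front_blocks q n y)\<^sup>2)"
    unfolding rem
  proof (rule Bochner_Integration.integrable_bound[OF ib])
    show "AE y in spacing_law n. norm ((D.gaps q K y + D.gsum (n - a) (shf a y))\<^sup>2)
      \<le> norm (2 * (D.gaps q K y)\<^sup>2 + 2 * (D.gsum (n - a) (shf a y))\<^sup>2)"
      using sq by (intro AE_I2) simp
  qed measurable
  have "(\<integral>y. ((\<Sum>k<n. G n (shf k y)) - front_blocks q n y)\<^sup>2 \<partial>spacing_law n)
    \<le> (\<integral>y. 2 * (D.gaps q K y)\<^sup>2 + 2 * (D.gsum (n - a) (shf a y))\<^sup>2 \<partial>spacing_law n)"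
    by (rule integral_mono[OF i ib]) (simp only: rem sq)
  also have "\<dots> = 2 * (\<integral>y. (D.gaps q K y)\<^sup>2 \<partial>spacing_law n) + 2 * (\<integral>y. (D.gsum (n - a) (shf a y))\<^sup>2 \<partial>spacing_law n)"
    using g2(1) s2(1) by simp
  also have "\<dots> \<le> 2 * ((\<integral>x. (D.gaps q K x)\<^sup>2 \<partial>EX.S) / \<kappa>) + 2 * ((\<integral>x. (D.gsum (n - a) x)\<^sup>2 \<partial>EX.S) / \<kappa>)"
    using g2(2) s2(2) unfolding \<kappa>_def by (intro add_mono mult_left_mono) auto
  also have "\<dots> = (2 * (\<integral>x. (D.gaps q K x)\<^sup>2 \<partial>EX.S) + 2 * (\<integral>x. (D.gsum (n - a) x)\<^sup>2 \<partial>EX.S)) / \<kappa>"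
    by (simp add: add_divide_distrib)
  also have "\<dots> \<le> (6 / q + 12 * (2 * \<gamma> n + real (m n) / real n)
           + 2 * (2 * \<gamma> n + (1 - real d / real n + real (m n) / real n))) / \<kappa>"
  proof (rule divide_right_mono)
    have g: "(\<integral>x. (D.gaps q K x)\<^sup>2 \<partial>EX.S) \<le> 3 * (K * (m n * (1 / n))) + 6 * (2 * \<gamma> n + m n * (1 / n))"
      unfolding \<gamma>_def using D.gaps_sq_le[of q K] q by (simp add: D.gvar_def mult.assoc)
    have "real K * (real (m n) * (1 / real n)) \<le> 1 / q"
    proof -
      have "real (K * q * m n) \<le> real n" unfolding d[symmetric] using n(2) by simp
      then have "real K * real (m n) * real q \<le> real n" by (simp add: ac_simps)
      then show ?thesis using n(1) q by (simp add: divide_simps)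
    qed
    moreover have s: "(\<integral>x. (D.gsum (n - a) x)\<^sup>2 \<partial>EX.S) \<le> 2 * \<gamma> n + real (n - a) * (1 / n)"
      unfolding \<gamma>_def using D.integral_gsum_sq_le[of "n - a"] by (simp add: D.gvar_def mult.assoc)
    moreover have "real (n - a) * (1 / n) = 1 - real d / real n + real (m n) / real n"
    proof -
      have "real (n - a) = real n - real d + real (m n)" using a n by linarith
      then show ?thesis using n(1) by (simp add: add_divide_distrib diff_divide_distrib)
    qed
    ultimately show "2 * (\<integral>x. (D.gaps q K x)\<^sup>2 \<partial>EX.S) + 2 * (\<integral>x. (D.gsum (n - a) x)\<^sup>2 \<partial>EX.S)
      \<le> 6 / q + 12 * (2 * \<gamma> n + real (m n) / real n)
           + 2 * (2 * \<gamma> n + (1 - real d / real n + real (m n) / real n))"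
      using g by simp
  qed (use \<kappa> in simp)
  finally show ?case using i unfolding \<kappa>_def d_def by blast
qed

end

context spacing_array
begin

lemma measurable_G:
  assumes "dependent_sequence expm (m n) (G n) (\<lambda>x. (x 0 - 1) / sqrt n) (1 / n)"
  shows "G n \<in> borel_measurable seq_borel"
proof -
  interpret D: dependent_sequence expm "m n" "G n" "\<lambda>x. (x 0 - 1) / sqrt n" "1 / n" by fact
  have "G n \<in> borel_measurable EX.S" by (rule EX.sqi_measurable[OF D.g_sqi])
  then show ?thesis by (simp add: measurable_cong_sets[OF sets_seq_expm refl])
qed

text \<open>A double limit: for fixed q the blocks converge and the remainder stays of size 8 / sqrt
  q in mean square as n grows; then q is taken large.\<close>

lemma spacing_sum_char_limit:
  "(\<lambda>n. \<integral>y. iexp (s * (\<Sum>k<n. G n (shf k y))) \<partial>spacing_law n) \<longlonglongrightarrow> complex_of_real (exp (- (s\<^sup>2 / 2)))"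
proof -
  define F where "F n = (\<integral>y. iexp (s * (\<Sum>k<n. G n (shf k y))) \<partial>spacing_law n)" for n
  define L where "L = complex_of_real (exp (- (s\<^sup>2 / 2)))"
  define Lq where "Lq q = complex_of_real (exp (- (((real q - 1) / real q)\<^sup>2 * s\<^sup>2 / 2)))" for q :: nat
  \<comment> \<open>The error that remains for fixed q as n grows: the root of the limiting
    remainder, plus the distance between the limit of the blocks and the standard normal
    characteristic function.\<close>
  define \<eta> where "\<eta> q = \<bar>s\<bar> * sqrt (8 / sqrt (real q)) + cmod (Lq q - L)" for q
  have r1: "(\<lambda>q. (real q - 1) / real q) \<longlonglongrightarrow> 1"
  proof -
    have "(\<lambda>q. 1 - 1 / real q) \<longlonglongrightarrow> 1 - 0" by (intro tendsto_intros lim_1_over_n)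
    moreover have "\<forall>\<^sub>F q in sequentially. 1 - 1 / real q = (real q - 1) / real q"
      using eventually_gt_at_top[of 0] by eventually_elim (simp add: diff_divide_distrib)
    ultimately show ?thesis by (simp add: tendsto_cong)
  qed
  have "(\<lambda>q. Lq q) \<longlonglongrightarrow> complex_of_real (exp (- (1\<^sup>2 * s\<^sup>2 / 2)))"
    unfolding Lq_def by (intro tendsto_intros r1) auto
  then have "Lq \<longlonglongrightarrow> L" by (simp add: L_def)
  then have "(\<lambda>q. cmod (Lq q - L)) \<longlonglongrightarrow> 0"
    by (rule tendsto_norm_zero[OF LIM_zero])
  moreover have "(\<lambda>q. 8 / sqrt (real q)) \<longlonglongrightarrow> 0"
    by (rule tendsto_divide_0[OF tendsto_const])
      (auto intro!: filterlim_at_top_imp_at_infinity filterlim_compose[OF sqrt_at_top] filterlim_real_sequentially)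
  then have "(\<lambda>q. \<bar>s\<bar> * sqrt (8 / sqrt (real q))) \<longlonglongrightarrow> \<bar>s\<bar> * sqrt 0"
    by (intro tendsto_intros)
  ultimately have \<eta>: "\<eta> \<longlonglongrightarrow> 0"
    unfolding \<eta>_def[abs_def] by (auto intro: tendsto_add_zero)
  have "(\<lambda>n. cmod (F n - L)) \<longlonglongrightarrow> 0"
  proof (rule tendsto_zeroI_eps)
    fix \<epsilon> :: real assume \<epsilon>: "\<epsilon> > 0"
    then have "\<forall>\<^sub>F q in sequentially. \<eta> q < \<epsilon>" using \<eta> by (intro order_tendstoD) auto
    then have "\<forall>\<^sub>F q in sequentially. \<eta> q < \<epsilon> \<and> q \<ge> 3"
      using eventually_ge_at_top[of 3] by eventually_elim simp
    then obtain q where q: "\<eta> q < \<epsilon>" "q \<ge> 3"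
      using eventually_happens'[OF sequentially_bot] by blast
    have q0: "real q > 0" "sqrt (real q) > 0" using q by auto
    define \<gamma> where "\<gamma> n = (real (m n))\<^sup>2 * (\<integral>x. (G n x)\<^sup>2 \<partial>EX.S)" for n
    define b where "b n = (6 / q + 12 * (2 * \<gamma> n + real (m n) / real n)
           + 2 * (2 * \<gamma> n + (1 - real (front q n) / real n + real (m n) / real n))) / (\<integral>x. kern n (front q n) x \<partial>EX.S)" for n
    have \<gamma>: "\<gamma> \<longlonglongrightarrow> 0" unfolding \<gamma>_def[abs_def] by (rule gvar_limit)
    have fl: "(\<lambda>n. real (front q n) / real n) \<longlonglongrightarrow> (real q - 1) / real q"
      using q by (intro front_limit) simp
    \<comment> \<open>The gaps leave 6 / q, the tail leaves 2 (1 - \<rho>) = 2 / q, and dividing by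
      the mean of \<open>kern\<close> multiplies by sqrt q.\<close>
    have "b \<longlonglongrightarrow> (6 / q + 12 * (2 * 0 + 0) + 2 * (2 * 0 + (1 - (real q - 1) / real q + 0))) / (1 / sqrt q)"
      unfolding b_def[abs_def] using q0
      by (intro tendsto_intros \<gamma> m_small fl kern_mean_limit[OF q(2)]) auto
    also have "(6 / q + 12 * (2 * 0 + 0) + 2 * (2 * 0 + (1 - (real q - 1) / real q + 0))) / (1 / sqrt q) = 8 / sqrt q"
    proof -
      have "1 - (real q - 1) / real q = 1 / real q" using q0 by (simp add: field_simps)
      then have "(6 / q + 12 * (2 * 0 + 0) + 2 * (2 * 0 + (1 - (real q - 1) / real q + 0))) / (1 / sqrt q) = 8 * (sqrt q / q)"
        by simp
      also have "sqrt q / q = 1 / sqrt q" by (rule sqrt_divide_self_eq[THEN trans]) (simp_all add: inverse_eq_divide)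
      finally show ?thesis by simp
    qed
    finally have b: "b \<longlonglongrightarrow> 8 / sqrt q" .
    have "(\<lambda>n. \<bar>s\<bar> * sqrt (b n) + cmod ((\<integral>y. iexp (s * front_blocks q n y) \<partial>spacing_law n) - L))
       \<longlonglongrightarrow> \<bar>s\<bar> * sqrt (8 / sqrt q) + cmod (Lq q - L)"
      unfolding Lq_def by (intro tendsto_intros b spacing_blocks_limit[OF q(2)])
    then have "\<forall>\<^sub>F n in sequentially. \<bar>s\<bar> * sqrt (b n) + cmod ((\<integral>y. iexp (s * front_blocks q n y) \<partial>spacing_law n) - L) < \<epsilon>"
      using q(1) by (intro order_tendstoD) (auto simp: \<eta>_def)
    then show "\<forall>\<^sub>F n in sequentially. cmod (F n - L) < \<epsilon>"
      using remainder_bound[OF q(2)] dependent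
    proof eventually_elim
      case (elim n)
      interpret D: dependent_sequence expm "m n" "G n" "\<lambda>x. (x 0 - 1) / sqrt n" "1 / n" by fact
      interpret Sp: prob_space "spacing_law n" by (rule prob_space_spacing_law)
      have [measurable]: "G n \<in> borel_measurable seq_borel" by (rule measurable_G) fact
      have "front_blocks q n \<in> borel_measurable EX.S"
        unfolding front_blocks_def by (rule EX.sqi_measurable[OF D.blocks_sqi])
      then have [measurable]: "front_blocks q n \<in> borel_measurable seq_borel"
        by (simp add: measurable_cong_sets[OF sets_seq_expm refl])
      define R where "R y = (\<Sum>k<n. G n (shf k y)) - front_blocks q n y" for y
      have R: "integrable (spacing_law n) (\<lambda>y. (R y)\<^sup>2)" "(\<integral>y. (R y)\<^sup>2 \<partial>spacing_law n) \<le> b n"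
        using elim(2) unfolding R_def b_def \<gamma>_def by auto
      have eq: "(s * (\<Sum>k<n. G n (shf k y)) - s * front_blocks q n y)\<^sup>2 = s\<^sup>2 * (R y)\<^sup>2" for y
        by (simp add: R_def right_diff_distrib[symmetric] power_mult_distrib)
      have "cmod (F n - (\<integral>y. iexp (s * front_blocks q n y) \<partial>spacing_law n))
        \<le> sqrt (\<integral>y. (s * (\<Sum>k<n. G n (shf k y)) - s * front_blocks q n y)\<^sup>2 \<partial>spacing_law n)"
        unfolding F_def using R(1) by (intro Sp.integral_iexp_diff_le) (simp_all add: eq)
      also have "\<dots> = sqrt (s\<^sup>2 * (\<integral>y. (R y)\<^sup>2 \<partial>spacing_law n))" by (simp add: eq)
      also have "\<dots> \<le> sqrt (s\<^sup>2 * b n)" using R(2) by (intro real_sqrt_le_mono mult_left_mono) auto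
      also have "\<dots> = \<bar>s\<bar> * sqrt (b n)" by (simp add: real_sqrt_mult)
      finally have "cmod (F n - (\<integral>y. iexp (s * front_blocks q n y) \<partial>spacing_law n)) \<le> \<bar>s\<bar> * sqrt (b n)" .
      moreover have "cmod (F n - L) \<le> cmod (F n - (\<integral>y. iexp (s * front_blocks q n y) \<partial>spacing_law n))
         + cmod ((\<integral>y. iexp (s * front_blocks q n y) \<partial>spacing_law n) - L)"
        by (rule order_trans[OF _ norm_triangle_ineq]) simp
      ultimately show ?case using elim(1) by linarith
    qed
  qed simp
  then have "F \<longlonglongrightarrow> L" by (rule LIM_zero_cancel[OF tendsto_norm_zero_cancel])
  then show ?thesis by (simp add: F_def[abs_def] L_def)
qed

text \<open>For windows of length \<open>2 * m n\<close> the fixed choice q = 3 is enough. The mean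
  of the kernel then tends to 1 / sqrt 3 > 1 / 2, which gives the factor 2.\<close>

lemma spacing_second_moment_le:
  "\<forall>\<^sub>F n in sequentially. \<forall>(f :: (nat \<Rightarrow> real) \<Rightarrow> real) a. f \<in> borel_measurable seq_borel \<longrightarrow> dep (2 * m n) f \<longrightarrow> integrable EX.S (\<lambda>x. (f x)\<^sup>2) \<longrightarrow>
    integrable (spacing_law n) (\<lambda>y. (f (shf a y))\<^sup>2) \<and>
    (\<integral>y. (f (shf a y))\<^sup>2 \<partial>spacing_law n) \<le> 2 * (\<integral>x. (f x)\<^sup>2 \<partial>EX.S)"
proof -
  have "1 / sqrt (real 3) > 1 / 2"
  proof -
    have "sqrt (real 3) < sqrt 4" by (rule real_sqrt_less_mono) simp
    then show ?thesis by (simp add: divide_simps)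
  qed
  then have "\<forall>\<^sub>F n in sequentially. (\<integral>x. kern n (front 3 n) x \<partial>EX.S) > 1 / 2"
    using kern_mean_limit[of 3] by (intro order_tendstoD) auto
  with front_bounds[of 3, simplified] show ?thesis
  proof eventually_elim
    case (elim n)
    define \<kappa> where "\<kappa> = (\<integral>x. kern n (front 3 n) x \<partial>EX.S)"
    have \<kappa>: "\<kappa> > 1 / 2" using elim by (simp add: \<kappa>_def)
    show ?case
    proof (intro allI impI conjI)
      fix f :: "(nat \<Rightarrow> real) \<Rightarrow> real" and a
      assume f: "f \<in> borel_measurable seq_borel" "dep (2 * m n) f" "integrable EX.S (\<lambda>x. (f x)\<^sup>2)"
      have d: "front 3 n + 2 \<le> n" "2 * m n \<le> front 3 n" using elim by linarith+
      note * = spacing_law_second_moment[OF d(1) f(1) dep_mono[OF f(2) d(2)] f(3), of a]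
      show "integrable (spacing_law n) (\<lambda>y. (f (shf a y))\<^sup>2)" by (rule *(1))
      have "(\<integral>y. (f (shf a y))\<^sup>2 \<partial>spacing_law n) \<le> (\<integral>x. (f x)\<^sup>2 \<partial>EX.S) / \<kappa>"
        unfolding \<kappa>_def by (rule *(2))
      also have "\<dots> \<le> (\<integral>x. (f x)\<^sup>2 \<partial>EX.S) / (1 / 2)"
        using \<kappa> by (intro divide_left_mono) auto
      finally show "(\<integral>y. (f (shf a y))\<^sup>2 \<partial>spacing_law n) \<le> 2 * (\<integral>x. (f x)\<^sup>2 \<partial>EX.S)" by simp
    qed
  qed
qed

text \<open>The part governed by \<open>g\<close> of the last \<open>m\<close> terms, by which the
  two statistics differ. These windows cross the end of the period, and rotation turns their sum
  into an ordinary block sum.\<close>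

lemma edge_sum_limit:
  "\<exists>b. b \<longlonglongrightarrow> 0 \<and> (\<forall>\<^sub>F n in sequentially.
    integrable (spacing_law n) (\<lambda>y. (\<Sum>k<m n. G n (shf k (shf (n - m n) y)))\<^sup>2) \<and>
    (\<integral>y. (\<Sum>k<m n. G n (shf k (shf (n - m n) y)))\<^sup>2 \<partial>spacing_law n) \<le> b n)"
proof -
  define b where "b n = 2 * (2 * ((real (m n))\<^sup>2 * (\<integral>x. (G n x)\<^sup>2 \<partial>EX.S)) + real (m n) / real n)" for n
  have "(\<lambda>n. 2 * (2 * ((real (m n))\<^sup>2 * (\<integral>x. (G n x)\<^sup>2 \<partial>EX.S)) + real (m n) / real n)) \<longlonglongrightarrow> 2 * (2 * 0 + 0)"
    by (intro tendsto_intros gvar_limit m_small)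
  then have "b \<longlonglongrightarrow> 0" by (simp add: b_def[abs_def])
  moreover have "\<forall>\<^sub>F n in sequentially.
    integrable (spacing_law n) (\<lambda>y. (\<Sum>k<m n. G n (shf k (shf (n - m n) y)))\<^sup>2) \<and>
    (\<integral>y. (\<Sum>k<m n. G n (shf k (shf (n - m n) y)))\<^sup>2 \<partial>spacing_law n) \<le> b n"
    using spacing_second_moment_le dependent
  proof eventually_elim
    case (elim n)
    interpret D: dependent_sequence expm "m n" "G n" "\<lambda>x. (x 0 - 1) / sqrt n" "1 / n" by fact
    have m1: "D.gsum (m n) \<in> borel_measurable seq_borel"
      using EX.sqi_measurable[OF D.gsum_sqi[of "m n"]] by (simp add: measurable_cong_sets[OF sets_seq_expm refl])
    have d1: "dep (2 * m n) (D.gsum (m n))" using D.m_pos by (intro D.gsum_dep) simp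
    have i1: "integrable EX.S (\<lambda>x. (D.gsum (m n) x)\<^sup>2)" by (rule EX.sqi_integrable_sq[OF D.gsum_sqi])
    note * = elim(1)[rule_format, OF m1 d1 i1, of "n - m n"]
    have "2 * (\<integral>x. (D.gsum (m n) x)\<^sup>2 \<partial>EX.S) \<le> b n"
      using D.integral_gsum_sq_le[of "m n"] by (simp add: b_def D.gvar_def)
    with * show ?case unfolding D.gsum_def by auto
  qed
  ultimately show ?thesis by blast
qed

lemma edge_csum:
  "\<forall>\<^sub>F n in sequentially.
    integrable (spacing_law n) (\<lambda>y. (csum (m n) (shf (n - m n) y))\<^sup>2) \<and>
    (\<integral>y. (csum (m n) (shf (n - m n) y))\<^sup>2 \<partial>spacing_law n) \<le> 2 * real (m n)"
  using spacing_second_moment_le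
proof eventually_elim
  case (elim n)
  have d1: "dep (2 * m n) (csum (m n))" by (rule dep_mono[OF dep_csum]) simp
  have i1: "integrable EX.S (\<lambda>x. (csum (m n) x)\<^sup>2)" "(\<integral>x. (csum (m n) x)\<^sup>2 \<partial>EX.S) = m n"
    using csum_moments[of "m n"] by auto
  show ?case using elim[rule_format, OF measurable_csum d1 i1(1), of "n - m n"] by (simp add: i1(2))
qed

end

section \<open>The covariances of the block function\<close>

lemma inj_rotation: "inj (\<lambda>i::nat. if i < n then (i + l) mod n else i)"
proof (rule injI)
  fix i j assume eq: "(if i < n then (i + l) mod n else i) = (if j < n then (j + l) mod n else j)"
  show "i = j"
  proof (cases "i < n \<and> j < n")
    case True
    then have "[i + l = j + l] (mod n)" using eq by (simp add: cong_def)
    then have "[i = j] (mod n)" by (simp add: cong_add_rcancel_nat)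
    then show ?thesis using True by (simp add: cong_def)
  next
    case False
    have "(k + l) mod n < n" if "k < n" for k using that by simp
    then show ?thesis using False eq by (auto split: if_splits)
  qed
qed

definition hseq :: "nat \<Rightarrow> ((nat \<Rightarrow> real) \<Rightarrow> real) \<Rightarrow> (nat \<Rightarrow> real) \<Rightarrow> real" where
  "hseq m h x = h (\<lambda>i\<in>{..<m}. x i)"

lemma measurable_hseq:
  assumes "h \<in> borel_measurable (\<Pi>\<^sub>M i\<in>{..<m}. borel)"
  shows "hseq m h \<in> borel_measurable seq_borel"
proof -
  have "(\<lambda>x. \<lambda>i\<in>{..<m}. x i) \<in> seq_borel \<rightarrow>\<^sub>M (\<Pi>\<^sub>M i\<in>{..<m}. borel :: real measure)"
    by (rule measurable_restrict) simp
  then show ?thesis unfolding hseq_def[abs_def] by (rule measurable_compose[OF _ assms])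
qed

lemma dep_hseq: "dep m (hseq m h)"
proof (rule depI)
  fix x y :: "nat \<Rightarrow> real" assume "\<And>i. i < m \<Longrightarrow> x i = y i"
  then have "(\<lambda>i\<in>{..<m}. x i) = (\<lambda>i\<in>{..<m}. y i)" by (auto simp: restrict_def)
  then show "hseq m h x = hseq m h y" by (simp add: hseq_def)
qed

lemma block_shf:
  assumes "j + m \<le> n"
  shows "h (block n m X (int j) \<omega>) = hseq m h (shf j (\<lambda>i. X i \<omega>))"
proof -
  have "nat ((int j + int i) mod int n) = j + i" if "i < m" for i
    using that assms by (simp flip: of_nat_add of_nat_mod)
  then have "block n m X (int j) \<omega> = (\<lambda>i\<in>{..<m}. shf j (\<lambda>i. X i \<omega>) i)"
    unfolding block_def shf_def by (auto simp: restrict_def)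
  then show ?thesis by (simp add: hseq_def)
qed

text \<open>The coordinates at the negative index \<open>-l\<close> are \<open>n - l, \<dots>, n - 1, 0, 1, \<dots>\<close>.\<close>
definition rot :: "nat \<Rightarrow> nat \<Rightarrow> nat \<Rightarrow> nat" where
  "rot n l i = (if i < n then (i + l) mod n else i)"

text \<open>Rotating by \<open>l\<close> turns the blocks at 0 and -l into those at l and 0. The
  rotation preserves the law, so the covariance at -l equals that at l; \<open>l + m \<le> n\<close>
  prevents the rotated windows from crossing the end of the period.\<close>

lemma block_rot:
  assumes "l + m \<le> n" "l \<le> n" "m \<ge> 1"
  shows "h (block n m (\<lambda>i x. x (rot n l i)) (- int l) x) = hseq m h x"
    and "h (block n m (\<lambda>i x. x (rot n l i)) 0 x) = hseq m h (shf l x)"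
proof -
  have n: "n > 0" using assms by simp
  have "rot n l (nat ((- int l + int i) mod int n)) = i" if "i < m" for i
  proof -
    have "int (nat ((- int l + int i) mod int n)) = (int i - int l) mod int n"
      using n by simp
    moreover have "nat ((- int l + int i) mod int n) < n"
      using n by (simp add: nat_less_iff)
    ultimately have "int (rot n l (nat ((- int l + int i) mod int n))) = ((int i - int l) mod int n + int l) mod int n"
      by (simp add: rot_def zmod_int)
    also have "\<dots> = int i mod int n" by (simp add: mod_simps)
    also have "\<dots> = int i" using that assms by simp
    finally show ?thesis by simp
  qed
  then have "block n m (\<lambda>i x. x (rot n l i)) (- int l) x = (\<lambda>i\<in>{..<m}. x i)"
    unfolding block_def by (auto simp: restrict_def)
  then show "h (block n m (\<lambda>i x. x (rot n l i)) (- int l) x) = hseq m h x"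
    by (simp add: hseq_def)
  have "rot n l (nat ((0 + int i) mod int n)) = l + i" if "i < m" for i
    using that assms by (simp add: rot_def add.commute flip: of_nat_mod)
  then have "block n m (\<lambda>i x. x (rot n l i)) 0 x = (\<lambda>i\<in>{..<m}. shf l x i)"
    unfolding block_def shf_def by (auto simp: restrict_def)
  then show "h (block n m (\<lambda>i x. x (rot n l i)) 0 x) = hseq m h (shf l x)"
    by (simp add: hseq_def)
qed

lemma sum_symmetric_int:
  fixes f :: "int \<Rightarrow> real"
  assumes "m \<ge> 1"
  shows "(\<Sum>j\<in>{- int m + 1..int m - 1}. f j) = f 0 + (\<Sum>l=1..m-1. f (int l) + f (- int l))"
proof -
  have "{- int m + 1..int m - 1} = insert 0 (int ` {1..m-1} \<union> (\<lambda>l. - int l) ` {1..m-1})"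
  proof (intro set_eqI iffI)
    fix j assume j: "j \<in> {- int m + 1..int m - 1}"
    consider "j = 0" | "j > 0" | "j < 0" by linarith
    then show "j \<in> insert 0 (int ` {1..m-1} \<union> (\<lambda>l. - int l) ` {1..m-1})"
    proof cases
      case 2
      then have "j = int (nat j)" "nat j \<in> {1..m-1}" using j by auto
      then show ?thesis by blast
    next
      case 3
      then have "j = - int (nat (- j))" "nat (- j) \<in> {1..m-1}" using j by auto
      then show ?thesis by blast
    qed simp
  qed (use assms in auto)
  then have "(\<Sum>j\<in>{- int m + 1..int m - 1}. f j) = f 0 + (\<Sum>j\<in>int ` {1..m-1} \<union> (\<lambda>l. - int l) ` {1..m-1}. f j)"
    by (simp only:) (rule sum.insert, auto)
  also have "(\<Sum>j\<in>int ` {1..m-1} \<union> (\<lambda>l. - int l) ` {1..m-1}. f j)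
    = (\<Sum>j\<in>int ` {1..m-1}. f j) + (\<Sum>j\<in>(\<lambda>l. - int l) ` {1..m-1}. f j)"
    by (rule sum.union_disjoint) auto
  also have "(\<Sum>j\<in>int ` {1..m-1}. f j) = (\<Sum>l=1..m-1. f (int l))"
    by (subst sum.reindex) (auto simp: inj_on_def)
  also have "(\<Sum>j\<in>(\<lambda>l. - int l) ` {1..m-1}. f j) = (\<Sum>l=1..m-1. f (- int l))"
    by (subst sum.reindex) (auto simp: inj_on_def)
  finally show ?thesis by (simp add: sum.distrib)
qed

section \<open>The corrected function and its covariances\<close>

locale block_function =
  fixes m :: nat and h :: "(nat \<Rightarrow> real) \<Rightarrow> real"
  assumes m_pos: "m \<ge> 1"
    and h_meas: "h \<in> borel_measurable (\<Pi>\<^sub>M i\<in>{..<m}. borel)"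
    and h_sq: "integrable EX.S (\<lambda>x. (hseq m h x)\<^sup>2)"
begin

definition \<mu> :: real where "\<mu> = (\<integral>x. hseq m h x \<partial>EX.S)"
definition hc :: "(nat \<Rightarrow> real) \<Rightarrow> real" where "hc x = hseq m h x - \<mu>"
definition z :: "(nat \<Rightarrow> real) \<Rightarrow> real" where "z x = x 0 - 1"
definition c :: real where "c = (\<integral>x. hc x * csum m x \<partial>EX.S)"
text \<open>The correction acts on a single coordinate. Over a whole period its shifts add up to a
  multiple of the coordinate sum minus \<open>n\<close>, which vanishes for spacings, so the
  statistic does not change.\<close>

definition g :: "(nat \<Rightarrow> real) \<Rightarrow> real" where "g x = hc x - z x * c"

lemma hseq_measurable: "hseq m h \<in> borel_measurable seq_borel"
  by (rule measurable_hseq[OF h_meas])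

lemma hseq_sqi: "EX.sqi (hseq m h)"
  unfolding EX.sqi_def using hseq_measurable h_sq by simp

lemma hc_sqi: "EX.sqi hc"
  unfolding hc_def[abs_def] by (intro EX.sqi_minus hseq_sqi EX.sqi_const)

lemma hc_dep: "dep m hc"
  unfolding hc_def[abs_def] by (rule dep_comp[OF dep_hseq])

lemma hc_mean: "(\<integral>x. hc x \<partial>EX.S) = 0"
  using EX.sqi_integrable[OF hseq_sqi] by (simp add: hc_def \<mu>_def EX.P.prob_space[simplified])

lemma z_sqi: "EX.sqi z"
  unfolding EX.sqi_def z_def using expm_centred_moments(3) by simp

lemma z_dep: "dep 1 z"
  by (rule depI) (simp add: z_def)

lemma z_mean: "(\<integral>x. z x \<partial>EX.S) = 0"
  unfolding z_def by (rule expm_centred_moments(2))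

lemma z_var: "(\<integral>x. z x * z x \<partial>EX.S) = 1"
  using expm_centred_moments(4) by (simp add: z_def power2_eq_square)

lemma csum_eq: "csum m x = (\<Sum>j<m. z (shf j x))"
  by (simp add: csum_def z_def shf_def)

lemma c_eq: "c = (\<Sum>j<m. \<integral>x. hc x * z (shf j x) \<partial>EX.S)"
  unfolding c_def csum_eq sum_distrib_left
  by (rule Bochner_Integration.integral_sum) (intro EX.sqi_integrable_mult hc_sqi EX.sqi_shf z_sqi)

lemma c_split: "c = (\<integral>x. hc x * z x \<partial>EX.S) + (\<Sum>j=1..m-1. \<integral>x. hc x * z (shf j x) \<partial>EX.S)"
proof -
  have "{..<m} = insert 0 {1..m-1}" using m_pos by auto
  then show ?thesis unfolding c_eq by (simp only:) (subst sum.insert, auto)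
qed

lemma g_sqi: "EX.sqi g"
  unfolding g_def[abs_def] using EX.sqi_cmult[OF z_sqi, of c]
  by (intro EX.sqi_minus hc_sqi) (simp add: mult.commute)

lemma g_dep: "dep m g"
  unfolding g_def[abs_def] using dep_mono[OF z_dep m_pos] by (rule dep_comp2[OF hc_dep])

lemma g_mean: "(\<integral>x. g x \<partial>EX.S) = 0"
  using EX.sqi_integrable[OF hc_sqi] EX.sqi_integrable[OF z_sqi]
  by (simp add: g_def hc_mean z_mean)

lemma z_z_shf: "j \<ge> 1 \<Longrightarrow> (\<integral>x. z x * z (shf j x) \<partial>EX.S) = 0"
  using EX.integral_mult_far[OF z_sqi z_sqi z_dep, of j] by (simp add: z_mean)

lemma z_hc_shf: "j \<ge> 1 \<Longrightarrow> (\<integral>x. z x * hc (shf j x) \<partial>EX.S) = 0"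
  using EX.integral_mult_far[OF z_sqi hc_sqi z_dep, of j] by (simp add: z_mean)

lemma g_z: "(\<integral>x. g x * z (shf j x) \<partial>EX.S) = (\<integral>x. hc x * z (shf j x) \<partial>EX.S) - c * (\<integral>x. z x * z (shf j x) \<partial>EX.S)"
proof -
  have "(\<integral>x. g x * z (shf j x) \<partial>EX.S) = (\<integral>x. hc x * z (shf j x) - c * (z x * z (shf j x)) \<partial>EX.S)"
    by (simp add: g_def algebra_simps)
  also have "\<dots> = (\<integral>x. hc x * z (shf j x) \<partial>EX.S) - c * (\<integral>x. z x * z (shf j x) \<partial>EX.S)"
    by (simp add: EX.sqi_integrable_mult EX.sqi_shf hc_sqi z_sqi)
  finally show ?thesis .
qed

text \<open>The covariance of \<open>hc\<close> with the coordinate sum is \<open>c\<close>, and so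
  is that of the correction, as only lag 0 contributes and \<open>z\<close> has variance 1.\<close>

lemma g_csum: "(\<integral>x. g x * (\<Sum>j<m. z (shf j x)) \<partial>EX.S) = 0"
proof -
  have "(\<integral>x. g x * (\<Sum>j<m. z (shf j x)) \<partial>EX.S) = (\<Sum>j<m. \<integral>x. g x * z (shf j x) \<partial>EX.S)"
    by (simp add: sum_distrib_left EX.sqi_integrable_mult EX.sqi_shf g_sqi z_sqi)
  also have "\<dots> = c - c * (\<Sum>j<m. \<integral>x. z x * z (shf j x) \<partial>EX.S)"
    by (simp add: g_z sum_subtractf c_eq[symmetric] sum_distrib_left)
  also have "(\<Sum>j<m. \<integral>x. z x * z (shf j x) \<partial>EX.S) = (\<Sum>j<m. if j = 0 then 1 else 0)"
    by (intro sum.cong) (auto simp: z_z_shf z_var)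
  also have "\<dots> = 1" using m_pos by simp
  finally show ?thesis by simp
qed

text \<open>The cross terms of \<open>hc\<close> with later coordinates add up to -2 c^2 over all
  lags, the square of the correction gives c^2, and the cross terms of \<open>z\<close> with later
  shifts of \<open>hc\<close> or \<open>z\<close> vanish by independence. This leaves -c^2, the term
  in the definition of \<sigma>^2.\<close>

lemma g_long_run:
  "(\<integral>x. (g x)\<^sup>2 \<partial>EX.S) + 2 * (\<Sum>j=1..m-1. \<integral>x. g x * g (shf j x) \<partial>EX.S)
    = (\<integral>x. hc x * hc x \<partial>EX.S) + 2 * (\<Sum>j=1..m-1. \<integral>x. hc x * hc (shf j x) \<partial>EX.S) - c\<^sup>2"
proof -
  note [simp] = EX.sqi_integrable_mult EX.sqi_shf hc_sqi z_sqi
  have "(\<integral>x. (g x)\<^sup>2 \<partial>EX.S) = (\<integral>x. hc x * hc x - 2 * c * (hc x * z x) + c\<^sup>2 * (z x * z x) \<partial>EX.S)"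
    by (simp add: g_def power2_eq_square algebra_simps)
  also have "\<dots> = (\<integral>x. hc x * hc x \<partial>EX.S) - 2 * c * (\<integral>x. hc x * z x \<partial>EX.S) + c\<^sup>2"
    by (simp add: z_var)
  finally have 1: "(\<integral>x. (g x)\<^sup>2 \<partial>EX.S) = (\<integral>x. hc x * hc x \<partial>EX.S) - 2 * c * (\<integral>x. hc x * z x \<partial>EX.S) + c\<^sup>2" .
  have 2: "(\<integral>x. g x * g (shf j x) \<partial>EX.S) = (\<integral>x. hc x * hc (shf j x) \<partial>EX.S) - c * (\<integral>x. hc x * z (shf j x) \<partial>EX.S)"
    if "j \<in> {1..m-1}" for j
  proof -
    have "(\<integral>x. g x * g (shf j x) \<partial>EX.S) = (\<integral>x. hc x * hc (shf j x) - c * (hc x * z (shf j x))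
       - c * (z x * hc (shf j x)) + c\<^sup>2 * (z x * z (shf j x)) \<partial>EX.S)"
      by (simp add: g_def power2_eq_square algebra_simps)
    also have "\<dots> = (\<integral>x. hc x * hc (shf j x) \<partial>EX.S) - c * (\<integral>x. hc x * z (shf j x) \<partial>EX.S)"
      using that by (simp add: z_z_shf z_hc_shf)
    finally show ?thesis .
  qed
  have "(\<Sum>j=1..m-1. \<integral>x. g x * g (shf j x) \<partial>EX.S)
    = (\<Sum>j=1..m-1. \<integral>x. hc x * hc (shf j x) \<partial>EX.S) - c * (\<Sum>j=1..m-1. \<integral>x. hc x * z (shf j x) \<partial>EX.S)"
    using 2 by (simp add: sum_subtractf sum_distrib_left)
  also have "(\<Sum>j=1..m-1. \<integral>x. hc x * z (shf j x) \<partial>EX.S) = c - (\<integral>x. hc x * z x \<partial>EX.S)"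
    using c_split by linarith
  finally have 3: "(\<Sum>j=1..m-1. \<integral>x. g x * g (shf j x) \<partial>EX.S)
    = (\<Sum>j=1..m-1. \<integral>x. hc x * hc (shf j x) \<partial>EX.S) - c * (c - (\<integral>x. hc x * z x \<partial>EX.S))" .
  show ?thesis
    unfolding 1 3 by (simp add: algebra_simps power2_eq_square)
qed

lemma dependent_sequence_g:
  assumes "\<sigma> > 0" "n > 0"
    and lrv: "(\<integral>x. (g x)\<^sup>2 \<partial>EX.S) + 2 * (\<Sum>j=1..m-1. \<integral>x. g x * g (shf j x) \<partial>EX.S) = \<sigma>\<^sup>2"
  shows "dependent_sequence expm m (\<lambda>x. g x / (\<sigma> * sqrt n)) (\<lambda>x. (x 0 - 1) / sqrt n) (1 / real n)"
proof -
  define s where "s = 1 / (\<sigma> * sqrt n)"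
  have s: "s\<^sup>2 * \<sigma>\<^sup>2 = 1 / real n" using assms(1,2) by (simp add: s_def power_divide power_mult_distrib)
  have gs: "(\<lambda>x. g x / (\<sigma> * sqrt n)) = (\<lambda>x. s * g x)" by (simp add: s_def)
  have zs: "(\<lambda>x. (x 0 - 1) / sqrt n) = (\<lambda>x. (1 / sqrt n) * z x)" by (simp add: z_def)
  show ?thesis
    unfolding gs zs
  proof (intro dependent_sequence.intro sequence_space_expm dependent_sequence_axioms.intro)
    show "1 \<le> m" by (rule m_pos)
    show "EX.sqi (\<lambda>x. s * g x)" by (rule EX.sqi_cmult[OF g_sqi])
    show "dep m (\<lambda>x. s * g x)" by (rule dep_comp[OF g_dep])
    show "(\<integral>x. s * g x \<partial>EX.S) = 0" by (simp add: g_mean)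
    show "EX.sqi (\<lambda>x. 1 / sqrt n * z x)" by (rule EX.sqi_cmult[OF z_sqi])
    show "dep 1 (\<lambda>x. 1 / sqrt n * z x)" by (rule dep_comp[OF z_dep])
    show "(\<integral>x. 1 / sqrt n * z x \<partial>EX.S) = 0" by (simp add: z_mean)
    have "(\<integral>x. (s * g x)\<^sup>2 \<partial>EX.S) + 2 * (\<Sum>j=1..m-1. \<integral>x. s * g x * (s * g (shf j x)) \<partial>EX.S)
      = s\<^sup>2 * ((\<integral>x. (g x)\<^sup>2 \<partial>EX.S) + 2 * (\<Sum>j=1..m-1. \<integral>x. g x * g (shf j x) \<partial>EX.S))"
    proof -
      have "(\<integral>x. s * g x * (s * g (shf j x)) \<partial>EX.S) = s\<^sup>2 * (\<integral>x. g x * g (shf j x) \<partial>EX.S)" for j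
      proof -
        have "(\<integral>x. s * g x * (s * g (shf j x)) \<partial>EX.S) = (\<integral>x. s\<^sup>2 * (g x * g (shf j x)) \<partial>EX.S)"
          by (rule Bochner_Integration.integral_cong) (simp_all add: power2_eq_square ac_simps)
        then show ?thesis by (simp only: integral_mult_right_zero)
      qed
      then have "(\<Sum>j=1..m-1. \<integral>x. s * g x * (s * g (shf j x)) \<partial>EX.S) = s\<^sup>2 * (\<Sum>j=1..m-1. \<integral>x. g x * g (shf j x) \<partial>EX.S)"
        by (simp only: sum_distrib_left)
      moreover have "(\<integral>x. (s * g x)\<^sup>2 \<partial>EX.S) = s\<^sup>2 * (\<integral>x. (g x)\<^sup>2 \<partial>EX.S)"
        by (simp add: power_mult_distrib)
      ultimately show ?thesis by (simp only: distrib_left mult.left_commute)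
    qed
    then show "(\<integral>x. (s * g x)\<^sup>2 \<partial>EX.S) + 2 * (\<Sum>j=1..m-1. \<integral>x. s * g x * (s * g (shf j x)) \<partial>EX.S) = 1 / real n"
      unfolding lrv s .
    have "(\<integral>x. s * g x * (\<Sum>j<m. 1 / sqrt n * z (shf j x)) \<partial>EX.S)
      = (\<integral>x. (s * (1 / sqrt n)) * (g x * (\<Sum>j<m. z (shf j x))) \<partial>EX.S)"
      by (simp add: sum_distrib_left[symmetric] sum_divide_distrib[symmetric] ac_simps)
    also have "\<dots> = 0" unfolding integral_mult_right_zero g_csum by simp
    finally show "(\<integral>x. s * g x * (\<Sum>j<m. 1 / sqrt n * z (shf j x)) \<partial>EX.S) = 0" .
    show "0 \<le> 1 / real n" by simp
  qed
qed

end

section \<open>Identification of the given moments with integrals over sequence space\<close>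

locale exponential_sequence = prob_space P for P :: "'b measure" +
  fixes X :: "nat \<Rightarrow> 'b \<Rightarrow> real"
  assumes X_indep: "indep_vars (\<lambda>_. borel) X UNIV"
    and X_exp: "\<And>i. distributed P lborel (X i) (exponential_density 1)"
begin

definition seq :: "'b \<Rightarrow> nat \<Rightarrow> real" where "seq \<omega> = (\<lambda>i. X i \<omega>)"

lemma seq_measurable: "seq \<in> P \<rightarrow>\<^sub>M seq_borel"
  unfolding seq_def[abs_def] using distr_exponential_sequence(1)[OF prob_space_axioms X_indep X_exp] .

lemma distr_seq: "distr P seq_borel seq = EX.S"
  unfolding seq_def[abs_def] using distr_exponential_sequence(2)[OF prob_space_axioms X_indep X_exp] .

lemma
  fixes f :: "(nat \<Rightarrow> real) \<Rightarrow> real"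
  assumes f: "f \<in> borel_measurable seq_borel"
  shows integral_seq: "(\<integral>\<omega>. f (seq \<omega>) \<partial>P) = (\<integral>x. f x \<partial>EX.S)"
    and integrable_seq: "integrable P (\<lambda>\<omega>. f (seq \<omega>)) \<longleftrightarrow> integrable EX.S f"
proof -
  have "(\<integral>x. f x \<partial>distr P seq_borel seq) = (\<integral>\<omega>. f (seq \<omega>) \<partial>P)"
    by (rule integral_distr[OF seq_measurable f])
  then show "(\<integral>\<omega>. f (seq \<omega>) \<partial>P) = (\<integral>x. f x \<partial>EX.S)" by (simp only: distr_seq)
  have "integrable (distr P seq_borel seq) f \<longleftrightarrow> integrable P (\<lambda>\<omega>. f (seq \<omega>))"
    by (rule integrable_distr_eq[OF seq_measurable f])
  then show "integrable P (\<lambda>\<omega>. f (seq \<omega>)) \<longleftrightarrow> integrable EX.S f" by (simp only: distr_seq)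
qed

lemma block_0_seq: "m \<le> n \<Longrightarrow> h (block n m X 0 \<omega>) = hseq m h (seq \<omega>)"
  using block_shf[of 0 m n h X \<omega>] by (simp add: seq_def)

lemma block_seq: "h (block n m X j \<omega>) = h (block n m (\<lambda>i x. x i) j (seq \<omega>))"
  by (simp add: block_def seq_def)

lemma measurable_block:
  assumes "h \<in> borel_measurable (\<Pi>\<^sub>M i\<in>{..<m}. borel)"
  shows "(\<lambda>x. h (block n m (\<lambda>i x. x (t i)) j x)) \<in> borel_measurable seq_borel"
proof -
  have "(\<lambda>x. block n m (\<lambda>i x. x (t i)) j x) \<in> seq_borel \<rightarrow>\<^sub>M (\<Pi>\<^sub>M i\<in>{..<m}. borel :: real measure)"
    unfolding block_def by (rule measurable_restrict) simp
  then show ?thesis by (rule measurable_compose[OF _ assms])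
qed

text \<open>The bound \<open>2 * m \<le> n\<close> keeps two blocks at distance less than
  \<open>m\<close> from meeting around the circle, so that the cyclic covariances are those of an
  infinite i.i.d. sequence.\<close>

context
  fixes n m :: nat and h :: "(nat \<Rightarrow> real) \<Rightarrow> real"
  assumes bf: "block_function m h" and mn: "2 * m \<le> n"
begin

interpretation B: block_function m h by (rule bf)

lemma mean_h_eq: "mean_h P n m X h = B.\<mu>"
  using integral_seq[OF B.hseq_measurable] mn by (simp add: mean_h_def B.\<mu>_def block_0_seq)

lemma csum_integrable: "integrable EX.S (csum m)" "(\<integral>x. csum m x \<partial>EX.S) = 0"
  using csum_moments[of m] by (auto dest: spec[of _ 1])

lemma cov_sum_eq: "cov_sum P n m X h = B.c"
proof -
  have bs: "block_sum n m X 0 \<omega> = csum m (seq \<omega>) + m" for \<omega>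
  proof -
    have "nat ((0 + int i) mod int n) = i" if "i < m" for i using that mn by simp
    then have "block_sum n m X 0 \<omega> = (\<Sum>i<m. X i \<omega>)" by (simp add: block_sum_def block_def)
    then show ?thesis by (simp add: csum_def seq_def sum_subtractf)
  qed
  have mean: "(\<integral>\<omega>. csum m (seq \<omega>) + real m \<partial>P) = m"
    using integral_seq[of "\<lambda>x. csum m x + real m"] csum_integrable by (simp add: EX.P.prob_space[simplified])
  have "cov_sum P n m X h = (\<integral>\<omega>. (hseq m h (seq \<omega>) - B.\<mu>) * csum m (seq \<omega>) \<partial>P)"
    unfolding cov_sum_def cov_def bs mean
    using mean_h_eq mn by (simp add: mean_h_def block_0_seq)
  also have "\<dots> = (\<integral>x. (hseq m h x - B.\<mu>) * csum m x \<partial>EX.S)"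
    by (rule integral_seq) (use B.hseq_measurable in measurable)
  finally show ?thesis by (simp add: B.c_def B.hc_def)
qed

lemma g_fun_eq: "g_fun P n m X h \<omega> = B.g (seq \<omega>)"
  using mn by (simp add: g_fun_def mean_h_eq cov_sum_eq block_0_seq B.g_def B.hc_def B.z_def seq_def)

lemma cov_block:
  assumes l: "l < m"
  shows "cov P (\<lambda>\<omega>. h (block n m X 0 \<omega>)) (\<lambda>\<omega>. h (block n m X (int l) \<omega>)) = (\<integral>x. B.hc x * B.hc (shf l x) \<partial>EX.S)"
    and "cov P (\<lambda>\<omega>. h (block n m X 0 \<omega>)) (\<lambda>\<omega>. h (block n m X (- int l) \<omega>)) = (\<integral>x. B.hc x * B.hc (shf l x) \<partial>EX.S)"
proof -
  note [measurable] = B.hseq_measurable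
  have mu: "(\<integral>\<omega>. hseq m h (seq \<omega>) \<partial>P) = B.\<mu>"
    using integral_seq[OF B.hseq_measurable] by (simp add: B.\<mu>_def)
  have mul: "(\<integral>x. hseq m h (shf l x) \<partial>EX.S) = B.\<mu>"
    using EX.integral_shf[of "hseq m h" l] by (simp add: B.\<mu>_def)
  have "cov P (\<lambda>\<omega>. h (block n m X 0 \<omega>)) (\<lambda>\<omega>. h (block n m X (int l) \<omega>))
    = (\<integral>\<omega>. (hseq m h (seq \<omega>) - B.\<mu>) * (hseq m h (shf l (seq \<omega>)) - B.\<mu>) \<partial>P)"
  proof -
    have "(\<integral>\<omega>. hseq m h (shf l (seq \<omega>)) \<partial>P) = B.\<mu>"
      using integral_seq[of "\<lambda>x. hseq m h (shf l x)"] mul by simp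
    then show ?thesis
      unfolding cov_def using mn l by (simp add: block_0_seq block_shf mu seq_def[symmetric])
  qed
  also have "\<dots> = (\<integral>x. (hseq m h x - B.\<mu>) * (hseq m h (shf l x) - B.\<mu>) \<partial>EX.S)"
    by (rule integral_seq) measurable
  finally show "cov P (\<lambda>\<omega>. h (block n m X 0 \<omega>)) (\<lambda>\<omega>. h (block n m X (int l) \<omega>)) = (\<integral>x. B.hc x * B.hc (shf l x) \<partial>EX.S)"
    by (simp add: B.hc_def)
  have inj: "inj (rot n l)" unfolding rot_def[abs_def] by (rule inj_rotation)
  have mb [measurable]: "(\<lambda>x. h (block n m (\<lambda>i x. x i) j x)) \<in> borel_measurable seq_borel" for j
    by (rule measurable_block[OF B.h_meas, where t = "\<lambda>i. i"])
  have rb: "h (block n m (\<lambda>i x. x i) j (\<lambda>i. x (rot n l i))) = h (block n m (\<lambda>i x. x (rot n l i)) j x)" for j and x :: "nat \<Rightarrow> real"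
    by (simp add: block_def)
  note br = block_rot[of l m n h, OF _ _ B.m_pos]
  have ln: "l + m \<le> n" "l \<le> n" using l mn by auto
  have mneg: "(\<integral>\<omega>. h (block n m X (- int l) \<omega>) \<partial>P) = B.\<mu>"
  proof -
    have "(\<integral>\<omega>. h (block n m X (- int l) \<omega>) \<partial>P) = (\<integral>x. h (block n m (\<lambda>i x. x i) (- int l) x) \<partial>EX.S)"
      unfolding block_seq[of h n m] by (rule integral_seq[OF mb])
    also have "\<dots> = (\<integral>x. h (block n m (\<lambda>i x. x i) (- int l) (\<lambda>i. x (rot n l i))) \<partial>EX.S)"
      by (rule EX.integral_reindex[symmetric, OF _ inj]) measurable
    also have "\<dots> = B.\<mu>" unfolding rb by (simp add: br[OF ln] B.\<mu>_def)
    finally show ?thesis .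
  qed
  have m0: "(\<integral>\<omega>. h (block n m X 0 \<omega>) \<partial>P) = B.\<mu>"
    using mean_h_eq by (simp add: mean_h_def)
  have "cov P (\<lambda>\<omega>. h (block n m X 0 \<omega>)) (\<lambda>\<omega>. h (block n m X (- int l) \<omega>))
    = (\<integral>x. (h (block n m (\<lambda>i x. x i) 0 x) - B.\<mu>) * (h (block n m (\<lambda>i x. x i) (- int l) x) - B.\<mu>) \<partial>EX.S)"
    unfolding cov_def m0 mneg unfolding block_seq[of h n m]
    by (rule integral_seq) measurable
  also have "\<dots> = (\<integral>x. (h (block n m (\<lambda>i x. x i) 0 (\<lambda>i. x (rot n l i))) - B.\<mu>) * (h (block n m (\<lambda>i x. x i) (- int l) (\<lambda>i. x (rot n l i))) - B.\<mu>) \<partial>EX.S)"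
    by (rule EX.integral_reindex[symmetric, OF _ inj]) measurable
  also have "\<dots> = (\<integral>x. B.hc x * B.hc (shf l x) \<partial>EX.S)"
    unfolding rb by (simp add: br[OF ln] B.hc_def mult.commute)
  finally show "cov P (\<lambda>\<omega>. h (block n m X 0 \<omega>)) (\<lambda>\<omega>. h (block n m X (- int l) \<omega>)) = (\<integral>x. B.hc x * B.hc (shf l x) \<partial>EX.S)" .
qed

lemma sigma_sq_eq:
  "sigma_sq P n m X h = (\<integral>x. (B.g x)\<^sup>2 \<partial>EX.S) + 2 * (\<Sum>j=1..m-1. \<integral>x. B.g x * B.g (shf j x) \<partial>EX.S)"
proof -
  have "(\<Sum>j\<in>{- int m + 1..int m - 1}. cov P (\<lambda>\<omega>. h (block n m X 0 \<omega>)) (\<lambda>\<omega>. h (block n m X j \<omega>)))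
    = (\<integral>x. B.hc x * B.hc x \<partial>EX.S) + (\<Sum>l=1..m-1. 2 * (\<integral>x. B.hc x * B.hc (shf l x) \<partial>EX.S))"
  proof (subst sum_symmetric_int[OF B.m_pos], intro arg_cong2[where f = "(+)"] sum.cong)
    show "cov P (\<lambda>\<omega>. h (block n m X 0 \<omega>)) (\<lambda>\<omega>. h (block n m X 0 \<omega>)) = (\<integral>x. B.hc x * B.hc x \<partial>EX.S)"
      using cov_block(1)[of 0] B.m_pos by simp
    fix l assume "l \<in> {1..m-1}"
    then have "l < m" by auto
    from cov_block[OF this] show "cov P (\<lambda>\<omega>. h (block n m X 0 \<omega>)) (\<lambda>\<omega>. h (block n m X (int l) \<omega>)) +
       cov P (\<lambda>\<omega>. h (block n m X 0 \<omega>)) (\<lambda>\<omega>. h (block n m X (- int l) \<omega>)) = 2 * (\<integral>x. B.hc x * B.hc (shf l x) \<partial>EX.S)"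
      by simp
  qed simp
  then show ?thesis
    unfolding sigma_sq_def cov_sum_eq B.g_long_run by (simp add: sum_distrib_left)
qed

end

end

section \<open>Convergence in distribution\<close>

lemma weak_conv_std_normalI:
  assumes "\<forall>\<^sub>F n in sequentially. real_distribution (D n)"
    and lim: "\<And>s. (\<lambda>n. char (D n) s) \<longlonglongrightarrow> complex_of_real (exp (- (s\<^sup>2 / 2)))"
  shows "weak_conv_m D std_normal_distribution"
proof -
  obtain N where N: "\<And>n. n \<ge> N \<Longrightarrow> real_distribution (D n)"
    using assms(1) by (auto simp: eventually_sequentially)
  \<comment> \<open>Levy's theorem is applied to a tail of the sequence, since the members are
    distributions only eventually.\<close>
  have "weak_conv_m (\<lambda>n. D (n + N)) std_normal_distribution"
  proof (rule levy_continuity)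
    show "real_distribution (D (n + N))" for n by (rule N) simp
    show "real_distribution std_normal_distribution" by (rule real_dist_normal_dist)
    show "(\<lambda>n. char (D (n + N)) s) \<longlonglongrightarrow> char std_normal_distribution s" for s
      using LIMSEQ_ignore_initial_segment[OF lim[of s], of N] by (simp add: char_std_normal_distribution)
  qed
  then show ?thesis
    unfolding weak_conv_m_def weak_conv_def by (blast intro: LIMSEQ_offset[where k = N])
qed

section \<open>The two statistics on the simplex\<close>

lemma Z_stat_eq:
  "Z_stat n m h V \<omega> = (\<Sum>k<n. hseq m h (shf k (\<lambda>k. real n * spacing n V \<omega> k)))"
  "Z_star_stat n m h V \<omega> = (\<Sum>k<n - m. hseq m h (shf k (\<lambda>k. real n * spacing n V \<omega> k)))"
  by (simp_all add: Z_stat_def Z_star_stat_def hseq_def shf_def)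

context block_function
begin

lemma sum_hseq:
  "(\<Sum>k<l. hseq m h (shf k y)) = (\<Sum>k<l. g (shf k y)) + real l * \<mu> + c * (\<Sum>k<l. y k - 1)"
proof -
  have "hseq m h (shf k y) = g (shf k y) + \<mu> + c * (y k - 1)" for k
    by (simp add: g_def hc_def z_def shf_def)
  then show ?thesis by (simp add: sum.distrib sum_distrib_left)
qed

lemma normalized_statistic:
  assumes y: "(\<Sum>k<n. y k) = real n"
  shows "((\<Sum>k<n. hseq m h (shf k y)) - real n * \<mu>) / S = (\<Sum>k<n. g (shf k y) / S)"
  using y by (simp add: sum_hseq sum_subtractf sum_divide_distrib)

text \<open>As the centred coordinates of a period sum to 0, their sum over the first n - m
  positions is minus that over the last m. Hence the correction term survives here as
  \<open>c\<close> times an edge sum, besides the missing centring \<open>m * \<mu>\<close>.\<close>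

lemma normalized_statistic_star:
  assumes y: "(\<Sum>k<n. y k) = real n" and "m \<le> n"
  shows "((\<Sum>k<n-m. hseq m h (shf k y)) - real n * \<mu>) / S
    = (\<Sum>k<n. g (shf k y) / S)
      - ((\<Sum>k<m. g (shf k (shf (n - m) y)) / S) + c / S * csum m (shf (n - m) y) + real m * \<mu> / S)"
proof -
  have split: "(\<Sum>k<n. F k) = (\<Sum>k<n-m. F k) + (\<Sum>k<m. F (n - m + k))" for F :: "nat \<Rightarrow> real"
  proof -
    have "(\<Sum>k<n. F k) = (\<Sum>k<n-m. F k) + (\<Sum>k=n-m..<n. F k)"
      using sum.atLeastLessThan_concat[of 0 "n - m" n F] by (simp add: lessThan_atLeast0)
    also have "(\<Sum>k=n-m..<n. F k) = (\<Sum>k<m. F (n - m + k))"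
      by (rule sum.reindex_bij_witness[of _ "\<lambda>k. n - m + k" "\<lambda>k. k - (n - m)"]) (use assms(2) in auto)
    finally show ?thesis .
  qed
  have "(\<Sum>k<n. y k - 1) = 0" using y by (simp add: sum_subtractf)
  then have e1: "(\<Sum>k<n-m. y k - 1) = - csum m (shf (n - m) y)"
    using split[of "\<lambda>k. y k - 1"] by (simp add: csum_def shf_def)
  have e2: "(\<Sum>k<n-m. g (shf k y)) = (\<Sum>k<n. g (shf k y)) - (\<Sum>k<m. g (shf k (shf (n - m) y)))"
    using split[of "\<lambda>k. g (shf k y)"] by (simp add: add.commute)
  have "(\<Sum>k<n-m. hseq m h (shf k y)) - real n * \<mu> = (\<Sum>k<n. g (shf k y))
      - ((\<Sum>k<m. g (shf k (shf (n - m) y))) + c * csum m (shf (n - m) y) + real m * \<mu>)"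
    unfolding sum_hseq e1 e2 using assms(2) by (simp add: of_nat_diff algebra_simps)
  then show ?thesis
    by (simp add: sum_divide_distrib diff_divide_distrib add_divide_distrib)
qed

end

lemma powr_normalization:
  fixes n s :: real
  assumes "n > 0" "s > 0"
  shows "n * (a * (I / (s * sqrt n) powr r)) = a / (n powr ((r - 2) / 2) * s powr r) * I"
proof -
  have "(s * sqrt n) powr r = s powr r * n powr (r / 2)"
    using assms by (simp add: powr_mult powr_half_sqrt[symmetric] powr_powr)
  also have "n powr (r / 2) = n powr (1 + (r - 2) / 2)" by (simp add: field_simps)
  also have "\<dots> = n * n powr ((r - 2) / 2)" using assms by (simp add: powr_add)
  finally have "(s * sqrt n) powr r = n * (n powr ((r - 2) / 2) * s powr r)" by simp
  then show ?thesis using assms by simp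
qed

text \<open>Each row of the sample lives on its own space \<open>M n\<close>, whereas one sequence
  of exponentials serves all rows, as it enters through expectations only. Square integrability and
  positivity of \<sigma>_m^2, which the division by \<sigma>_m and the covariances presuppose, are
  asked for eventually.\<close>

theorem corollary2p3:
  fixes M :: "nat \<Rightarrow> 'a measure" and V :: "nat \<Rightarrow> nat \<Rightarrow> 'a \<Rightarrow> real"
    and P :: "'b measure" and X :: "nat \<Rightarrow> 'b \<Rightarrow> real"
    and m :: "nat \<Rightarrow> nat" and h :: "nat \<Rightarrow> (nat \<Rightarrow> real) \<Rightarrow> real" and r :: real
  assumes M_prob: "\<And>n. n \<ge> 1 \<Longrightarrow> prob_space (M n)"
    and V_indep: "\<And>n. n \<ge> 1 \<Longrightarrow> prob_space.indep_vars (M n) (\<lambda>_. borel) (V n) {..<n - 1}"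
    and V_unif: "\<And>n i. n \<ge> 1 \<Longrightarrow> i < n - 1 \<Longrightarrow>
                   distr (M n) lborel (V n i) = uniform_measure lborel {0..1}"
    and P_prob: "prob_space P"
    and X_indep: "prob_space.indep_vars P (\<lambda>_. borel) X UNIV"
    and X_exp: "\<And>i. distributed P lborel (X i) (exponential_density 1)"
    and m_pos: "\<And>n. n \<ge> 1 \<Longrightarrow> m n \<ge> 1"
    and m_small: "(\<lambda>n. real (m n)) \<in> o(\<lambda>n. real n)"
    and h_meas: "\<And>n. n \<ge> 1 \<Longrightarrow> h n \<in> borel_measurable (\<Pi>\<^sub>M i\<in>{..<m n}. borel)"
    and h_sq_int: "\<forall>\<^sub>F n in sequentially. integrable P (\<lambda>\<omega>. (h n (block n (m n) X 0 \<omega>))\<^sup>2)"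
    and sigma_pos: "\<forall>\<^sub>F n in sequentially. sigma_sq P n (m n) X (h n) > 0"
    and r_gt_2: "r > 2"
    and g_int: "\<forall>\<^sub>F n in sequentially. integrable P (\<lambda>\<omega>. \<bar>g_fun P n (m n) X (h n) \<omega>\<bar> powr r)"
    and g_moment:
      "(\<lambda>n. real (m n) powr (r - 1)
              / (real n powr ((r - 2) / 2) * sigma_m P n (m n) X (h n) powr r)
            * (\<integral>\<omega>. \<bar>g_fun P n (m n) X (h n) \<omega>\<bar> powr r \<partial>P)) \<longlonglongrightarrow> 0"
  shows "weak_conv_m
           (\<lambda>n. distr (M n) borel (\<lambda>\<omega>.
              (Z_stat n (m n) (h n) (V n) \<omega> - real n * mean_h P n (m n) X (h n))
                / (sigma_m P n (m n) X (h n) * sqrt (real n))))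
           std_normal_distribution
       \<and> (edge_negligible P m X h \<longrightarrow>
         weak_conv_m
           (\<lambda>n. distr (M n) borel (\<lambda>\<omega>.
              (Z_star_stat n (m n) (h n) (V n) \<omega> - real n * mean_h P n (m n) X (h n))
                / (sigma_m P n (m n) X (h n) * sqrt (real n))))
           std_normal_distribution)"
proof -
  interpret ES: exponential_sequence P X
    by (intro exponential_sequence.intro exponential_sequence_axioms.intro P_prob X_indep X_exp)
  have m_lim: "(\<lambda>n. real (m n) / real n) \<longlonglongrightarrow> 0"
    using m_small by (rule smalloD_tendsto)
  then have "\<forall>\<^sub>F n in sequentially. real (m n) / real n < 1 / 2"
    by (intro order_tendstoD) auto
  then have "\<forall>\<^sub>F n in sequentially. 2 * m n \<le> n \<and> n \<ge> 2"
    using eventually_ge_at_top[of 2]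
  proof eventually_elim
    case (elim n)
    then have "2 * real (m n) < real n" by (simp add: divide_less_eq)
    then show ?case using elim by linarith
  qed
  then have ev_bf: "\<forall>\<^sub>F n in sequentially. block_function (m n) (h n) \<and> 2 * m n \<le> n \<and> n \<ge> 2"
    using h_sq_int
  proof eventually_elim
    case (elim n)
    then have n: "n \<ge> 1" "m n \<le> n" by auto
    note hm = measurable_hseq[OF h_meas[OF n(1)]]
    have "integrable P (\<lambda>\<omega>. (hseq (m n) (h n) (ES.seq \<omega>))\<^sup>2)"
      using elim(2) n by (simp add: ES.block_0_seq)
    then have "integrable EX.S (\<lambda>x. (hseq (m n) (h n) x)\<^sup>2)"
      by (subst (asm) ES.integrable_seq[where f = "\<lambda>x. (hseq (m n) (h n) x)\<^sup>2"])
        (use hm in \<open>auto intro: borel_measurable_power\<close>)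
    then show ?case
      using elim n m_pos h_meas by (auto intro!: block_function.intro)
  qed
  define \<sigma> where "\<sigma> n = sigma_m P n (m n) X (h n)" for n
  define G where "G n x = block_function.g (m n) (h n) x / (\<sigma> n * sqrt n)" for n x
  have \<sigma>: "\<forall>\<^sub>F n in sequentially. \<sigma> n > 0 \<and> (\<sigma> n)\<^sup>2 = sigma_sq P n (m n) X (h n)"
    using sigma_pos by eventually_elim (simp add: \<sigma>_def sigma_m_def)
  have ev_g: "\<forall>\<^sub>F n in sequentially. (\<integral>\<omega>. \<bar>g_fun P n (m n) X (h n) \<omega>\<bar> powr r \<partial>P)
      = (\<integral>x. \<bar>block_function.g (m n) (h n) x\<bar> powr r \<partial>EX.S)
    \<and> integrable EX.S (\<lambda>x. \<bar>block_function.g (m n) (h n) x\<bar> powr r)"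
    using ev_bf g_int
  proof eventually_elim
    case (elim n)
    interpret B: block_function "m n" "h n" using elim by simp
    have eq: "g_fun P n (m n) X (h n) \<omega> = B.g (ES.seq \<omega>)" for \<omega>
      using elim by (intro ES.g_fun_eq) auto
    have "B.g \<in> borel_measurable EX.S" by (rule EX.sqi_measurable[OF B.g_sqi])
    then have [measurable]: "B.g \<in> borel_measurable seq_borel"
      by (simp add: measurable_cong_sets[OF sets_seq_expm refl])
    have m: "(\<lambda>x. \<bar>B.g x\<bar> powr r) \<in> borel_measurable seq_borel" by measurable
    show ?case
      using elim(2) ES.integral_seq[OF m] ES.integrable_seq[OF m] by (simp add: eq)
  qed
  interpret SA: spacing_array m G r
  proof
    show "\<forall>\<^sub>F n in sequentially. dependent_sequence expm (m n) (G n) (\<lambda>x. (x 0 - 1) / sqrt n) (1 / n)"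
      using ev_bf \<sigma>
    proof eventually_elim
      case (elim n)
      interpret B: block_function "m n" "h n" using elim by simp
      show ?case
        unfolding G_def[abs_def] using elim ES.sigma_sq_eq[of "m n" "h n" n]
        by (intro B.dependent_sequence_g) auto
    qed
    show "r > 2" by (rule r_gt_2)
    have abs_G: "\<bar>G n x\<bar> powr r = \<bar>block_function.g (m n) (h n) x\<bar> powr r / (\<sigma> n * sqrt n) powr r" if "\<sigma> n > 0" for n x
      using that by (simp add: G_def abs_divide powr_divide)
    show "\<forall>\<^sub>F n in sequentially. integrable EX.S (\<lambda>x. \<bar>G n x\<bar> powr r)"
      using ev_g \<sigma> by eventually_elim (simp add: abs_G)
    have "\<forall>\<^sub>F n in sequentially. real n * (real (m n) powr (r - 1) * (\<integral>x. \<bar>G n x\<bar> powr r \<partial>EX.S))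
      = real (m n) powr (r - 1) / (real n powr ((r - 2) / 2) * sigma_m P n (m n) X (h n) powr r)
            * (\<integral>\<omega>. \<bar>g_fun P n (m n) X (h n) \<omega>\<bar> powr r \<partial>P)"
      using ev_g \<sigma> eventually_gt_at_top[of 0]
    proof eventually_elim
      case (elim n)
      have "(\<integral>x. \<bar>G n x\<bar> powr r \<partial>EX.S) = (\<integral>\<omega>. \<bar>g_fun P n (m n) X (h n) \<omega>\<bar> powr r \<partial>P) / (\<sigma> n * sqrt n) powr r"
        using elim by (simp add: abs_G)
      then show ?case
        using elim powr_normalization[of "real n" "\<sigma> n"] by (simp only: \<sigma>_def of_nat_0_less_iff)
    qed
    then show "(\<lambda>n. real n * (real (m n) powr (r - 1) * (\<integral>x. \<bar>G n x\<bar> powr r \<partial>EX.S))) \<longlonglongrightarrow> 0"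
      using g_moment by (simp only: tendsto_cong)
    show "(\<lambda>n. real (m n) / real n) \<longlonglongrightarrow> 0" by (rule m_lim)
  qed
  \<comment> \<open>Covers both statistics: \<open>l = n\<close> gives Z and
    \<open>l = n - m n\<close> gives Z*.\<close>
  define \<Phi> where "\<Phi> l n y = ((\<Sum>k<l. hseq (m n) (h n) (shf k y)) - real n * mean_h P n (m n) X (h n)) / (\<sigma> n * sqrt (real n))"
    for l n and y :: "nat \<Rightarrow> real"
  have \<Phi>_meas: "\<Phi> l n \<in> borel_measurable seq_borel" if "n \<ge> 1" for l n
  proof -
    have [measurable]: "hseq (m n) (h n) \<in> borel_measurable seq_borel"
      by (rule measurable_hseq[OF h_meas[OF that]])
    show ?thesis unfolding \<Phi>_def[abs_def] by measurable
  qed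
  have distr_\<Phi>: "distr (M n) borel (\<lambda>\<omega>. \<Phi> l n (\<lambda>k. real n * spacing n (V n) \<omega> k)) = distr (spacing_law n) borel (\<Phi> l n)"
    if "n \<ge> 2" for l n
  proof -
    have n: "n \<ge> 1" using that by simp
    have V: "distr (M n) lborel (V n i) = uniform_measure lborel {0..1}" if "i < n - 1" for i
      by (rule V_unif[OF n that])
    have y: "(\<lambda>\<omega> k. real n * spacing n (V n) \<omega> k) \<in> M n \<rightarrow>\<^sub>M seq_borel"
      by (rule distr_spacings(1)[OF M_prob[OF n] V_indep[OF n] V that])
    have "distr (M n) seq_borel (\<lambda>\<omega> k. real n * spacing n (V n) \<omega> k) = spacing_law n"
      by (rule distr_spacings(2)[OF M_prob[OF n] V_indep[OF n] V that])
    then have "distr (spacing_law n) borel (\<Phi> l n)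
      = distr (distr (M n) seq_borel (\<lambda>\<omega> k. real n * spacing n (V n) \<omega> k)) borel (\<Phi> l n)"
      by simp
    also have "\<dots> = distr (M n) borel (\<lambda>\<omega>. \<Phi> l n (\<lambda>k. real n * spacing n (V n) \<omega> k))"
      by (simp only: distr_distr[OF \<Phi>_meas[OF n] y] comp_def)
    finally show ?thesis by simp
  qed
  have real_dist: "\<forall>\<^sub>F n in sequentially. real_distribution (distr (spacing_law n) borel (\<Phi> (l n) n))" for l
    using eventually_ge_at_top[of 1]
  proof eventually_elim
    case (elim n)
    interpret Sp: prob_space "spacing_law n" by (rule prob_space_spacing_law)
    show ?case
      unfolding real_distribution_def real_distribution_axioms_def
      using \<Phi>_meas[OF elim] by (auto intro: Sp.prob_space_distr simp: measurable_cong_sets[OF sets_spacing_law refl])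
  qed
  have char_\<Phi>: "char (distr (spacing_law n) borel (\<Phi> l n)) s = (\<integral>y. iexp (s * \<Phi> l n y) \<partial>spacing_law n)"
    if "n \<ge> 1" for l n s
    unfolding char_def using \<Phi>_meas[OF that]
    by (subst integral_distr) (auto simp: measurable_cong_sets[OF sets_spacing_law refl])
  have lim_T: "(\<lambda>n. \<integral>y. iexp (s * (\<Sum>k<n. G n (shf k y))) \<partial>spacing_law n) \<longlonglongrightarrow> complex_of_real (exp (- (s\<^sup>2 / 2)))" for s
    by (rule SA.spacing_sum_char_limit)
  have G_meas: "\<forall>\<^sub>F n in sequentially. G n \<in> borel_measurable seq_borel"
    using SA.dependent by eventually_elim (rule SA.measurable_G)
  have "weak_conv_m (\<lambda>n. distr (spacing_law n) borel (\<Phi> n n)) std_normal_distribution"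
  proof (rule weak_conv_std_normalI[OF real_dist])
    fix s
    have "\<forall>\<^sub>F n in sequentially. (\<integral>y. iexp (s * (\<Sum>k<n. G n (shf k y))) \<partial>spacing_law n) = char (distr (spacing_law n) borel (\<Phi> n n)) s"
      using ev_bf G_meas
    proof eventually_elim
      case (elim n)
      interpret B: block_function "m n" "h n" using elim by simp
      have n: "n \<ge> 1" and mean: "mean_h P n (m n) X (h n) = B.\<mu>"
        using elim ES.mean_h_eq[of "m n" "h n" n] by auto
      have [measurable]: "G n \<in> borel_measurable seq_borel" "\<Phi> n n \<in> borel_measurable seq_borel"
        using elim \<Phi>_meas[OF n] by auto
      show ?case
        unfolding char_\<Phi>[OF n]
      proof (rule integral_cong_AE)
        show "AE y in spacing_law n. iexp (s * (\<Sum>k<n. G n (shf k y))) = iexp (s * \<Phi> n n y)"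
          using AE_spacing_law[OF n]
        proof eventually_elim
          case (elim y)
          then have "\<Phi> n n y = (\<Sum>k<n. G n (shf k y))"
            unfolding \<Phi>_def G_def mean by (intro B.normalized_statistic) simp
          then show ?case by simp
        qed
      qed measurable
    qed
    from tendsto_cong[OF this] lim_T[of s]
    show "(\<lambda>n. char (distr (spacing_law n) borel (\<Phi> n n)) s) \<longlonglongrightarrow> complex_of_real (exp (- (s\<^sup>2 / 2)))"
      by simp
  qed
  moreover have "weak_conv_m (\<lambda>n. distr (spacing_law n) borel (\<Phi> (n - m n) n)) std_normal_distribution"
    if edge: "edge_negligible P m X h"
  proof (rule weak_conv_std_normalI[OF real_dist])
    fix s
    \<comment> \<open>\<open>a1\<close> is the coefficient of the edge coordinate sum and
      \<open>a2\<close> the deterministic shift. The former is weighted with sqrt m because the edge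
      sum has second moment at most 2 m.\<close>
    define a1 where "a1 n = cov_sum P n (m n) X (h n) / (\<sigma> n * sqrt n)" for n
    define a2 where "a2 n = real (m n) * mean_h P n (m n) X (h n) / (\<sigma> n * sqrt n)" for n
    have a1: "(\<lambda>n. sqrt (real (m n)) * a1 n) \<longlonglongrightarrow> 0" and a2: "a2 \<longlonglongrightarrow> 0"
      using edge by (simp_all add: edge_negligible_def a1_def a2_def[abs_def] \<sigma>_def)
    obtain b where b: "b \<longlonglongrightarrow> 0"
      "\<forall>\<^sub>F n in sequentially. integrable (spacing_law n) (\<lambda>y. (\<Sum>k<m n. G n (shf k (shf (n - m n) y)))\<^sup>2) \<and>
        (\<integral>y. (\<Sum>k<m n. G n (shf k (shf (n - m n) y)))\<^sup>2 \<partial>spacing_law n) \<le> b n"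
      using SA.edge_sum_limit by blast
    \<comment> \<open>The factor 3 comes from \<open>sq3_le\<close> and the inner factor 2 from
      \<open>edge_csum\<close>.\<close>
    define e where "e n = \<bar>s\<bar> * sqrt (3 * (b n + 2 * (sqrt (real (m n)) * a1 n)\<^sup>2 + (a2 n)\<^sup>2))" for n
    have "(\<lambda>n. \<bar>s\<bar> * sqrt (3 * (b n + 2 * (sqrt (real (m n)) * a1 n)\<^sup>2 + (a2 n)\<^sup>2))) \<longlonglongrightarrow> \<bar>s\<bar> * sqrt (3 * (0 + 2 * 0\<^sup>2 + 0\<^sup>2))"
      by (intro tendsto_intros a1 a2 b)
    then have e: "e \<longlonglongrightarrow> 0" by (simp add: e_def[abs_def])
    have "\<forall>\<^sub>F n in sequentially. cmod (char (distr (spacing_law n) borel (\<Phi> (n - m n) n)) s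
        - (\<integral>y. iexp (s * (\<Sum>k<n. G n (shf k y))) \<partial>spacing_law n)) \<le> e n"
      using ev_bf G_meas b(2) SA.edge_csum
    proof eventually_elim
      case (elim n)
      interpret B: block_function "m n" "h n" using elim by simp
      interpret Sp: prob_space "spacing_law n" by (rule prob_space_spacing_law)
      have n: "n \<ge> 1" "m n \<le> n" and mean: "mean_h P n (m n) X (h n) = B.\<mu>"
        and cov: "cov_sum P n (m n) X (h n) = B.c"
        using elim ES.mean_h_eq[of "m n" "h n" n] ES.cov_sum_eq[of "m n" "h n" n] by auto
      have [measurable]: "G n \<in> borel_measurable seq_borel" "\<Phi> (n - m n) n \<in> borel_measurable seq_borel"
        using elim \<Phi>_meas[OF n(1)] by auto
      define E1 where "E1 y = (\<Sum>k<m n. G n (shf k (shf (n - m n) y)))" for y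
      define E2 where "E2 y = csum (m n) (shf (n - m n) y)" for y
      have E1: "integrable (spacing_law n) (\<lambda>y. (E1 y)\<^sup>2)" "(\<integral>y. (E1 y)\<^sup>2 \<partial>spacing_law n) \<le> b n"
        and E2: "integrable (spacing_law n) (\<lambda>y. (E2 y)\<^sup>2)" "(\<integral>y. (E2 y)\<^sup>2 \<partial>spacing_law n) \<le> 2 * real (m n)"
        using elim unfolding E1_def E2_def by auto
      have [measurable]: "E1 \<in> borel_measurable seq_borel" "E2 \<in> borel_measurable seq_borel"
        unfolding E1_def[abs_def] E2_def[abs_def] by measurable
      define R where "R y = s * \<Phi> (n - m n) n y - s * (\<Sum>k<n. G n (shf k y))" for y
      have [measurable]: "R \<in> borel_measurable seq_borel" unfolding R_def[abs_def] by measurable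
      define Q where "Q y = s\<^sup>2 * (3 * ((E1 y)\<^sup>2 + (a1 n)\<^sup>2 * (E2 y)\<^sup>2 + (a2 n)\<^sup>2))" for y
      have R: "AE y in spacing_law n. (R y)\<^sup>2 \<le> Q y"
        using AE_spacing_law[OF n(1)]
      proof eventually_elim
        case (elim y)
        have "\<Phi> (n - m n) n y = (\<Sum>k<n. G n (shf k y)) - (E1 y + a1 n * E2 y + a2 n)"
          unfolding \<Phi>_def G_def E1_def E2_def a1_def a2_def mean cov
          using elim n by (intro B.normalized_statistic_star) auto
        then have "R y = - (s * (E1 y + a1 n * E2 y + a2 n))" by (simp add: R_def right_diff_distrib)
        then have "(R y)\<^sup>2 = s\<^sup>2 * (E1 y + a1 n * E2 y + a2 n)\<^sup>2" by (simp add: power_mult_distrib)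
        also have "\<dots> \<le> Q y"
          unfolding Q_def using sq3_le[of "E1 y" "a1 n * E2 y" "a2 n"]
          by (intro mult_left_mono) (auto simp: power_mult_distrib)
        finally show ?case .
      qed
      have Qi: "integrable (spacing_law n) Q" unfolding Q_def[abs_def] using E1(1) E2(1) by simp
      have Ri: "integrable (spacing_law n) (\<lambda>y. (R y)\<^sup>2)"
      proof (rule Bochner_Integration.integrable_bound[OF Qi])
        show "AE y in spacing_law n. norm ((R y)\<^sup>2) \<le> norm (Q y)" using R by eventually_elim simp
      qed measurable
      have "(\<integral>y. (R y)\<^sup>2 \<partial>spacing_law n) \<le> (\<integral>y. Q y \<partial>spacing_law n)"
        by (rule integral_mono_AE[OF Ri Qi R])
      also have "\<dots> = s\<^sup>2 * (3 * ((\<integral>y. (E1 y)\<^sup>2 \<partial>spacing_law n) + (a1 n)\<^sup>2 * (\<integral>y. (E2 y)\<^sup>2 \<partial>spacing_law n) + (a2 n)\<^sup>2))"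
        unfolding Q_def using E1(1) E2(1) Sp.prob_space by simp
      also have "\<dots> \<le> s\<^sup>2 * (3 * (b n + (a1 n)\<^sup>2 * (2 * real (m n)) + (a2 n)\<^sup>2))"
        using E1(2) E2(2) by (intro mult_left_mono add_mono) auto
      also have "(a1 n)\<^sup>2 * (2 * real (m n)) = 2 * (sqrt (real (m n)) * a1 n)\<^sup>2"
        by (simp add: power_mult_distrib)
      finally have "sqrt (\<integral>y. (R y)\<^sup>2 \<partial>spacing_law n) \<le> e n"
        unfolding e_def by (metis real_sqrt_le_mono real_sqrt_mult real_sqrt_abs)
      moreover have "cmod ((\<integral>y. iexp (s * \<Phi> (n - m n) n y) \<partial>spacing_law n) - (\<integral>y. iexp (s * (\<Sum>k<n. G n (shf k y))) \<partial>spacing_law n))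
        \<le> sqrt (\<integral>y. (R y)\<^sup>2 \<partial>spacing_law n)"
        using Ri unfolding R_def by (intro Sp.integral_iexp_diff_le) simp_all
      ultimately show ?case unfolding char_\<Phi>[OF n(1)] by linarith
    qed
    then have "(\<lambda>n. char (distr (spacing_law n) borel (\<Phi> (n - m n) n)) s
        - (\<integral>y. iexp (s * (\<Sum>k<n. G n (shf k y))) \<partial>spacing_law n)) \<longlonglongrightarrow> 0"
      by (rule Lim_null_comparison[OF _ e])
    from tendsto_add[OF this lim_T[of s]]
    show "(\<lambda>n. char (distr (spacing_law n) borel (\<Phi> (n - m n) n)) s) \<longlonglongrightarrow> complex_of_real (exp (- (s\<^sup>2 / 2)))"
      by simp
  qed
  \<comment> \<open>The laws are identified from \<open>n = 2\<close> on, where the sample is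
    nonempty; weak convergence does not see the earlier terms.\<close>
  moreover have cong: "weak_conv_m D std_normal_distribution"
    if "weak_conv_m D' std_normal_distribution" "\<And>n. n \<ge> 2 \<Longrightarrow> D n = D' n" for D D' :: "nat \<Rightarrow> real measure"
  proof -
    have "(\<lambda>n. cdf (D n) x) \<longlonglongrightarrow> l" if "(\<lambda>n. cdf (D' n) x) \<longlonglongrightarrow> l" for x l
    proof -
      have "\<forall>\<^sub>F n in sequentially. cdf (D n) x = cdf (D' n) x"
        using eventually_ge_at_top[of 2] by eventually_elim (simp add: \<open>\<And>n. n \<ge> 2 \<Longrightarrow> D n = D' n\<close>)
      from tendsto_cong[OF this] that show ?thesis by simp
    qed
    then show ?thesis using that(1) unfolding weak_conv_m_def weak_conv_def by blast
  qed
  have Z: "((Z_stat n (m n) (h n) (V n) \<omega> - real n * mean_h P n (m n) X (h n)) / (sigma_m P n (m n) X (h n) * sqrt (real n)))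
      = \<Phi> n n (\<lambda>k. real n * spacing n (V n) \<omega> k)"
    "((Z_star_stat n (m n) (h n) (V n) \<omega> - real n * mean_h P n (m n) X (h n)) / (sigma_m P n (m n) X (h n) * sqrt (real n)))
      = \<Phi> (n - m n) n (\<lambda>k. real n * spacing n (V n) \<omega> k)" for n \<omega>
    by (simp_all only: \<Phi>_def Z_stat_eq \<sigma>_def)
  ultimately show ?thesis
    unfolding Z by (auto intro!: cong[OF _ distr_\<Phi>])
qed

end
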